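(* Let $\underline a\in\mathbb{F}_2^{(\mathbb{Z}_{\ge0})}$ be non-zero and different from $(1,0,0,\ldots)$, and let $\varphi:M_{\underline a}^{\mathrm{ab}}\to\Omega_\infty^{\mathrm{ab}}$ be the map induced by inclusion. Then $|\ker\varphi|=2$. Moreover: \begin{enumerate} \item If $a_0=0$, then $M_{\underline a}^{\mathrm{ab}}$ is an $\mathbb{F}_2$-vector space, and the map $\sum_{i\ge0}a_i\widetilde\phi_i(x):M_{\underline a}\to\mathbb{F}_2$ is a continuous character, unique modulo restrictions of characters of $\Omega_\infty$, whose class generates $(M_{\underline a}^{\mathrm{ab}})^\vee/\big((\Omega_\infty^{\mathrm{ab}})^\vee|_{M_{\underline a}}\big)$. \item If $a_0=1$, then $M_{\underline a}^{\mathrm{ab}}$ has a cyclic direct summand of order $4$. The map $M_{\underline a}\to(\mathbb{F}_2\times\mathbb{F}_2,\star)\cong\mathbb{Z}/4\mathbb{Z}$, $\sigma\mapsto\big(\sum_{i\ge1}a_i\widetilde\phi_i(x)(\sigma),\phi_0(\sigma)\big)$, is a surjective homomorphism, unique up to restriction of characters from $\Omega_\infty$. Its double is the restriction of $\sum_{i\ge1}a_i\phi_i=\phi_0$ to $M_{\underline a}$, which is the unique non-trivial element of $2(M_{\underline a}^{\mathrm{ab}})^\vee$. \end{enumerate}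
   Context: $T_\infty$: Cayley graph of the free monoid on $\{x,y\}$ (each word $w$ joined to $xw$ and $yw$), rooted at the empty word; $L_n$ = words of length $n$; $\Omega_\infty$ its profinite automorphism group. For a word $w$, $\sigma_w\in\Omega_\infty$ is the involution fixing every word not ending in $w$ and sending $v'w\mapsto\overline{v'}w$ where $\overline{v'}$ is $v'$ with $x,y$ interchanged. Each $\sigma\in\Omega_\infty$ has a unique decomposition $\sigma=\lim_N\sigma_N\sigma_{N-1}\cdots\sigma_0$ with $\sigma_i=\prod_{w\in L_i}\sigma_w^{\varepsilon_w(\sigma)}$, $\varepsilon_w(\sigma)\in\mathbb{F}_2$. Define $\phi_i(\sigma)=\sum_{w\in L_i}\varepsilon_w(\sigma)$ (continuous homomorphisms to $\mathbb{F}_2$), and for $i\ge1$, $s\in\{x,y\}$, the (non-homomorphic) maps $\widetilde\phi_i(s)(\sigma)=\sum_{w\in L_i,\ w=v's}\varepsilon_w(\sigma)$ (sum over words of length $i$ whose last letter is $s$). $\mathbb{F}_2^{(\mathbb{Z}_{\ge0})}$ = finitely supported sequences; $M_{\underline a}=\ker(\sum_i a_i\phi_i)$. For a topological group $G$, $G^{\mathrm{ab}}$ is $G$ modulo the closed subgroup generated by commutators, and $G^\vee$ denotes the group of continuous homomorphisms to $\mathbb{Q}_2/\mathbb{Z}_2$ (for pro-2 groups). On $\mathbb{F}_2\times\mathbb{F}_2$ the group law $\star$ is $(x_1,y_1)\star(x_2,y_2)=(x_1+x_2+y_1y_2,\ y_1+y_2)$, making it cyclic of order 4. *)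

theory Defs
  imports "HOL-Analysis.Analysis" "HOL-Algebra.Algebra" "HOL-Library.Z2" "HOL-Library.Sublist"
begin

datatype letter = Lx | Ly

type_synonym word = "letter list"

fun other :: "letter \<Rightarrow> letter" where
  "other Lx = Ly"
| "other Ly = Lx"

definition adjacent :: "word \<Rightarrow> word \<Rightarrow> bool" where
  "adjacent u v \<longleftrightarrow> (\<exists>s. v = s # u \<or> u = s # v)"

definition level :: "nat \<Rightarrow> word set" where
  "level n = {w. length w = n}"

definition Omega :: "(word \<Rightarrow> word) monoid" where
  "Omega = \<lparr>carrier = {f. bij f \<and> f [] = [] \<and> (\<forall>u v. adjacent (f u) (f v) \<longleftrightarrow> adjacent u v)},
            monoid.mult = (\<circ>), monoid.one = id\<rparr>"

text \<open>The inverse limit topology of the finite groups acting on the words of length at most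
  \<open>n\<close> is the topology of pointwise convergence, with the set of words discrete.\<close>

definition Omega_top :: "(word \<Rightarrow> word) topology" where
  "Omega_top = subtopology (product_topology (\<lambda>_. discrete_topology UNIV) UNIV) (carrier Omega)"

definition sigma :: "word \<Rightarrow> word \<Rightarrow> word" where
  "sigma w u = (if suffix w u then map other (take (length u - length w) u) @ w else u)"

text \<open>The involutions \<open>sigma w\<close>, for \<open>w\<close> of a fixed length, commute, so
  the fold does not depend on an enumeration.\<close>

definition sigma_level :: "(word \<Rightarrow> bit) \<Rightarrow> nat \<Rightarrow> word \<Rightarrow> word" where
  "sigma_level e i = Finite_Set.fold (\<lambda>w f. (if e w = 1 then sigma w else id) \<circ> f) id (level i)"

fun sigma_prod :: "(word \<Rightarrow> bit) \<Rightarrow> nat \<Rightarrow> word \<Rightarrow> word" where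
  "sigma_prod e 0 = sigma_level e 0"
| "sigma_prod e (Suc N) = sigma_level e (Suc N) \<circ> sigma_prod e N"

definition eps :: "(word \<Rightarrow> word) \<Rightarrow> word \<Rightarrow> bit" where
  "eps \<sigma> = (THE e. limitin Omega_top (sigma_prod e) \<sigma> sequentially)"

definition phi :: "nat \<Rightarrow> (word \<Rightarrow> word) \<Rightarrow> bit" where
  "phi i \<sigma> = (\<Sum>w\<in>level i. eps \<sigma> w)"

definition phi_tilde :: "nat \<Rightarrow> letter \<Rightarrow> (word \<Rightarrow> word) \<Rightarrow> bit" where
  "phi_tilde i s \<sigma> = (\<Sum>w\<in>{w \<in> level i. \<exists>v. w = v @ [s]}. eps \<sigma> w)"

definition F2 :: "bit ring" where
  "F2 = \<lparr>carrier = UNIV, monoid.mult = (*), monoid.one = 1, ring.zero = 0, ring.add = (+)\<rparr>"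

definition M_set :: "(nat \<Rightarrow> bit) \<Rightarrow> (word \<Rightarrow> word) set" where
  "M_set a = kernel Omega (add_monoid F2) (\<lambda>\<sigma>. \<Sum>i\<in>{i. a i \<noteq> 0}. a i * phi i \<sigma>)"

definition M_group :: "(nat \<Rightarrow> bit) \<Rightarrow> (word \<Rightarrow> word) monoid" where
  "M_group a = Omega\<lparr>carrier := M_set a\<rparr>"

definition M_top :: "(nat \<Rightarrow> bit) \<Rightarrow> (word \<Rightarrow> word) topology" where
  "M_top a = subtopology Omega_top (M_set a)"


text \<open>A topological group is a group \<open>G\<close> together with a topology \<open>T\<close> on its carrier.\<close>

definition closed_derived :: "'g topology \<Rightarrow> 'g monoid \<Rightarrow> 'g set" where
  "closed_derived T G =
     \<Inter>{H. subgroup H G \<and> closedin T H \<and> derived_set G (carrier G) \<subseteq> H}"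

definition ab :: "'g topology \<Rightarrow> 'g monoid \<Rightarrow> 'g set monoid" where
  "ab T G = G Mod closed_derived T G"

definition ab_proj :: "'g topology \<Rightarrow> 'g monoid \<Rightarrow> 'g \<Rightarrow> 'g set" where
  "ab_proj T G g = closed_derived T G #>\<^bsub>G\<^esub> g"

definition ab_top :: "'g topology \<Rightarrow> 'g monoid \<Rightarrow> 'g set topology" where
  "ab_top T G = topology (\<lambda>U. U \<subseteq> carrier (ab T G) \<and> openin T {g \<in> topspace T. ab_proj T G g \<in> U})"

lemma openin_ab_top:
  "openin (ab_top T G) U \<longleftrightarrow>
     U \<subseteq> carrier (ab T G) \<and> openin T {g \<in> topspace T. ab_proj T G g \<in> U}"
proof -
  let ?pre = "\<lambda>U. {g \<in> topspace T. ab_proj T G g \<in> U}"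
  have "?pre (S \<inter> S') = ?pre S \<inter> ?pre S'" for S S' by auto
  moreover have "?pre (\<Union>K) = \<Union>(?pre ` K)" for K by auto
  ultimately have "istopology (\<lambda>U. U \<subseteq> carrier (ab T G) \<and> openin T (?pre U))"
    unfolding istopology_def by (auto simp del: Union_iff)
  then show ?thesis
    by (simp add: ab_top_def topology_inverse')
qed

text \<open>The map on \<open>ab T G\<close> through which \<open>f\<close> factors, if \<open>f\<close> is constant on the
  cosets of \<open>closed_derived T G\<close>.\<close>

definition ab_factor :: "'g topology \<Rightarrow> 'g monoid \<Rightarrow> ('g \<Rightarrow> 'h) \<Rightarrow> 'g set \<Rightarrow> 'h" where
  "ab_factor T G f = (\<lambda>C\<in>carrier (ab T G). the_elem (f ` C))"

text \<open>\<open>\<rat>\<^sub>2/\<int>\<^sub>2\<close> is realised as \<open>\<int>[1/2]/\<int>\<close>; its topology is discrete.\<close>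

definition dyadic_group :: "rat monoid" where
  "dyadic_group = \<lparr>carrier = {q. \<exists>k n. q = of_int k / 2 ^ n}, monoid.mult = (+), monoid.one = 0\<rparr>"

definition Q2Z2 :: "rat set monoid" where
  "Q2Z2 = dyadic_group Mod \<int>"

definition Q2Z2_of :: "rat \<Rightarrow> rat set" where
  "Q2Z2_of q = \<int> #>\<^bsub>dyadic_group\<^esub> q"

definition dual :: "'g topology \<Rightarrow> 'g monoid \<Rightarrow> ('g \<Rightarrow> rat set) monoid" where
  "dual T G =
     \<lparr>carrier = {\<psi> \<in> hom G Q2Z2 \<inter> extensional (carrier G).
                   continuous_map T (discrete_topology (carrier Q2Z2)) \<psi>},
      monoid.mult = (\<lambda>\<psi> \<eta>. \<lambda>g\<in>carrier G. \<psi> g \<otimes>\<^bsub>Q2Z2\<^esub> \<eta> g),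
      monoid.one = (\<lambda>g\<in>carrier G. \<one>\<^bsub>Q2Z2\<^esub>)\<rparr>"

definition Omega_ab :: "(word \<Rightarrow> word) set monoid" where
  "Omega_ab = ab Omega_top Omega"

definition Omega_dual :: "((word \<Rightarrow> word) set \<Rightarrow> rat set) monoid" where
  "Omega_dual = dual (ab_top Omega_top Omega) Omega_ab"

definition M_ab :: "(nat \<Rightarrow> bit) \<Rightarrow> (word \<Rightarrow> word) set monoid" where
  "M_ab a = ab (M_top a) (M_group a)"

definition M_ab_top :: "(nat \<Rightarrow> bit) \<Rightarrow> (word \<Rightarrow> word) set topology" where
  "M_ab_top a = ab_top (M_top a) (M_group a)"

definition M_dual :: "(nat \<Rightarrow> bit) \<Rightarrow> ((word \<Rightarrow> word) set \<Rightarrow> rat set) monoid" where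
  "M_dual a = dual (M_ab_top a) (M_ab a)"

definition M_ab_map :: "(nat \<Rightarrow> bit) \<Rightarrow> (word \<Rightarrow> word) set \<Rightarrow> (word \<Rightarrow> word) set" where
  "M_ab_map a = ab_factor (M_top a) (M_group a) (ab_proj Omega_top Omega)"

definition restricted_characters :: "(nat \<Rightarrow> bit) \<Rightarrow> ((word \<Rightarrow> word) set \<Rightarrow> rat set) set" where
  "restricted_characters a =
     (\<lambda>\<psi>. \<lambda>C\<in>carrier (M_ab a). \<psi> (M_ab_map a C)) ` carrier Omega_dual"

definition star_group :: "(bit \<times> bit) monoid" where
  "star_group = \<lparr>carrier = UNIV,
     monoid.mult = (\<lambda>(x1, y1) (x2, y2). (x1 + x2 + y1 * y2, y1 + y2)), monoid.one = (0, 0)\<rparr>"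

text \<open>Maps from \<open>M_group a\<close> to \<open>F\<^sub>2\<close> and to \<open>(F\<^sub>2 \<times> F\<^sub>2, \<star>)\<close> are turned into elements of
  the dual through the embeddings \<open>u \<mapsto> u/2\<close> and \<open>(u, v) \<mapsto> u/2 + v/4\<close> into \<open>\<rat>\<^sub>2/\<int>\<^sub>2\<close>.\<close>

definition F2_embed :: "bit \<Rightarrow> rat set" where
  "F2_embed u = Q2Z2_of (if u = 1 then 1/2 else 0)"

definition star_embed :: "bit \<times> bit \<Rightarrow> rat set" where
  "star_embed = (\<lambda>(u, v). Q2Z2_of ((if u = 1 then 1/2 else 0) + (if v = 1 then 1/4 else 0)))"

definition F2_character :: "(nat \<Rightarrow> bit) \<Rightarrow> ((word \<Rightarrow> word) \<Rightarrow> bit) \<Rightarrow> (word \<Rightarrow> word) set \<Rightarrow> rat set" where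
  "F2_character a f = ab_factor (M_top a) (M_group a) (F2_embed \<circ> f)"

definition star_character ::
    "(nat \<Rightarrow> bit) \<Rightarrow> ((word \<Rightarrow> word) \<Rightarrow> bit \<times> bit) \<Rightarrow> (word \<Rightarrow> word) set \<Rightarrow> rat set" where
  "star_character a f = ab_factor (M_top a) (M_group a) (star_embed \<circ> f)"

text \<open>The fields \<open>mult\<close> and \<open>one\<close> of a module record play no role.\<close>

definition F2_vector_space :: "'g monoid \<Rightarrow> bool" where
  "F2_vector_space G \<longleftrightarrow>
     (\<exists>s. Module.module F2
        \<lparr>carrier = carrier G, monoid.mult = mult G, monoid.one = \<one>\<^bsub>G\<^esub>,
          ring.zero = \<one>\<^bsub>G\<^esub>, ring.add = mult G, module.smult = s\<rparr>)"

text \<open>The summands are closed, so that for compact Hausdorff \<open>G\<close> the decomposition is one of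
  topological groups.\<close>

definition has_cyclic_summand :: "'g topology \<Rightarrow> 'g monoid \<Rightarrow> nat \<Rightarrow> bool" where
  "has_cyclic_summand T G n \<longleftrightarrow>
     (\<exists>A B. subgroup A G \<and> subgroup B G \<and> closedin T A \<and> closedin T B \<and>
        A \<inter> B = {\<one>\<^bsub>G\<^esub>} \<and> A <#>\<^bsub>G\<^esub> B = carrier G \<and>
        card A = n \<and> (\<exists>g\<in>carrier G. A = generate G {g}))"

definition character_x :: "(nat \<Rightarrow> bit) \<Rightarrow> (word \<Rightarrow> word) \<Rightarrow> bit" where
  "character_x a \<sigma> = (\<Sum>i\<in>{i. a i \<noteq> 0}. a i * phi_tilde i Lx \<sigma>)"

definition star_map :: "(nat \<Rightarrow> bit) \<Rightarrow> (word \<Rightarrow> word) \<Rightarrow> bit \<times> bit" where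
  "star_map a \<sigma> = (\<Sum>i\<in>{i. 1 \<le> i \<and> a i \<noteq> 0}. a i * phi_tilde i Lx \<sigma>, phi 0 \<sigma>)"

end

theory Submission
  imports Defs
begin

text \<open>
  Write an automorphism as \<open>f (s # u) = flip (p u) s # f u\<close>; then \<open>eps\<close> is the discrete derivative
  of the portrait \<open>p\<close> along the tree, whence
  \<open>eps (f \<circ> g) (f u) = eps f (f u) + eps g u\<close>. Summing over a level shows that \<open>phi i\<close> is a
  homomorphism and that \<open>phi_tilde i s\<close> has the coboundary \<open>phi 0 f * phi i g\<close>. On the kernel
  \<open>M\<close> of \<open>\<Sum>i. a i * phi i\<close> the coboundary of \<open>\<Sum>i\<ge>1. a i * phi_tilde i x\<close> therefore becomes
  \<open>a 0 * phi 0 f * phi 0 g\<close>.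

  For the upper bound on the kernel let \<open>D\<close> be the closed derived subgroup of \<open>M\<close> and
  \<open>\<tau> = sigma w\<close> an involution outside \<open>M\<close>. An element \<open>m\<close> of \<open>M\<close> with \<open>phi 0 m = 0\<close> is a pair of
  automorphisms of the two branches of the tree, and it, or each of its two components,
  lies in \<open>M\<close> and commutes with some element outside \<open>M\<close>. Hence \<open>\<tau>\<close> commutes modulo \<open>D\<close> with an
  index two subgroup of \<open>M\<close>, and all commutators of \<open>\<Omega>\<close> lie in \<open>D \<union> D\<zeta>\<close> for a single commutator
  \<open>\<zeta> = [\<tau>, \<mu>]\<close>. The function above takes the value \<open>1\<close> at \<open>\<zeta>\<close>, so \<open>\<zeta> \<notin> D\<close>. Since squares of \<open>\<Omega>\<close> lie in
  its closed derived subgroup and characters of \<open>M\<close> killing \<open>\<zeta>\<close> extend to \<open>\<Omega>\<close>, a character of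
  \<open>M\<close> is determined up to restrictions by its value at \<open>\<zeta>\<close>.
\<close>

section \<open>The automorphism group of the tree\<close>

text \<open>Words grow at the front, so the last letter of a word names the branch at the root that
  contains it, and \<open>phi_tilde i x\<close> is the share of \<open>phi i\<close> carried by one
  branch. An automorphism swaps the branches exactly when \<open>phi 0\<close> is 1 on it; this is
  the whole source of the coboundary \<open>phi 0 f * phi i g\<close>. On M what remains,
  \<open>a 0 * phi 0 f * phi 0 g\<close>, is zero or the carry cocycle of Z/4, which is why the
  distinguished character takes values in (1/2)Z/Z for \<open>a 0 = 0\<close> and in (1/4)Z/Z for
  \<open>a 0 = 1\<close>. The obstacle is to see that commutators of Omega add only one coset to D.
  What helps is that M has index 2: all elements outside M induce the same conjugation on M/D up to
  inner automorphisms, which are trivial there, so the partner commuting with a given m may be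
  chosen freely outside M. Squares enter because Omega is topologically generated by commuting
  families of involutions: a square of M is trivial or \<open>\<zeta>\<close> modulo D, so a
  character of M can fail to have order 2 only through its value at \<open>\<zeta>\<close>.\<close>

declare add_bit_eq_xor [simp del] mult_bit_eq_and [simp del]

lemma bit_add_self [simp]: "(b :: bit) + b = 0" "b + (b + c) = c"
  by (cases b; cases c; simp)+

section \<open>Automorphisms as portraits\<close>

definition flip :: "bit \<Rightarrow> letter \<Rightarrow> letter" where
  "flip b s = (if b = 1 then other s else s)"

lemma other_other [simp]: "other (other s) = s"
  by (cases s) auto

lemma other_neq [simp]: "other s \<noteq> s" "s \<noteq> other s"
  by (cases s; simp)+

lemma neq_iff_other: "s \<noteq> t \<longleftrightarrow> t = other s"
  by (cases s; cases t) auto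

lemma flip_0 [simp]: "flip 0 s = s"
  by (simp add: flip_def)

lemma flip_1 [simp]: "flip 1 s = other s"
  by (simp add: flip_def)

lemma flip_flip [simp]: "flip b (flip c s) = flip (b + c) s"
  by (cases b; cases c) auto

lemma flip_eq_iff [simp]: "flip b s = flip b t \<longleftrightarrow> s = t"
  by (cases b; cases s; cases t) auto

lemma flip_eq_flip_iff [simp]: "flip b s = flip c s \<longleftrightarrow> b = c"
  by (cases b; cases c) auto

lemma finite_level [simp]: "finite (level n)"
proof -
  have "finite (UNIV :: letter set)"
    by (rule finite_subset[of _ "{Lx, Ly}"]) (use letter.exhaust in auto)
  from finite_lists_length_eq[OF this, of n] show ?thesis
    by (simp add: level_def)
qed

text \<open>The tail \<open>u\<close> is the parent of \<open>s # u\<close>, and \<open>p u\<close>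
  records whether the edges below \<open>u\<close> are interchanged. The bit is read at the source
  vertex, not at its image, which produces the shift \<open>p (act q u)\<close> in
  \<open>comp_act\<close>. No condition is imposed on \<open>p\<close>: every such function is the
  portrait of an automorphism.\<close>

fun act :: "(word \<Rightarrow> bit) \<Rightarrow> word \<Rightarrow> word" where
  "act p [] = []"
| "act p (s # u) = flip (p u) s # act p u"

definition portrait :: "(word \<Rightarrow> word) \<Rightarrow> word \<Rightarrow> bit" where
  "portrait f u = (if f (Lx # u) = Lx # f u then 0 else 1)"

lemma length_act [simp]: "length (act p u) = length u"
  by (induction u) auto

lemma act_eq_iff [simp]: "act p u = act p v \<longleftrightarrow> u = v"
proof (induction u arbitrary: v)
  case Nil
  then show ?case by (cases v) auto
next
  case (Cons s u)
  then show ?case by (cases v) (simp, metis act.simps(2) flip_eq_iff list.inject)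
qed

lemma act_surj: "\<exists>u. act p u = v"
proof (induction v)
  case Nil
  then show ?case by (metis act.simps(1))
next
  case (Cons t v)
  then obtain u where "act p u = v" by blast
  then have "act p (flip (p u) t # u) = t # v" by simp
  then show ?case by blast
qed

lemma act_eq_Cons_iff: "act p v = t # act p u \<longleftrightarrow> (\<exists>s. v = s # u \<and> t = flip (p u) s)"
  by (cases v) auto

lemma act_in_Omega [simp]: "act p \<in> carrier Omega"
proof -
  have "adjacent (act p u) (act p v) \<longleftrightarrow> adjacent u v" for u v
    unfolding adjacent_def by (auto simp: act_eq_Cons_iff)
  moreover have "bij (act p)"
    unfolding bij_def inj_def surj_def by (metis act_eq_iff act_surj)
  ultimately show ?thesis by (simp add: Omega_def)
qed

lemma portrait_act [simp]: "portrait (act p) = p"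
  by (rule ext) (auto simp: portrait_def flip_def)

text \<open>Membership in \<open>Omega\<close> only asks that adjacency be preserved and the root
  fixed, so the point is that a child must go to a child. Once this is known, injectivity leaves one
  bit of freedom at each vertex.\<close>

lemma Omega_eq_act:
  assumes "f \<in> carrier Omega"
  shows "f = act (portrait f)"
proof
  have f: "bij f" "f [] = []" "\<And>u v. adjacent (f u) (f v) \<longleftrightarrow> adjacent u v"
    using assms by (auto simp: Omega_def)
  have inj: "f u = f v \<longleftrightarrow> u = v" for u v
    using f(1) by (meson bij_is_inj inj_eq)
  have ex: "\<exists>t. f (s # u) = t # f u" for s u
  proof (induction u arbitrary: s)
    case Nil
    have "adjacent (f []) (f [s])" unfolding f(3) by (simp add: adjacent_def)
    then show ?case by (auto simp: adjacent_def f(2))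
  next
    case (Cons r u)
    have "adjacent (f (r # u)) (f (s # r # u))" unfolding f(3) by (simp add: adjacent_def)
    \<comment> \<open>Adjacency leaves the parent of \<open>f (r # u)\<close> as the other
      candidate. By the induction hypothesis this parent is \<open>f u\<close>, so injectivity would
      identify \<open>u\<close> with its own grandchild.\<close>
    moreover have "f (r # u) \<noteq> t # f (s # r # u)" for t
    proof
      assume "f (r # u) = t # f (s # r # u)"
      moreover obtain t' where "f (r # u) = t' # f u" using Cons by blast
      ultimately have "u = s # r # u" by (simp add: inj)
      then have "length u = length (s # r # u)" by (rule arg_cong)
      then show False by simp
    qed
    ultimately show ?case by (auto simp: adjacent_def)
  qed
  have step: "f (s # u) = flip (portrait f u) s # f u" for s u
  proof -
    obtain t t' where t: "f (Lx # u) = t # f u" "f (Ly # u) = t' # f u"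
      using ex by blast
    with inj have "t \<noteq> t'" by (metis letter.distinct(1) list.inject)
    with t show ?thesis
      by (cases s; cases t; cases t') (auto simp: portrait_def)
  qed
  show "f u = act (portrait f) u" for u
    by (induction u) (simp_all add: step f(2))
qed

lemma Omega_cases:
  assumes "f \<in> carrier Omega"
  obtains p where "f = act p"
  using Omega_eq_act[OF assms] by blast

lemma Omega_Nil: "f \<in> carrier Omega \<Longrightarrow> f [] = []"
  by (auto elim: Omega_cases)

lemma Omega_Cons: "f \<in> carrier Omega \<Longrightarrow> f (s # u) = flip (portrait f u) s # f u"
  by (auto elim: Omega_cases)

lemma length_Omega: "f \<in> carrier Omega \<Longrightarrow> length (f u) = length u"
  by (auto elim: Omega_cases)

lemma Omega_eq_iff: "f \<in> carrier Omega \<Longrightarrow> f u = f v \<longleftrightarrow> u = v"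
  by (auto elim: Omega_cases)

text \<open>The last letter belongs to the edge at the root, so the bit at \<open>[]\<close> is the
  only one that touches it.\<close>

lemma last_Omega:
  assumes f: "f \<in> carrier Omega" and "u \<noteq> []"
  shows "last (f u) = flip (portrait f []) (last u)"
  using assms(2)
proof (induction u)
  case (Cons s u)
  then show ?case
    using length_Omega[OF f, of u]
    by (cases "u = []") (auto simp: Omega_Cons[OF f] Omega_Nil[OF f])
qed simp

lemma Omega_bij_betw_level:
  assumes "f \<in> carrier Omega" shows "bij_betw f (level i) (level i)"
proof -
  have "inj_on f (level i)" by (simp add: inj_on_def Omega_eq_iff[OF assms])
  moreover have "f ` level i \<subseteq> level i" by (auto simp: level_def length_Omega[OF assms])
  ultimately show ?thesis
    by (simp add: bij_betw_def endo_inj_surj)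
qed

lemma comp_act: "act p \<circ> act q = act (\<lambda>u. q u + p (act q u))"
proof
  show "(act p \<circ> act q) u = act (\<lambda>u. q u + p (act q u)) u" for u
    by (induction u) (auto simp: add.commute)
qed

lemma comp_in_Omega [simp]: "f \<in> carrier Omega \<Longrightarrow> g \<in> carrier Omega \<Longrightarrow> f \<circ> g \<in> carrier Omega"
  by (auto elim!: Omega_cases simp: comp_act)

lemma portrait_comp:
  assumes "f \<in> carrier Omega" "g \<in> carrier Omega"
  shows "portrait (f \<circ> g) u = portrait g u + portrait f (g u)"
  using assms by (auto elim!: Omega_cases simp: comp_act)

lemma Omega_mult: "f \<otimes>\<^bsub>Omega\<^esub> g = f \<circ> g"
  by (simp add: Omega_def)

lemma Omega_one: "\<one>\<^bsub>Omega\<^esub> = id"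
  by (simp add: Omega_def)

lemma id_in_Omega [simp]: "id \<in> carrier Omega"
  by (simp add: Omega_def)

lemma group_Omega: "group Omega"
proof (rule groupI)
  fix f assume f: "f \<in> carrier Omega"
  then have b: "bij f" by (simp add: Omega_def)
  then have 1: "f (inv_into UNIV f u) = u" for u by (simp add: bij_is_surj surj_f_inv_f)
  have "adjacent (inv_into UNIV f u) (inv_into UNIV f v) \<longleftrightarrow> adjacent u v" for u v
  proof -
    have "adjacent (f (inv_into UNIV f u)) (f (inv_into UNIV f v)) \<longleftrightarrow>
      adjacent (inv_into UNIV f u) (inv_into UNIV f v)"
      using f by (simp add: Omega_def)
    then show ?thesis by (simp add: 1)
  qed
  moreover have "inv_into UNIV f [] = []"
    by (metis 1 Omega_Nil[OF f] Omega_eq_iff[OF f])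
  ultimately have "inv_into UNIV f \<in> carrier Omega"
    using b by (simp add: Omega_def bij_imp_bij_inv)
  moreover have "inv_into UNIV f \<circ> f = id"
    using b by (simp add: bij_is_inj)
  ultimately show "\<exists>g\<in>carrier Omega. g \<otimes>\<^bsub>Omega\<^esub> f = \<one>\<^bsub>Omega\<^esub>"
    by (auto simp: Omega_mult Omega_one)
qed (auto simp: comp_assoc Omega_mult Omega_one)

subsection \<open>The involutions \<open>sigma w\<close>\<close>

text \<open>\<open>sigma w\<close> interchanges every letter in front of \<open>w\<close>, so its
  portrait is the indicator of the whole subtree at \<open>w\<close> and not of the single vertex
  \<open>w\<close>. This is why \<open>eps\<close> is a difference of portrait bits.\<close>

lemma sigma_eq_act: "sigma w = act (\<lambda>u. if suffix w u then 1 else 0)"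
proof
  show "sigma w u = act (\<lambda>u. if suffix w u then 1 else 0) u" for u
  proof (induction u)
    case Nil
    then show ?case by (simp add: sigma_def)
  next
    case (Cons s u)
    show ?case
    proof (cases "suffix w u")
      case True
      then have "length w \<le> length u" by (rule suffix_length_le)
      with True show ?thesis
        using Cons by (auto simp: sigma_def Suc_diff_le suffix_ConsI)
    next
      case False
      then show ?thesis
        using Cons by (auto simp: sigma_def suffix_Cons)
    qed
  qed
qed

lemma sigma_in_Omega [simp]: "sigma w \<in> carrier Omega"
  by (simp add: sigma_eq_act)

lemma portrait_sigma: "portrait (sigma w) u = (if suffix w u then 1 else 0)"
  by (simp add: sigma_eq_act)

lemma sigma_self [simp]: "sigma w w = w"
  by (simp add: sigma_def)

lemma sigma_sigma [simp]: "sigma w \<circ> sigma w = id"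
  by (auto simp: fun_eq_iff sigma_def suffix_def comp_def)

lemma act_drop: "act p (drop n u) = drop n (act p u)"
proof (induction u arbitrary: n)
  case (Cons s u)
  then show ?case by (cases n) auto
qed simp

lemma act_trivial: "(\<And>v. length v < length u \<Longrightarrow> p v = 0) \<Longrightarrow> act p u = u"
  by (induction u) auto

lemma act_zero [simp]: "act (\<lambda>u. 0) = id"
  by (auto simp: fun_eq_iff act_trivial)

lemma suffix_iff_drop: "suffix w u \<longleftrightarrow> length w \<le> length u \<and> drop (length u - length w) u = w"
  by (auto simp: suffix_def intro: exI[of _ "take (length u - length w) u"])
     (metis append_take_drop_id)

lemma suffix_act:
  assumes "\<And>v. length v < length w \<Longrightarrow> p v = 0"
  shows "suffix w (act p u) \<longleftrightarrow> suffix w u"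
  using act_trivial[of "drop (length u - length w) u" p] assms
  by (auto simp: suffix_iff_drop simp flip: act_drop)

text \<open>For words of equal length the portraits of the factors add: a product of such factors
  fixes all words of length at most \<open>i\<close>, hence does not move the ancestor at level
  \<open>i\<close> on which the next factor depends. That ancestor of \<open>u\<close> is
  \<open>drop (length u - i) u\<close>.\<close>

lemma sigma_level_eq_act:
  "sigma_level e i = act (\<lambda>u. if i \<le> length u then e (drop (length u - i) u) else 0)"
proof -
  define F where "F = (\<lambda>w f. (if e w = 1 then sigma w else id) \<circ> (f :: word \<Rightarrow> word))"
  define P where "P = (\<lambda>S u. \<Sum>w\<in>S. if suffix w u then e w else 0)"
  have comm: "comp_fun_commute_on (level i) F"
  proof
    fix v w assume "v \<in> level i" "w \<in> level i"
    then have "suffix v (act (\<lambda>u. if suffix w u then 1 else 0) u) \<longleftrightarrow> suffix v u"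
      "suffix w (act (\<lambda>u. if suffix v u then 1 else 0) u) \<longleftrightarrow> suffix w u" for u
      by (auto intro!: suffix_act simp: level_def) (auto dest!: suffix_length_le)
    then have "sigma v \<circ> sigma w = sigma w \<circ> sigma v"
      unfolding sigma_eq_act comp_act by (simp add: add.commute)
    then show "F w \<circ> F v = F v \<circ> F w"
      by (auto simp: F_def fun_eq_iff)
  qed
  \<comment> \<open>The claim is made for all subsets of the level, since the fold is unwound one
    element at a time.\<close>
  have "Finite_Set.fold F id S = act (P S)"
    if "finite S" "S \<subseteq> level i" for S
    using that
  proof (induction S rule: finite_induct)
    case empty
    then show ?case by (simp add: P_def)
  next
    case (insert w S)
    then have w: "length w = i" by (simp add: level_def)
    have P: "P S v = 0" if "length v < length w" for v
      unfolding P_def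
    proof (rule sum.neutral, rule ballI)
      fix w' assume "w' \<in> S"
      then have "length w' = i" using insert.prems by (auto simp: level_def)
      then have "\<not> suffix w' v" using that w suffix_length_le[of w' v] by auto
      then show "(if suffix w' v then e w' else 0) = 0" by simp
    qed
    have "(if e w = 1 then sigma w else id) = act (\<lambda>u. if suffix w u then e w else 0)"
    proof (cases "e w = 1")
      case False
      then have "(\<lambda>u. if suffix w u then e w else 0) = (\<lambda>u. 0)" by auto
      with False show ?thesis by simp
    qed (simp add: sigma_eq_act cong: if_cong)
    then have "F w (act (P S)) = act (\<lambda>u. if suffix w u then e w else 0) \<circ> act (P S)"
      by (simp add: F_def)
    also have "\<dots> = act (P (insert w S))"
      using insert.hyps by (simp add: comp_act suffix_act[OF P]) (simp add: P_def add.commute)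
    also have "act (P S) = Finite_Set.fold F id S"
      using insert.prems by (intro insert.IH[symmetric]) auto
    also have "F w (Finite_Set.fold F id S) = Finite_Set.fold F id (insert w S)"
      using insert.hyps insert.prems
      by (intro comp_fun_commute_on.fold_insert[OF comm, symmetric]) auto
    finally show ?case .
  qed
  from this[OF finite_level subset_refl] have "sigma_level e i = act (P (level i))"
    by (simp add: sigma_level_def F_def)
  also have "P (level i) u = (if i \<le> length u then e (drop (length u - i) u) else 0)" for u
  proof -
    have "P (level i) u = (\<Sum>w\<in>level i. if i \<le> length u \<and> drop (length u - i) u = w then e w else 0)"
      unfolding P_def by (intro sum.cong refl) (simp add: suffix_iff_drop level_def)
    also have "\<dots> = (if i \<le> length u then e (drop (length u - i) u) else 0)"
    proof (cases "i \<le> length u")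
      case True
      then have "drop (length u - i) u \<in> level i" by (simp add: level_def)
      with True show ?thesis by (simp add: sum.delta')
    qed simp
    finally show ?thesis .
  qed
  then have "act (P (level i)) = act (\<lambda>u. if i \<le> length u then e (drop (length u - i) u) else 0)"
    by presburger
  finally show ?thesis .
qed


text \<open>The portrait depends only on the ancestor at level \<open>i\<close>, which the map
  fixes. That all factors of the decomposition are involutions is what later puts squares into the
  closed derived subgroup.\<close>

lemma sigma_level_sigma_level: "sigma_level e i \<circ> sigma_level e i = id"
proof -
  define p where "p = (\<lambda>u. if i \<le> length u then e (drop (length u - i) u) else 0)"
  have "p (act p u) = p u" for u
  proof (cases "i \<le> length u")
    case True
    then have "act p (drop (length u - i) u) = drop (length u - i) u"
      by (intro act_trivial) (simp add: p_def)
    with True show ?thesis by (simp add: p_def flip: act_drop)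
  qed (simp add: p_def)
  then have "act p \<circ> act p = id" by (simp add: comp_act)
  then show ?thesis unfolding sigma_level_eq_act p_def .
qed

subsection \<open>The decomposition of an automorphism\<close>

lemma act_cong: "(\<And>v. length v < length u \<Longrightarrow> p v = q v) \<Longrightarrow> act p u = act q u"
  by (induction u) auto

lemma sigma_prod_in_Omega [simp]: "sigma_prod e N \<in> carrier Omega"
proof (induction N)
  case (Suc N)
  then show ?case
    by (simp only: sigma_prod.simps sigma_level_eq_act comp_in_Omega act_in_Omega)
qed (simp add: sigma_level_eq_act)

lemma portrait_sigma_prod_0: "portrait (sigma_prod e 0) u = e []"
  by (simp add: sigma_level_eq_act)

lemma portrait_sigma_prod_Suc:
  "portrait (sigma_prod e (Suc N)) u = portrait (sigma_prod e N) u +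
     (if Suc N \<le> length u then e (drop (length u - Suc N) (sigma_prod e N u)) else 0)"
proof -
  have "portrait (sigma_prod e (Suc N)) u =
    portrait (sigma_prod e N) u + portrait (sigma_level e (Suc N)) (sigma_prod e N u)"
    by (simp add: portrait_comp sigma_level_eq_act)
  then show ?thesis
    by (simp add: sigma_level_eq_act length_Omega[OF sigma_prod_in_Omega])
qed

text \<open>The factors up to level \<open>N\<close> flip whole subtrees, so from depth
  \<open>N\<close> on a vertex passes its bit to its children. Taken at \<open>N = length u\<close>,
  this lets only the factor at the level of \<open>r # u\<close> survive in the difference of the
  two bits.\<close>

lemma portrait_sigma_prod_Cons:
  "N \<le> length u \<Longrightarrow> portrait (sigma_prod e N) (r # u) = portrait (sigma_prod e N) u"
proof (induction N)
  case 0
  then show ?case by (simp only: portrait_sigma_prod_0)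
next
  case (Suc N)
  then have "drop (length (r # u) - Suc N) (sigma_prod e N (r # u)) =
    drop (length u - Suc N) (sigma_prod e N u)"
    by (simp add: Omega_Cons[OF sigma_prod_in_Omega] drop_Cons' Suc_diff_Suc)
  with Suc show ?case
    by (simp only: portrait_sigma_prod_Suc) simp
qed

lemma portrait_sigma_prod_stable:
  "length u \<le> N \<Longrightarrow> portrait (sigma_prod e (N + k)) u = portrait (sigma_prod e N) u"
  by (induction k) (simp_all only: add_Suc_right portrait_sigma_prod_Suc, auto)

text \<open>The bit at \<open>u\<close> is final once the factors up to level
  \<open>length u\<close> have been applied, so this diagonal choice of the index yields the limit
  of the partial products.\<close>

definition sigma_lim :: "(word \<Rightarrow> bit) \<Rightarrow> word \<Rightarrow> word" where
  "sigma_lim e = act (\<lambda>u. portrait (sigma_prod e (length u)) u)"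

lemma sigma_lim_in_Omega [simp]: "sigma_lim e \<in> carrier Omega"
  by (simp add: sigma_lim_def)

text \<open>The bound is \<open>Suc N\<close> and not \<open>N\<close> because the image of a word
  uses the portrait only at strictly shorter words.\<close>

lemma sigma_prod_eq_lim:
  assumes "length u \<le> Suc N"
  shows "sigma_prod e N u = sigma_lim e u"
proof -
  have "sigma_prod e N u = act (portrait (sigma_prod e N)) u"
    using Omega_eq_act[OF sigma_prod_in_Omega, of e N] by (rule fun_cong)
  also have "\<dots> = sigma_lim e u"
    unfolding sigma_lim_def
  proof (rule act_cong)
    fix v :: word assume "length v < length u"
    with assms show "portrait (sigma_prod e N) v = portrait (sigma_prod e (length v)) v"
      using portrait_sigma_prod_stable[of v "length v" e "N - length v"] by simp
  qed
  finally show ?thesis .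
qed

lemma portrait_sigma_lim_Nil: "portrait (sigma_lim e) [] = e []"
  by (simp add: sigma_lim_def portrait_sigma_prod_0 del: sigma_prod.simps)

text \<open>\<open>e\<close> is read at the image of \<open>r # u\<close>: the factor at this level
  acts after the lower ones, which have already moved the vertex to its final position.\<close>

lemma portrait_sigma_lim_Cons:
  "portrait (sigma_lim e) (r # u) = portrait (sigma_lim e) u + e (sigma_lim e (r # u))"
proof -
  have "portrait (sigma_prod e (Suc (length u))) (r # u) =
    portrait (sigma_prod e (length u)) u + e (sigma_lim e (r # u))"
    by (simp add: portrait_sigma_prod_Suc portrait_sigma_prod_Cons sigma_prod_eq_lim
        del: sigma_prod.simps)
  then show ?thesis
    by (simp add: sigma_lim_def del: sigma_prod.simps act.simps)
qed

lemma Omega_obtain: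
  assumes "f \<in> carrier Omega" obtains v where "f v = w"
  using assms by (elim Omega_cases) (use act_surj in blast)

lemma sigma_lim_inject:
  assumes "sigma_lim e = sigma_lim e'" shows "e = e'"
proof
  fix w
  obtain v where v: "sigma_lim e v = w"
    using Omega_obtain[OF sigma_lim_in_Omega] .
  show "e w = e' w"
  proof (cases v)
    case Nil
    with v have "w = []" by (simp add: Omega_Nil[OF sigma_lim_in_Omega])
    then show ?thesis using portrait_sigma_lim_Nil assms by metis
  next
    case (Cons r u)
    with v show ?thesis
      using portrait_sigma_lim_Cons[of e r u] portrait_sigma_lim_Cons[of e' r u] assms by simp
  qed
qed

lemma Omega_eq_sigma_lim:
  assumes f: "f \<in> carrier Omega"
  obtains e where "f = sigma_lim e"
proof
  \<comment> \<open>The derivative of the portrait, transported by the given \<open>f\<close>.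
    Prescribing \<open>e\<close> at \<open>f v\<close> avoids the circularity of reading
    \<open>e\<close> at images under the map under construction.\<close>
  define d where "d v = (case v of [] \<Rightarrow> portrait f [] | r # u \<Rightarrow> portrait f (r # u) + portrait f u)" for v
  define e where "e w = d (inv_into UNIV f w)" for w
  have e: "e (f v) = d v" for v
    using f by (simp add: e_def Omega_eq_iff[OF f] inj_def)
  \<comment> \<open>Bits and images are compared together, since the recursion for the bit at
    \<open>r # u\<close> needs to know that both maps send \<open>r # u\<close> to the same
    vertex.\<close>
  have "portrait f u = portrait (sigma_lim e) u \<and> f u = sigma_lim e u" for u
  proof (induction u)
    case Nil
    have "e [] = portrait f []"
      using e[of "[]"] by (simp add: d_def Omega_Nil[OF f])
    then show ?case
      by (simp add: portrait_sigma_lim_Nil Omega_Nil[OF f] Omega_Nil[OF sigma_lim_in_Omega])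
  next
    case (Cons r u)
    then have eq: "f (r # u) = sigma_lim e (r # u)"
      by (simp add: Omega_Cons[OF f] Omega_Cons[OF sigma_lim_in_Omega])
    have "portrait (sigma_lim e) (r # u) = portrait f u + d (r # u)"
      using Cons by (simp add: portrait_sigma_lim_Cons e flip: eq)
    then show ?case by (simp add: eq d_def)
  qed
  then show "f = sigma_lim e" by auto
qed

lemma topspace_Omega_top [simp]: "topspace Omega_top = carrier Omega"
  by (simp add: Omega_top_def)

lemma limitin_Omega_top_iff:
  "limitin Omega_top F f sequentially \<longleftrightarrow> f \<in> carrier Omega \<and>
     (\<forall>\<^sub>F n in sequentially. F n \<in> carrier Omega) \<and> (\<forall>u. \<forall>\<^sub>F n in sequentially. F n u = f u)"
proof -
  have "limitin (discrete_topology UNIV) (\<lambda>n. F n u) (f u) sequentially \<longleftrightarrow>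
    (\<forall>\<^sub>F n in sequentially. F n u = f u)" for u
    unfolding limitin_def by (auto elim: eventually_mono dest: spec[of _ "{f u}"])
  then show ?thesis
    by (simp add: Omega_top_def limitin_subtopology limitin_componentwise)
qed

lemma limitin_sigma_prod_iff:
  "limitin Omega_top (sigma_prod e) f sequentially \<longleftrightarrow> f = sigma_lim e"
proof -
  have ev: "\<forall>\<^sub>F n in sequentially. sigma_prod e n u = sigma_lim e u" for u
    by (rule eventually_sequentiallyI[of "length u"]) (simp add: sigma_prod_eq_lim)
  have "f u = sigma_lim e u" if "\<forall>\<^sub>F n in sequentially. sigma_prod e n u = f u" for u
    using eventually_conj[OF that ev[of u]] by (metis (mono_tags) eventually_happens' sequentially_bot)
  with ev show ?thesis
    by (auto simp: limitin_Omega_top_iff)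
qed

lemma eps_sigma_lim [simp]: "eps (sigma_lim e) = e"
  unfolding eps_def limitin_sigma_prod_iff
  by (rule the_equality) (auto dest: sigma_lim_inject)

lemma eps_Nil: "f \<in> carrier Omega \<Longrightarrow> eps f [] = portrait f []"
  by (auto elim!: Omega_eq_sigma_lim simp: portrait_sigma_lim_Nil)

lemma eps_Cons:
  "f \<in> carrier Omega \<Longrightarrow> eps f (f (r # u)) = portrait f (r # u) + portrait f u"
  by (auto elim!: Omega_eq_sigma_lim simp: portrait_sigma_lim_Cons)

lemma sigma_prod_limit:
  assumes "f \<in> carrier Omega"
  shows "limitin Omega_top (sigma_prod (eps f)) f sequentially"
  using assms by (auto elim!: Omega_eq_sigma_lim simp: limitin_sigma_prod_iff)

text \<open>The identity is indexed by \<open>f u\<close> because \<open>g\<close> contributes at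
  the vertex before \<open>f\<close> moves it. A preimage of \<open>u\<close> under \<open>g\<close>
  turns every term into a difference of portrait bits, to which the crossed product rule
  \<open>portrait_comp\<close> applies.\<close>

lemma eps_comp:
  assumes f: "f \<in> carrier Omega" and g: "g \<in> carrier Omega"
  shows "eps (f \<circ> g) (f u) = eps f (f u) + eps g u"
proof -
  obtain v where v: "g v = u" using Omega_obtain[OF g] .
  have fg: "f \<circ> g \<in> carrier Omega" using f g by simp
  show ?thesis
  proof (cases v)
    case Nil
    with v have "u = []" by (simp add: Omega_Nil[OF g])
    then show ?thesis
      by (simp add: portrait_comp[OF f g] Omega_Nil[OF f] Omega_Nil[OF g] eps_Nil[OF f] eps_Nil[OF g] eps_Nil[OF fg] add.commute)
  next
    case (Cons r w)
    have "eps f (f (g (r # w))) = portrait f (g (r # w)) + portrait f (g w)"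
      by (simp add: Omega_Cons[OF g] eps_Cons[OF f])
    moreover have "eps (f \<circ> g) (f (g (r # w))) = portrait (f \<circ> g) (r # w) + portrait (f \<circ> g) w"
      using eps_Cons[OF fg, of r w] by simp
    ultimately show ?thesis
      using v Cons eps_Cons[OF g, of r w]
      by (simp add: portrait_comp[OF f g] algebra_simps)
  qed
qed

text \<open>The portrait is the indicator of a subtree, so a vertex and its parent differ only at
  the apex \<open>w\<close>.\<close>

lemma eps_sigma: "eps (sigma w) v = (if v = w then 1 else 0)"
proof -
  obtain u where u: "sigma w u = v" using Omega_obtain[OF sigma_in_Omega] .
  have "eps (sigma w) (sigma w u) = (if u = w then 1 else 0)"
  proof (cases u)
    case Nil
    then show ?thesis
      using eps_Nil[OF sigma_in_Omega, of w]
      by (auto simp: Omega_Nil[OF sigma_in_Omega] portrait_sigma)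
  next
    case (Cons r x)
    have "\<not> suffix (r # x) x" by (auto dest: suffix_length_le)
    with Cons show ?thesis
      by (auto simp: eps_Cons[OF sigma_in_Omega] portrait_sigma suffix_Cons)
  qed
  moreover have "sigma w u = w \<longleftrightarrow> u = w"
    using Omega_eq_iff[OF sigma_in_Omega, of w u w] by simp
  ultimately show ?thesis using u by auto
qed

subsection \<open>The functions \<open>phi\<close> and \<open>phi_tilde\<close>\<close>

lemma phi_comp:
  assumes f: "f \<in> carrier Omega" and g: "g \<in> carrier Omega"
  shows "phi i (f \<circ> g) = phi i f + phi i g"
proof -
  have "phi i (f \<circ> g) = (\<Sum>u\<in>level i. eps (f \<circ> g) (f u))"
    unfolding phi_def by (rule sum.reindex_bij_betw[OF Omega_bij_betw_level[OF f], symmetric])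
  also have "\<dots> = (\<Sum>u\<in>level i. eps f (f u)) + phi i g"
    by (simp add: eps_comp[OF f g] sum.distrib phi_def)
  also have "(\<Sum>u\<in>level i. eps f (f u)) = phi i f"
    unfolding phi_def by (rule sum.reindex_bij_betw[OF Omega_bij_betw_level[OF f]])
  finally show ?thesis .
qed

lemma phi_0: "f \<in> carrier Omega \<Longrightarrow> phi 0 f = portrait f []"
  by (simp add: phi_def level_def eps_Nil)

lemma phi_sigma: "phi i (sigma w) = (if i = length w then 1 else 0)"
proof -
  have "phi i (sigma w) = (if w \<in> level i then 1 else 0)"
    unfolding phi_def eps_sigma by (rule sum.delta) simp
  then show ?thesis by (auto simp: level_def)
qed

lemma phi_tilde_alt:
  assumes "1 \<le> i"
  shows "phi_tilde i s f = (\<Sum>w\<in>{w \<in> level i. last w = s}. eps f w)"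
proof -
  have "(\<exists>v. w = v @ [s]) \<longleftrightarrow> last w = s" if "w \<in> level i" for w
  proof -
    have "w \<noteq> []" using that assms by (auto simp: level_def)
    then show ?thesis by (metis append_butlast_last_id last_snoc)
  qed
  then have "{w \<in> level i. \<exists>v. w = v @ [s]} = {w \<in> level i. last w = s}" by blast
  then show ?thesis by (simp add: phi_tilde_def)
qed

text \<open>Reindexing the sum by \<open>f\<close> replaces the words ending in \<open>s\<close> by
  those that \<open>f\<close> sends to them; these end in \<open>other s\<close> if \<open>f\<close>
  swaps the branches at the root.\<close>

lemma phi_tilde_comp:
  assumes f: "f \<in> carrier Omega" and g: "g \<in> carrier Omega" and i: "1 \<le> i"
  shows "phi_tilde i s (f \<circ> g) = phi_tilde i s f + phi_tilde i (flip (phi 0 f) s) g"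
proof -
  let ?A = "{w \<in> level i. last w = s}" and ?B = "{w \<in> level i. last w = flip (phi 0 f) s}"
  have last: "last (f w) = s \<longleftrightarrow> last w = flip (phi 0 f) s" if "w \<in> level i" for w
  proof -
    have "w \<noteq> []" using that i by (auto simp: level_def)
    then have "last (f w) = flip (phi 0 f) (last w)"
      using f by (simp add: last_Omega phi_0)
    then show ?thesis by (cases "phi 0 f"; cases s; cases "last w") auto
  qed
  have bij: "bij_betw f ?B ?A"
  proof -
    have "f ` ?B \<subseteq> ?A"
      using last by (auto simp: level_def length_Omega[OF f])
    moreover have "w \<in> f ` ?B" if w: "w \<in> ?A" for w
    proof -
      obtain v where v: "f v = w" using Omega_obtain[OF f] .
      then have "v \<in> level i" using w by (auto simp: level_def length_Omega[OF f])
      then have "v \<in> ?B" using w v last by auto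
      then show ?thesis using v by blast
    qed
    ultimately have "f ` ?B = ?A" by blast
    then show ?thesis
      by (auto simp: bij_betw_def inj_on_def Omega_eq_iff[OF f])
  qed
  have "phi_tilde i s (f \<circ> g) = (\<Sum>u\<in>?B. eps (f \<circ> g) (f u))"
    unfolding phi_tilde_alt[OF i] by (rule sum.reindex_bij_betw[OF bij, symmetric])
  also have "\<dots> = (\<Sum>u\<in>?B. eps f (f u)) + phi_tilde i (flip (phi 0 f) s) g"
    by (simp add: eps_comp[OF f g] sum.distrib phi_tilde_alt[OF i])
  also have "(\<Sum>u\<in>?B. eps f (f u)) = phi_tilde i s f"
    unfolding phi_tilde_alt[OF i] by (rule sum.reindex_bij_betw[OF bij])
  finally show ?thesis .
qed

lemma phi_tilde_add:
  assumes "1 \<le> i" shows "phi_tilde i s f + phi_tilde i (other s) f = phi i f"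
proof -
  have "phi i f = (\<Sum>w\<in>{w \<in> level i. last w = s} \<union> {w \<in> level i. last w = other s}. eps f w)"
    unfolding phi_def by (rule sum.cong) (auto, metis neq_iff_other)
  also have "\<dots> = phi_tilde i s f + phi_tilde i (other s) f"
    unfolding phi_tilde_alt[OF assms] by (rule sum.union_disjoint) auto
  finally show ?thesis by simp
qed

text \<open>If \<open>f\<close> swaps the branches, the contribution of \<open>g\<close> comes from
  the other half of the level, which differs from the expected half by the full sum
  \<open>phi i g\<close>.\<close>

lemma phi_tilde_cocycle:
  assumes "f \<in> carrier Omega" "g \<in> carrier Omega" "1 \<le> i"
  shows "phi_tilde i s (f \<circ> g) = phi_tilde i s f + phi_tilde i s g + phi 0 f * phi i g"
proof (cases "phi 0 f = 1")
  case True
  have "phi_tilde i (other s) g = phi_tilde i s g + phi i g"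
    by (simp flip: phi_tilde_add[OF assms(3), of s g])
  with True show ?thesis by (simp add: phi_tilde_comp[OF assms] add.assoc)
qed (simp add: phi_tilde_comp[OF assms])

text \<open>\<open>eps f w\<close> is read off from the bits at the preimage of \<open>w\<close> and
  at its parent. Seeing the former takes the image of a child of that preimage, hence the bound
  \<open>Suc (length w)\<close>.\<close>

lemma eps_cong:
  assumes f: "f \<in> carrier Omega" and g: "g \<in> carrier Omega"
    and eq: "\<And>u. length u \<le> Suc (length w) \<Longrightarrow> f u = g u"
  shows "eps f w = eps g w"
proof -
  obtain v where v: "f v = w" using Omega_obtain[OF f] .
  then have [simp]: "length w = length v" by (auto simp: length_Omega[OF f])
  have p: "portrait f u = portrait g u" if "length u \<le> length v" for u
    using that by (simp add: portrait_def eq)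
  show ?thesis
  proof (cases v)
    case Nil
    with v have "w = []" by (simp add: Omega_Nil[OF f])
    then show ?thesis by (simp add: eps_Nil f g p)
  next
    case (Cons r u)
    have "g v = w" using v eq[of v] by simp
    then show ?thesis
      using v Cons eps_Cons[OF f, of r u] eps_Cons[OF g, of r u] by (simp add: p)
  qed
qed

lemma phi_cong:
  assumes "f \<in> carrier Omega" "g \<in> carrier Omega" "\<And>u. length u \<le> Suc i \<Longrightarrow> f u = g u"
  shows "phi i f = phi i g"
  unfolding phi_def using assms by (intro sum.cong refl eps_cong) (auto simp: level_def)

lemma phi_tilde_cong:
  assumes "f \<in> carrier Omega" "g \<in> carrier Omega" "\<And>u. length u \<le> Suc i \<Longrightarrow> f u = g u"
  shows "phi_tilde i s f = phi_tilde i s g"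
  unfolding phi_tilde_def using assms by (intro sum.cong refl eps_cong) (auto simp: level_def)

subsection \<open>Continuity of functions on \<open>Omega\<close>\<close>

lemma finite_words: "finite {u :: word. length u \<le> n}"
proof -
  have "{u :: word. length u \<le> n} = (\<Union>i\<le>n. level i)" by (auto simp: level_def)
  then show ?thesis by simp
qed

text \<open>There are finitely many words of length at most \<open>n\<close>, so agreement on them
  defines an open neighbourhood, and a function of bounded depth is locally constant.\<close>

lemma continuous_map_Omega_discrete:
  assumes "\<And>f g. f \<in> carrier Omega \<Longrightarrow> g \<in> carrier Omega \<Longrightarrow>
    (\<And>u. length u \<le> n \<Longrightarrow> f u = g u) \<Longrightarrow> F f = F g"
  shows "continuous_map Omega_top (discrete_topology UNIV) F"
proof -
  have "openin Omega_top {f \<in> carrier Omega. F f \<in> U}" for U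
  proof (subst openin_subopen, intro ballI)
    fix f assume f: "f \<in> {f \<in> carrier Omega. F f \<in> U}"
    define B where "B = PiE UNIV (\<lambda>u. if length u \<le> n then {f u} else UNIV)"
    have "openin (product_topology (\<lambda>_. discrete_topology UNIV) UNIV) B"
      unfolding B_def
      by (rule product_topology_basis) (auto intro: finite_subset[OF _ finite_words[of n]])
    then have "openin Omega_top (B \<inter> carrier Omega)"
      by (auto simp: Omega_top_def openin_subtopology)
    moreover have "f \<in> B" by (auto simp: B_def)
    moreover have "g \<in> {f \<in> carrier Omega. F f \<in> U}" if g: "g \<in> B \<inter> carrier Omega" for g
    proof -
      have "g u = f u" if "length u \<le> n" for u
      proof -
        have "g u \<in> (if length u \<le> n then {f u} else UNIV)"
          using g by (auto simp: B_def PiE_iff)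
        then show ?thesis using that by simp
      qed
      then have "F g = F f" using f g by (intro assms) auto
      then show ?thesis using f g by simp
    qed
    ultimately show "\<exists>T. openin Omega_top T \<and> f \<in> T \<and> T \<subseteq> {f \<in> carrier Omega. F f \<in> U}"
      using f by (intro exI[of _ "B \<inter> carrier Omega"]) auto
  qed
  then show ?thesis by (simp add: continuous_map_def)
qed

lemma continuous_map_Omega_Omega:
  assumes "\<And>f. f \<in> carrier Omega \<Longrightarrow> F f \<in> carrier Omega"
    and "\<And>u f g. f \<in> carrier Omega \<Longrightarrow> g \<in> carrier Omega \<Longrightarrow>
      (\<And>v. length v \<le> length u \<Longrightarrow> f v = g v) \<Longrightarrow> F f u = F g u"
  shows "continuous_map Omega_top Omega_top F"
proof -
  have "continuous_map Omega_top (discrete_topology UNIV) (\<lambda>f. F f u)" for u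
    by (rule continuous_map_Omega_discrete[of "length u"]) (rule assms(2))
  then have "continuous_map Omega_top (product_topology (\<lambda>_. discrete_topology UNIV) UNIV) F"
    by (simp add: continuous_map_componentwise_UNIV)
  with assms(1) show ?thesis
    by (subst (2) Omega_top_def) (auto simp: continuous_map_in_subtopology)
qed

lemma continuous_map_Omega_mult_left:
  assumes "a \<in> carrier Omega" shows "continuous_map Omega_top Omega_top (\<lambda>f. a \<circ> f)"
  using assms by (intro continuous_map_Omega_Omega) auto

lemma continuous_map_Omega_mult_right:
  assumes "a \<in> carrier Omega" shows "continuous_map Omega_top Omega_top (\<lambda>f. f \<circ> a)"
  using assms by (intro continuous_map_Omega_Omega) (auto simp: length_Omega[OF assms])

lemma continuous_map_Omega_square: "continuous_map Omega_top Omega_top (\<lambda>f. f \<circ> f)"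
proof (rule continuous_map_Omega_Omega)
  fix u :: word and f g assume "f \<in> carrier Omega" "g \<in> carrier Omega"
    and eq: "\<And>v. length v \<le> length u \<Longrightarrow> f v = g v"
  then show "(f \<circ> f) u = (g \<circ> g) u"
    using eq[of u] eq[of "g u"] length_Omega[of g u] by simp
qed simp

lemma continuous_map_phi: "continuous_map Omega_top (discrete_topology UNIV) (phi i)"
  by (rule continuous_map_Omega_discrete[of "Suc i"]) (rule phi_cong)

section \<open>Abelianizations and duals of topologized groups\<close>

subsection \<open>Maps into discrete spaces\<close>

text \<open>\<open>dual\<close> asks for continuity into the discrete space on
  \<open>carrier Q2Z2\<close>, whereas pointwise combinations are handled with the discrete space on
  \<open>UNIV\<close>; this moves between the two.\<close>

lemma continuous_map_discrete_iff:
  "continuous_map T (discrete_topology S) f \<longleftrightarrow>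
     continuous_map T (discrete_topology UNIV) f \<and> f ` topspace T \<subseteq> S"
proof -
  have "discrete_topology S = subtopology (discrete_topology UNIV) S" by simp
  then show ?thesis
    by (metis continuous_map_in_subtopology image_subset_iff_funcset)
qed

lemma continuous_map_discrete_combine:
  assumes f: "continuous_map T (discrete_topology UNIV) f"
    and g: "continuous_map T (discrete_topology UNIV) g"
  shows "continuous_map T (discrete_topology UNIV) (\<lambda>x. h (f x) (g x))"
proof -
  have "openin T {x \<in> topspace T. h (f x) (g x) \<in> U}" for U
  proof -
    have "{x \<in> topspace T. h (f x) (g x) \<in> U} =
      (\<Union>(a, b)\<in>{(a, b). h a b \<in> U}. {x \<in> topspace T. f x \<in> {a}} \<inter> {x \<in> topspace T. g x \<in> {b}})"
      by auto
    also have "openin T \<dots>"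
    proof (intro openin_Union ballI; clarsimp)
      fix a b
      have "openin T {x \<in> topspace T. f x \<in> U}" for U
        using f by (simp add: continuous_map_def)
      moreover have "openin T {x \<in> topspace T. g x \<in> U}" for U
        using g by (simp add: continuous_map_def)
      ultimately have "openin T ({x \<in> topspace T. f x \<in> {a}} \<inter> {x \<in> topspace T. g x \<in> {b}})"
        by (intro openin_Int)
      then show "openin T ({x \<in> topspace T. f x = a} \<inter> {x \<in> topspace T. g x = b})"
        by simp
    qed
    finally show ?thesis .
  qed
  then show ?thesis by (simp add: continuous_map_def)
qed

lemma continuous_map_discrete_comp:
  "continuous_map T (discrete_topology UNIV) f \<Longrightarrow> continuous_map T (discrete_topology UNIV) (\<lambda>x. h (f x))"
  using continuous_map_discrete_combine[of T f f "\<lambda>x _. h x"] .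

lemma continuous_map_discrete_sum:
  fixes f :: "'i \<Rightarrow> 'a \<Rightarrow> 'b::comm_monoid_add"
  assumes "\<And>i. i \<in> I \<Longrightarrow> continuous_map T (discrete_topology UNIV) (f i)"
  shows "continuous_map T (discrete_topology UNIV) (\<lambda>x. \<Sum>i\<in>I. f i x)"
  using assms
proof (induction I rule: infinite_finite_induct)
  case (insert i I)
  then show ?case
    using continuous_map_discrete_combine[of T "f i" "\<lambda>x. \<Sum>i\<in>I. f i x" "(+)"] by simp
qed simp_all

subsection \<open>Abelianizations\<close>

text \<open>The topology is tied to the group only through the carrier, so that abelianizations with
  their quotient topology are instances at once. Where continuity of translations matters, as in
  \<open>finite_closedin_ab_top\<close>, it appears as an explicit assumption.\<close>

locale topologized_group = group G for G :: "'g monoid" (structure) +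
  fixes T :: "'g topology"
  assumes topspace_eq: "topspace T = carrier G"
begin

lemma closed_derived_family_nonempty:
  "{H. subgroup H G \<and> closedin T H \<and> derived_set G (carrier G) \<subseteq> H} \<noteq> {}"
proof -
  have "carrier G \<in> {H. subgroup H G \<and> closedin T H \<and> derived_set G (carrier G) \<subseteq> H}"
    using derived_set_in_carrier[of "carrier G"] closedin_topspace[of T]
    by (simp add: subgroup_self topspace_eq)
  then show ?thesis by blast
qed

lemma subgroup_closed_derived: "subgroup (closed_derived T G) G"
  unfolding closed_derived_def
  by (rule subgroups_Inter[OF _ closed_derived_family_nonempty]) simp

lemma closedin_closed_derived: "closedin T (closed_derived T G)"
  unfolding closed_derived_def
  by (rule closedin_Inter[OF closed_derived_family_nonempty]) simp

lemma commutator_in_closed_derived: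
  "g \<in> carrier G \<Longrightarrow> h \<in> carrier G \<Longrightarrow> g \<otimes> h \<otimes> inv g \<otimes> inv h \<in> closed_derived T G"
  unfolding closed_derived_def by auto

lemma closed_derived_subset:
  assumes "subgroup H G" "closedin T H"
    and "\<And>g h. g \<in> carrier G \<Longrightarrow> h \<in> carrier G \<Longrightarrow> g \<otimes> h \<otimes> inv g \<otimes> inv h \<in> H"
  shows "closed_derived T G \<subseteq> H"
  unfolding closed_derived_def using assms by (intro Inter_lower) auto

lemma closed_derived_in_carrier: "d \<in> closed_derived T G \<Longrightarrow> d \<in> carrier G"
  using subgroup.mem_carrier[OF subgroup_closed_derived] .

text \<open>Any subgroup containing all commutators is normal, since \<open>x h x^-1\<close> is the
  commutator of \<open>x\<close> and \<open>h\<close> times \<open>h\<close>.\<close>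

lemma normal_closed_derived: "closed_derived T G \<lhd> G"
proof -
  have "x \<otimes> h \<otimes> inv x \<in> closed_derived T G"
    if x: "x \<in> carrier G" and h: "h \<in> closed_derived T G" for x h
  proof -
    have hG: "h \<in> carrier G" using h by (rule closed_derived_in_carrier)
    have "x \<otimes> h \<otimes> inv x \<otimes> inv h \<otimes> h \<in> closed_derived T G"
      using commutator_in_closed_derived[OF x hG] h
      by (rule subgroup.m_closed[OF subgroup_closed_derived])
    then show ?thesis using x hG by (simp add: m_assoc)
  qed
  then show ?thesis by (simp add: normal_inv_iff subgroup_closed_derived)
qed

lemma ab_proj_hom: "ab_proj T G \<in> hom G (ab T G)"
  using normal.r_coset_hom_Mod[OF normal_closed_derived] unfolding ab_proj_def ab_def by simp

lemma carrier_ab: "carrier (ab T G) = ab_proj T G ` carrier G"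
  unfolding ab_def ab_proj_def by (simp add: carrier_FactGroup)

lemma ab_proj_in_ab [simp]: "g \<in> carrier G \<Longrightarrow> ab_proj T G g \<in> carrier (ab T G)"
  by (simp add: carrier_ab)

lemma ab_proj_mult:
  "g \<in> carrier G \<Longrightarrow> h \<in> carrier G \<Longrightarrow> ab_proj T G g \<otimes>\<^bsub>ab T G\<^esub> ab_proj T G h = ab_proj T G (g \<otimes> h)"
  using ab_proj_hom by (simp add: hom_mult)

lemma one_ab: "\<one>\<^bsub>ab T G\<^esub> = closed_derived T G"
  by (simp add: ab_def)

lemma ab_proj_eq_one_iff: "g \<in> carrier G \<Longrightarrow> ab_proj T G g = \<one>\<^bsub>ab T G\<^esub> \<longleftrightarrow> g \<in> closed_derived T G"
  unfolding one_ab ab_proj_def using subgroup_closed_derived coset_join1 coset_join2 by blast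

lemma ab_proj_eq_iff:
  assumes "g \<in> carrier G" "h \<in> carrier G"
  shows "ab_proj T G g = ab_proj T G h \<longleftrightarrow> g \<otimes> inv h \<in> closed_derived T G"
proof
  assume "ab_proj T G g = ab_proj T G h"
  then have "g \<in> closed_derived T G #> h"
    using rcos_self[OF assms(1) subgroup_closed_derived] by (simp add: ab_proj_def)
  then show "g \<otimes> inv h \<in> closed_derived T G"
    using subgroup.rcos_module_imp[OF subgroup_closed_derived is_group assms(2)] by blast
next
  assume "g \<otimes> inv h \<in> closed_derived T G"
  then have "g \<in> closed_derived T G #> h"
    using subgroup.rcos_module_rev[OF subgroup_closed_derived is_group assms(2,1)] by blast
  then show "ab_proj T G g = ab_proj T G h"
    using repr_independence[OF _ assms(2) subgroup_closed_derived] by (simp add: ab_proj_def)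
qed

lemma comm_group_ab: "comm_group (ab T G)"
proof (rule group.group_comm_groupI)
  show "group (ab T G)"
    unfolding ab_def using normal_closed_derived by (rule normal.factorgroup_is_group)
  fix x y assume "x \<in> carrier (ab T G)" "y \<in> carrier (ab T G)"
  then obtain g h where gh: "g \<in> carrier G" "h \<in> carrier G" "x = ab_proj T G g" "y = ab_proj T G h"
    by (auto simp: carrier_ab)
  have "g \<otimes> h \<otimes> inv (h \<otimes> g) \<in> closed_derived T G"
    using commutator_in_closed_derived[OF gh(1,2)] gh by (simp add: inv_mult_group m_assoc)
  then show "x \<otimes>\<^bsub>ab T G\<^esub> y = y \<otimes>\<^bsub>ab T G\<^esub> x"
    using gh by (simp add: ab_proj_mult ab_proj_eq_iff)
qed

lemma topspace_ab_top: "topspace (ab_top T G) = carrier (ab T G)"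
proof -
  have "{g \<in> topspace T. ab_proj T G g \<in> carrier (ab T G)} = topspace T"
    by (auto simp: topspace_eq)
  then have "openin (ab_top T G) (carrier (ab T G))" by (simp add: openin_ab_top)
  then show ?thesis
    unfolding topspace_def by (auto simp: openin_ab_top)
qed

lemma continuous_map_ab_top_iff:
  "continuous_map (ab_top T G) (discrete_topology UNIV) \<psi> \<longleftrightarrow>
     continuous_map T (discrete_topology UNIV) (\<lambda>g. \<psi> (ab_proj T G g))"
proof -
  have "{g \<in> topspace T. ab_proj T G g \<in> {x \<in> carrier (ab T G). \<psi> x \<in> U}} =
    {g \<in> topspace T. \<psi> (ab_proj T G g) \<in> U}" for U
    by (auto simp: topspace_eq)
  then show ?thesis
    by (simp add: continuous_map_def topspace_ab_top openin_ab_top)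
qed

text \<open>The kernel of \<open>\<xi>\<close> is closed, as points of a discrete space are, and
  contains all commutators because \<open>A\<close> is abelian.\<close>

lemma closed_derived_trivial:
  assumes \<xi>: "\<xi> \<in> hom G A" and A: "comm_group A"
    and cont: "continuous_map T (discrete_topology UNIV) \<xi>"
    and d: "d \<in> closed_derived T G"
  shows "\<xi> d = \<one>\<^bsub>A\<^esub>"
proof -
  interpret A: comm_group A by fact
  interpret h: group_hom G A \<xi> by unfold_locales (rule \<xi>)
  have "closedin T {g \<in> topspace T. \<xi> g \<in> {\<one>\<^bsub>A\<^esub>}}"
    by (rule closedin_continuous_map_preimage[OF cont]) simp
  then have "closedin T (kernel G A \<xi>)"
    by (simp add: kernel_def topspace_eq)
  moreover have "g \<otimes> h \<otimes> inv g \<otimes> inv h \<in> kernel G A \<xi>"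
    if "g \<in> carrier G" "h \<in> carrier G" for g h
    using that A.m_comm[of "\<xi> g" "\<xi> h"] by (simp add: kernel_def A.m_assoc)
  ultimately have "closed_derived T G \<subseteq> kernel G A \<xi>"
    using h.subgroup_kernel by (intro closed_derived_subset) auto
  with d show ?thesis by (auto simp: kernel_def)
qed

lemma ab_factor_proj:
  assumes "\<And>g h. g \<in> carrier G \<Longrightarrow> h \<in> carrier G \<Longrightarrow> ab_proj T G g = ab_proj T G h \<Longrightarrow> f g = f h"
    and g: "g \<in> carrier G"
  shows "ab_factor T G f (ab_proj T G g) = f g"
proof -
  have gg: "g \<in> ab_proj T G g"
    unfolding ab_proj_def using g subgroup_closed_derived by (rule rcos_self)
  have "f h = f g" if h: "h \<in> ab_proj T G g" for h
  proof (rule assms(1))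
    show "h \<in> carrier G"
      using h g subgroup.subset[OF subgroup_closed_derived] r_coset_subset_G[of "closed_derived T G" g]
      by (auto simp: ab_proj_def)
    show "ab_proj T G h = ab_proj T G g"
      using repr_independence[OF _ g subgroup_closed_derived, of h] h by (simp add: ab_proj_def)
  qed (rule g)
  moreover have "ab_proj T G g \<noteq> {}" using gg by blast
  ultimately have "the_elem (f ` ab_proj T G g) = f g"
    using the_elem_image_unique[of "ab_proj T G g" f "f g"] by blast
  then show ?thesis using g by (simp add: ab_factor_def)
qed

lemma ab_factor_character:
  assumes \<xi>: "\<xi> \<in> hom G A" and A: "comm_group A"
    and cont: "continuous_map T (discrete_topology UNIV) \<xi>" and g: "g \<in> carrier G"
  shows "ab_factor T G \<xi> (ab_proj T G g) = \<xi> g"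
proof (rule ab_factor_proj[OF _ g])
  interpret A: comm_group A by fact
  interpret h: group_hom G A \<xi> by unfold_locales (rule \<xi>)
  fix g h assume gh: "g \<in> carrier G" "h \<in> carrier G" and "ab_proj T G g = ab_proj T G h"
  then have "\<xi> (g \<otimes> inv h) = \<one>\<^bsub>A\<^esub>"
    using closed_derived_trivial[OF \<xi> A cont] by (simp add: ab_proj_eq_iff)
  then show "\<xi> g = \<xi> h"
    using gh by (simp add: A.inv_solve_right')
qed

end

subsection \<open>The group \<open>Q2Z2\<close>\<close>

lemma dyadic_uminus: "x \<in> carrier dyadic_group \<Longrightarrow> - x \<in> carrier dyadic_group"
  by (auto simp: dyadic_group_def) (metis minus_divide_left of_int_minus)

lemma comm_group_dyadic_group: "comm_group dyadic_group"
proof (rule comm_groupI)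
  fix x y assume "x \<in> carrier dyadic_group" "y \<in> carrier dyadic_group"
  then obtain k n l m where "x = of_int k / 2 ^ n" "y = of_int l / 2 ^ m"
    by (auto simp: dyadic_group_def)
  then have "x + y = of_int (k * 2 ^ m + l * 2 ^ n) / 2 ^ (n + m)"
    by (simp add: add_divide_distrib power_add)
  then have "\<exists>k n. x + y = of_int k / 2 ^ n" by blast
  then show "x \<otimes>\<^bsub>dyadic_group\<^esub> y \<in> carrier dyadic_group"
    by (simp add: dyadic_group_def)
next
  show "\<one>\<^bsub>dyadic_group\<^esub> \<in> carrier dyadic_group"
    by (auto simp: dyadic_group_def intro: exI[of _ 0])
next
  fix x assume "x \<in> carrier dyadic_group"
  then have "- x \<in> carrier dyadic_group" by (rule dyadic_uminus)
  then show "\<exists>y\<in>carrier dyadic_group. y \<otimes>\<^bsub>dyadic_group\<^esub> x = \<one>\<^bsub>dyadic_group\<^esub>"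
    by (rule bexI[rotated]) (simp add: dyadic_group_def)
qed (auto simp: dyadic_group_def)

interpretation dyadic: comm_group dyadic_group
  by (rule comm_group_dyadic_group)

lemma dyadic_inv: "x \<in> carrier dyadic_group \<Longrightarrow> inv\<^bsub>dyadic_group\<^esub> x = - x"
  by (rule dyadic.inv_equality) (simp_all add: dyadic_uminus, simp add: dyadic_group_def)

lemma subgroup_Ints: "subgroup \<int> dyadic_group"
proof (rule dyadic.subgroupI)
  show sub: "\<int> \<subseteq> carrier dyadic_group"
  proof
    fix x :: rat assume "x \<in> \<int>"
    then obtain k where "x = of_int k / 2 ^ 0" by (auto elim: Ints_cases)
    then show "x \<in> carrier dyadic_group" by (auto simp: dyadic_group_def simp del: power_0)
  qed
  show "inv\<^bsub>dyadic_group\<^esub> x \<in> \<int>" if "x \<in> \<int>" for x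
    using that sub by (subst dyadic_inv) auto
qed (auto simp: dyadic_group_def)

lemma normal_Ints: "\<int> \<lhd> dyadic_group"
  using subgroup_Ints by (rule dyadic.subgroup_imp_normal)

lemma comm_group_Q2Z2: "comm_group Q2Z2"
  unfolding Q2Z2_def using subgroup_Ints by (rule dyadic.abelian_FactGroup)

interpretation Q2Z2: comm_group Q2Z2
  by (rule comm_group_Q2Z2)

lemma carrier_Q2Z2: "carrier Q2Z2 = Q2Z2_of ` carrier dyadic_group"
  unfolding Q2Z2_def Q2Z2_of_def by (simp add: carrier_FactGroup)

lemma Q2Z2_of_in [simp]: "x \<in> carrier dyadic_group \<Longrightarrow> Q2Z2_of x \<in> carrier Q2Z2"
  by (simp add: carrier_Q2Z2)

lemma Q2Z2_of_add:
  assumes "x \<in> carrier dyadic_group" "y \<in> carrier dyadic_group"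
  shows "Q2Z2_of x \<otimes>\<^bsub>Q2Z2\<^esub> Q2Z2_of y = Q2Z2_of (x + y)"
  using normal.rcos_sum[OF normal_Ints assms]
  by (simp add: Q2Z2_def Q2Z2_of_def) (simp add: dyadic_group_def)

lemma Q2Z2_of_eq_one_iff: "x \<in> carrier dyadic_group \<Longrightarrow> Q2Z2_of x = \<one>\<^bsub>Q2Z2\<^esub> \<longleftrightarrow> x \<in> \<int>"
  unfolding Q2Z2_def Q2Z2_of_def one_FactGroup
  using subgroup_Ints dyadic.coset_join1 dyadic.coset_join2 by blast

lemma Q2Z2_of_eqI:
  assumes "x \<in> carrier dyadic_group" "y \<in> carrier dyadic_group" "x - y \<in> \<int>"
  shows "Q2Z2_of x = Q2Z2_of y"
proof -
  have "x - y \<in> carrier dyadic_group"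
    using assms(3) subgroup.mem_carrier[OF subgroup_Ints] by blast
  then have "Q2Z2_of x = Q2Z2_of (x - y) \<otimes>\<^bsub>Q2Z2\<^esub> Q2Z2_of y"
    using assms by (simp add: Q2Z2_of_add)
  then show ?thesis
    using assms \<open>x - y \<in> carrier dyadic_group\<close> by (simp add: Q2Z2_of_eq_one_iff)
qed

lemma dyadic_quarters: "of_int k / 4 \<in> carrier dyadic_group"
proof -
  have "(of_int k / 4 :: rat) = of_int k / 2 ^ 2" by simp
  then show ?thesis unfolding dyadic_group_def partial_object.simps by blast
qed

lemma dyadic_constants [simp]:
  "0 \<in> carrier dyadic_group" "1 / 2 \<in> carrier dyadic_group" "1 / 4 \<in> carrier dyadic_group"
  "3 / 4 \<in> carrier dyadic_group" "1 \<in> carrier dyadic_group" "3 / 2 \<in> carrier dyadic_group"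
  "5 / 4 \<in> carrier dyadic_group"
  using dyadic_quarters[of 0] dyadic_quarters[of 2] dyadic_quarters[of 1] dyadic_quarters[of 3]
    dyadic_quarters[of 4] dyadic_quarters[of 6] dyadic_quarters[of 5]
  by simp_all

lemma Q2Z2_of_mod_Ints:
  "Q2Z2_of 1 = Q2Z2_of 0" "Q2Z2_of (3 / 2) = Q2Z2_of (1 / 2)" "Q2Z2_of (5 / 4) = Q2Z2_of (1 / 4)"
  by (rule Q2Z2_of_eqI; simp)+

lemma half_notin_Ints: "(1 / 2 :: rat) \<notin> \<int>"
proof
  assume "(1 / 2 :: rat) \<in> \<int>"
  then obtain k where "(1 / 2 :: rat) = of_int k" by (auto elim: Ints_cases)
  then have "(1 :: rat) = of_int (2 * k)" by simp
  then have "1 = 2 * k" by linarith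
  then show False by presburger
qed

lemma half_not_one: "Q2Z2_of (1 / 2) \<noteq> \<one>\<^bsub>Q2Z2\<^esub>"
  by (simp add: Q2Z2_of_eq_one_iff half_notin_Ints)

lemma half_half: "Q2Z2_of (1 / 2) \<otimes>\<^bsub>Q2Z2\<^esub> Q2Z2_of (1 / 2) = \<one>\<^bsub>Q2Z2\<^esub>"
  by (simp add: Q2Z2_of_add Q2Z2_of_eq_one_iff)

text \<open>\<open>Q2Z2\<close> has a single element of order 2. This leaves only two possible
  values for a character at \<open>zeta\<close>, whose square is trivial modulo
  \<open>M_derived a\<close>.\<close>

lemma Q2Z2_involution:
  assumes "x \<in> carrier Q2Z2" "x \<otimes>\<^bsub>Q2Z2\<^esub> x = \<one>\<^bsub>Q2Z2\<^esub>" "x \<noteq> \<one>\<^bsub>Q2Z2\<^esub>"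
  shows "x = Q2Z2_of (1 / 2)"
proof -
  obtain q where q: "q \<in> carrier dyadic_group" "x = Q2Z2_of q"
    using assms(1) by (auto simp: carrier_Q2Z2)
  have qq: "q + q \<in> carrier dyadic_group"
    using dyadic.m_closed[OF q(1) q(1)] by (simp add: dyadic_group_def)
  then have "q + q \<in> \<int>"
    using assms(2) q by (simp add: Q2Z2_of_add Q2Z2_of_eq_one_iff)
  then obtain k where k: "q + q = of_int k" by (auto elim: Ints_cases)
  have "q \<notin> \<int>" using assms(3) q by (simp add: Q2Z2_of_eq_one_iff)
  have "odd k"
  proof
    assume "even k"
    then obtain l where "k = 2 * l" by blast
    with k have "q = of_int l" by simp
    with \<open>q \<notin> \<int>\<close> show False by simp
  qed
  then obtain l where "k = 2 * l + 1" by (rule oddE)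
  with k have "q - 1 / 2 = of_int l" by simp
  then have "q - 1 / 2 \<in> \<int>" by simp
  then show ?thesis unfolding q(2) using q(1) by (intro Q2Z2_of_eqI) simp_all
qed

lemma F2_embed_0: "F2_embed 0 = \<one>\<^bsub>Q2Z2\<^esub>"
  by (simp add: F2_embed_def Q2Z2_of_eq_one_iff)

lemma F2_embed_1: "F2_embed 1 = Q2Z2_of (1 / 2)"
  by (simp add: F2_embed_def)

lemma F2_embed_eq_one_iff: "F2_embed u = \<one>\<^bsub>Q2Z2\<^esub> \<longleftrightarrow> u = 0"
  using half_not_one by (cases u) (auto simp: F2_embed_0 F2_embed_1)

lemma F2_embed_hom: "F2_embed \<in> hom (add_monoid F2) Q2Z2"
proof (rule homI)
  show "F2_embed u \<in> carrier Q2Z2" for u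
    by (simp add: F2_embed_def)
  show "F2_embed (u \<otimes>\<^bsub>add_monoid F2\<^esub> v) = F2_embed u \<otimes>\<^bsub>Q2Z2\<^esub> F2_embed v" for u v
    by (cases u; cases v) (simp_all add: F2_def F2_embed_0 F2_embed_1 half_half)
qed

lemma star_embed_in: "star_embed p \<in> carrier Q2Z2"
  by (cases p) (auto simp: star_embed_def)

lemma star_mult: "(u, v) \<otimes>\<^bsub>star_group\<^esub> (u', v') = (u + u' + v * v', v + v')"
  by (simp add: star_group_def)

lemma star_embed_hom: "star_embed \<in> hom star_group Q2Z2"
proof (rule homI)
  show "star_embed (p \<otimes>\<^bsub>star_group\<^esub> q) = star_embed p \<otimes>\<^bsub>Q2Z2\<^esub> star_embed q" for p q
  proof -
    obtain u v u' v' where "p = (u, v)" "q = (u', v')" by (meson surj_pair)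
    then show ?thesis
      by (cases u; cases v; cases u'; cases v')
         (simp_all add: star_mult star_embed_def Q2Z2_of_add Q2Z2_of_mod_Ints)
  qed
qed (rule star_embed_in)

text \<open>Doubling \<open>u/2 + v/4\<close> leaves \<open>v/2\<close>, so the double of a
  character with values in \<open>star_group\<close> is given by its second coordinate.\<close>

lemma star_embed_square: "star_embed p \<otimes>\<^bsub>Q2Z2\<^esub> star_embed p = F2_embed (snd p)"
proof -
  obtain u v where "p = (u, v)" by (meson surj_pair)
  then show ?thesis
    by (cases u; cases v)
       (simp_all add: star_embed_def F2_embed_def Q2Z2_of_add Q2Z2_of_mod_Ints)
qed

lemma comm_group_F2: "comm_group (add_monoid F2)"
proof (rule comm_groupI)
  fix x :: bit assume "x \<in> carrier (add_monoid F2)"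
  show "\<exists>y\<in>carrier (add_monoid F2). y \<otimes>\<^bsub>add_monoid F2\<^esub> x = \<one>\<^bsub>add_monoid F2\<^esub>"
    by (rule bexI[of _ x]) (simp_all add: F2_def)
qed (simp_all add: F2_def algebra_simps)

lemma star_group_iso: "star_group \<cong> integer_mod_group 4"
proof -
  \<comment> \<open>The pair \<open>(u, v)\<close> stands for \<open>2 * u + v\<close>; the term
    \<open>y1 * y2\<close> of the group law is the carry out of the lower binary digit.\<close>
  define h :: "bit \<times> bit \<Rightarrow> int" where
    "h = (\<lambda>(u, v). (if u = 1 then 2 else 0) + (if v = 1 then 1 else 0))"
  have c: "carrier (integer_mod_group 4) = {0, 1, 2, 3}"
    by (auto simp: carrier_integer_mod_group)
  have "h \<in> hom star_group (integer_mod_group 4)"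
  proof (rule homI)
    show "h p \<in> carrier (integer_mod_group 4)" for p
      unfolding c by (cases p) (auto simp: h_def)
    show "h (p \<otimes>\<^bsub>star_group\<^esub> q) = h p \<otimes>\<^bsub>integer_mod_group 4\<^esub> h q" for p q
    proof -
      obtain u v u' v' where "p = (u, v)" "q = (u', v')" by (meson surj_pair)
      then show ?thesis
        by (cases u; cases v; cases u'; cases v')
           (simp_all add: star_mult h_def mult_integer_mod_group)
    qed
  qed
  moreover have "bij_betw h (carrier star_group) (carrier (integer_mod_group 4))"
  proof -
    have inj: "inj h"
    proof (rule injI)
      fix p q assume "h p = h q"
      moreover obtain u v u' v' where "p = (u, v)" "q = (u', v')" by (meson surj_pair)
      ultimately show "p = q"
        by (cases u; cases v; cases u'; cases v') (simp_all add: h_def)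
    qed
    moreover have "range h = {0, 1, 2, 3}"
    proof
      have "h (0, 0) = 0" "h (0, 1) = 1" "h (1, 0) = 2" "h (1, 1) = 3" by (simp_all add: h_def)
      then show "{0, 1, 2, 3} \<subseteq> range h" by (metis empty_subsetI insert_subset rangeI)
      have "h p \<in> {0, 1, 2, 3}" for p
        by (cases p) (simp add: h_def)
      then show "range h \<subseteq> {0, 1, 2, 3}" by blast
    qed
    ultimately show ?thesis unfolding c by (simp add: bij_betw_def star_group_def)
  qed
  ultimately show ?thesis by (auto simp: is_iso_def iso_def)
qed

subsection \<open>Dual groups\<close>

lemma dual_carrier_iff:
  "\<psi> \<in> carrier (dual T G) \<longleftrightarrow> \<psi> \<in> hom G Q2Z2 \<and> \<psi> \<in> extensional (carrier G) \<and>
     continuous_map T (discrete_topology (carrier Q2Z2)) \<psi>"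
  by (auto simp: dual_def)

lemma (in topologized_group) dual_iff:
  "\<psi> \<in> carrier (dual T G) \<longleftrightarrow> \<psi> \<in> hom G Q2Z2 \<and> \<psi> \<in> extensional (carrier G) \<and>
     continuous_map T (discrete_topology UNIV) \<psi>"
  unfolding dual_carrier_iff
  by (subst continuous_map_discrete_iff) (auto simp: topspace_eq hom_def)

lemma (in topologized_group) comm_group_dual: "comm_group (dual T G)"
proof (rule comm_groupI)
  have cont: "continuous_map T (discrete_topology UNIV) (\<lambda>g\<in>carrier G. f g)"
    if "continuous_map T (discrete_topology UNIV) f" for f :: "'g \<Rightarrow> rat set"
    using that by (rule continuous_map_eq) (simp add: topspace_eq)
  have hom: "(\<lambda>g\<in>carrier G. f g) \<in> hom G Q2Z2" if "f \<in> hom G Q2Z2" for f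
    using that by (auto simp: hom_def)
  have dual_mult: "\<psi> \<otimes>\<^bsub>dual T G\<^esub> \<eta> = (\<lambda>g\<in>carrier G. \<psi> g \<otimes>\<^bsub>Q2Z2\<^esub> \<eta> g)" for \<psi> \<eta>
    by (simp add: dual_def)
  have dual_one: "\<one>\<^bsub>dual T G\<^esub> = (\<lambda>g\<in>carrier G. \<one>\<^bsub>Q2Z2\<^esub>)"
    by (simp add: dual_def)
  have closed: "\<psi> g \<in> carrier Q2Z2" if "\<psi> \<in> carrier (dual T G)" "g \<in> carrier G" for \<psi> g
    using that by (auto simp: dual_iff hom_def)
  have mult: "\<psi> (g \<otimes> h) = \<psi> g \<otimes>\<^bsub>Q2Z2\<^esub> \<psi> h"
    if "\<psi> \<in> carrier (dual T G)" "g \<in> carrier G" "h \<in> carrier G" for \<psi> g h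
    using that by (simp add: dual_iff hom_def)
  show "\<one>\<^bsub>dual T G\<^esub> \<in> carrier (dual T G)"
    unfolding dual_iff dual_one by (auto intro!: hom cont homI)
  fix \<psi> \<eta> assume \<psi>: "\<psi> \<in> carrier (dual T G)" and \<eta>: "\<eta> \<in> carrier (dual T G)"
  have "(\<lambda>g. \<psi> g \<otimes>\<^bsub>Q2Z2\<^esub> \<eta> g) \<in> hom G Q2Z2"
    by (rule homI) (simp_all add: closed[OF \<psi>] closed[OF \<eta>] mult[OF \<psi>] mult[OF \<eta>] Q2Z2.m_ac)
  moreover have "continuous_map T (discrete_topology UNIV) (\<lambda>g. \<psi> g \<otimes>\<^bsub>Q2Z2\<^esub> \<eta> g)"
    using \<psi> \<eta> by (simp add: dual_iff continuous_map_discrete_combine)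
  ultimately show "\<psi> \<otimes>\<^bsub>dual T G\<^esub> \<eta> \<in> carrier (dual T G)"
    by (simp only: dual_iff dual_mult hom cont restrict_extensional simp_thms)
  show "\<psi> \<otimes>\<^bsub>dual T G\<^esub> \<eta> = \<eta> \<otimes>\<^bsub>dual T G\<^esub> \<psi>"
    unfolding dual_mult by (intro restrict_ext Q2Z2.m_comm closed \<psi> \<eta>)
  show "\<one>\<^bsub>dual T G\<^esub> \<otimes>\<^bsub>dual T G\<^esub> \<psi> = \<psi>"
  proof (rule extensionalityI[of _ "carrier G"])
    show "\<psi> \<in> extensional (carrier G)" using \<psi> by (simp add: dual_iff)
  qed (simp_all add: dual_mult dual_one closed[OF \<psi>])
  have "(\<lambda>g. inv\<^bsub>Q2Z2\<^esub> (\<psi> g)) \<in> hom G Q2Z2"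
    by (rule homI) (simp_all add: closed[OF \<psi>] mult[OF \<psi>] Q2Z2.inv_mult)
  moreover have "continuous_map T (discrete_topology UNIV) (\<lambda>g. inv\<^bsub>Q2Z2\<^esub> (\<psi> g))"
    using \<psi> by (simp add: dual_iff continuous_map_discrete_comp)
  ultimately have "(\<lambda>g\<in>carrier G. inv\<^bsub>Q2Z2\<^esub> (\<psi> g)) \<in> carrier (dual T G)"
    by (simp only: dual_iff hom cont restrict_extensional simp_thms)
  moreover have "(\<lambda>g\<in>carrier G. inv\<^bsub>Q2Z2\<^esub> (\<psi> g)) \<otimes>\<^bsub>dual T G\<^esub> \<psi> = \<one>\<^bsub>dual T G\<^esub>"
    unfolding dual_mult dual_one by (rule restrict_ext) (simp add: closed[OF \<psi>])
  ultimately show "\<exists>\<eta>\<in>carrier (dual T G). \<eta> \<otimes>\<^bsub>dual T G\<^esub> \<psi> = \<one>\<^bsub>dual T G\<^esub>"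
    by blast
  fix \<theta> assume \<theta>: "\<theta> \<in> carrier (dual T G)"
  show "\<psi> \<otimes>\<^bsub>dual T G\<^esub> \<eta> \<otimes>\<^bsub>dual T G\<^esub> \<theta> = \<psi> \<otimes>\<^bsub>dual T G\<^esub> (\<eta> \<otimes>\<^bsub>dual T G\<^esub> \<theta>)"
    unfolding dual_mult
    by (rule restrict_ext) (simp add: closed[OF \<psi>] closed[OF \<eta>] closed[OF \<theta>] Q2Z2.m_assoc)
qed

context topologized_group
begin

abbreviation "ab_dual \<equiv> dual (ab_top T G) (ab T G)"

lemma comm_group_ab_dual: "comm_group ab_dual"
proof -
  interpret A: comm_group "ab T G" by (rule comm_group_ab)
  interpret A: topologized_group "ab T G" "ab_top T G"
    by unfold_locales (rule topspace_ab_top)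
  show ?thesis by (rule A.comm_group_dual)
qed

text \<open>The topology on \<open>ab T G\<close> is the quotient topology, so characters of the
  abelianization can be handled as functions on \<open>G\<close>.\<close>

lemma ab_dual_iff:
  "\<psi> \<in> carrier ab_dual \<longleftrightarrow> \<psi> \<in> extensional (carrier (ab T G)) \<and>
     (\<lambda>g. \<psi> (ab_proj T G g)) \<in> hom G Q2Z2 \<and>
     continuous_map T (discrete_topology UNIV) (\<lambda>g. \<psi> (ab_proj T G g))"
proof -
  have "\<psi> \<in> hom (ab T G) Q2Z2 \<longleftrightarrow> (\<lambda>g. \<psi> (ab_proj T G g)) \<in> hom G Q2Z2"
    unfolding hom_def Pi_iff carrier_ab by (simp add: ab_proj_mult)
  then show ?thesis
    unfolding dual_carrier_iff
    by (subst continuous_map_discrete_iff)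
       (auto simp: topspace_ab_top continuous_map_ab_top_iff hom_def)
qed

lemma ab_dual_eqI:
  assumes "\<psi> \<in> carrier ab_dual" "\<eta> \<in> carrier ab_dual"
    and "\<And>g. g \<in> carrier G \<Longrightarrow> \<psi> (ab_proj T G g) = \<eta> (ab_proj T G g)"
  shows "\<psi> = \<eta>"
proof (rule extensionalityI)
  show "\<psi> \<in> extensional (carrier (ab T G))" "\<eta> \<in> extensional (carrier (ab T G))"
    using assms(1,2) by (simp_all add: ab_dual_iff)
qed (use assms(3) in \<open>auto simp: carrier_ab\<close>)

lemma ab_dual_mult:
  "g \<in> carrier G \<Longrightarrow> (\<psi> \<otimes>\<^bsub>ab_dual\<^esub> \<eta>) (ab_proj T G g) = \<psi> (ab_proj T G g) \<otimes>\<^bsub>Q2Z2\<^esub> \<eta> (ab_proj T G g)"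
  by (simp add: dual_def)

lemma ab_dual_one: "g \<in> carrier G \<Longrightarrow> \<one>\<^bsub>ab_dual\<^esub> (ab_proj T G g) = \<one>\<^bsub>Q2Z2\<^esub>"
  by (simp add: dual_def)

lemma ab_dual_trivial:
  assumes "\<psi> \<in> carrier ab_dual" "d \<in> closed_derived T G"
  shows "\<psi> (ab_proj T G d) = \<one>\<^bsub>Q2Z2\<^esub>"
proof -
  have "(\<lambda>g. \<psi> (ab_proj T G g)) \<in> hom G Q2Z2"
    "continuous_map T (discrete_topology UNIV) (\<lambda>g. \<psi> (ab_proj T G g))"
    using assms(1) by (simp_all add: ab_dual_iff)
  from closed_derived_trivial[OF this(1) comm_group_Q2Z2 this(2) assms(2)] show ?thesis .
qed

lemma ab_factor_in_dual:
  assumes \<xi>: "\<xi> \<in> hom G Q2Z2" and cont: "continuous_map T (discrete_topology UNIV) \<xi>"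
  shows "ab_factor T G \<xi> \<in> carrier ab_dual"
proof -
  have eq: "ab_factor T G \<xi> (ab_proj T G g) = \<xi> g" if "g \<in> carrier G" for g
    using ab_factor_character[OF \<xi> comm_group_Q2Z2 cont that] .
  then have "(\<lambda>g. ab_factor T G \<xi> (ab_proj T G g)) \<in> hom G Q2Z2"
    using \<xi> by (auto simp: hom_def Pi_iff)
  moreover have "continuous_map T (discrete_topology UNIV) (\<lambda>g. ab_factor T G \<xi> (ab_proj T G g))"
    using cont by (rule continuous_map_eq) (simp add: eq topspace_eq)
  moreover have "ab_factor T G \<xi> \<in> extensional (carrier (ab T G))"
    by (simp add: ab_factor_def)
  ultimately show ?thesis
    by (simp add: ab_dual_iff)
qed

end

section \<open>The kernel of \<open>M_ab_map\<close>\<close>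

text \<open>Here \<open>G\<close> will be \<open>Omega\<close> modulo \<open>M_derived a\<close>,
  \<open>A\<close> the image of \<open>M_set a\<close>, and \<open>t\<close>, \<open>m\<close>,
  \<open>z\<close> the images of \<open>tau\<close>, \<open>mu\<close>, \<open>zeta\<close>. As
  \<open>z\<close> is central with trivial square, commuting up to \<open>z\<close> is stable under
  products, so it only has to be checked on \<open>A\<close> and \<open>t\<close>.\<close>

lemma (in group) commutators_of_index_two_abelian:
  assumes A: "subgroup A G" and comm: "\<And>x y. x \<in> A \<Longrightarrow> y \<in> A \<Longrightarrow> x \<otimes> y = y \<otimes> x"
    and t: "t \<in> carrier G" "t \<otimes> t = \<one>"
    and cover: "\<And>g. g \<in> carrier G \<Longrightarrow> g \<in> A \<or> g \<otimes> t \<in> A"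
    and m: "m \<in> A" and z: "z \<in> A" "z \<otimes> m = t \<otimes> m \<otimes> t" "t \<otimes> z = z \<otimes> t"
    and fix_t: "\<And>x. x \<in> A \<Longrightarrow> t \<otimes> x = x \<otimes> t \<or> t \<otimes> (x \<otimes> inv m) = (x \<otimes> inv m) \<otimes> t"
  shows "z \<otimes> z = \<one>"
    and "\<And>g h. g \<in> carrier G \<Longrightarrow> h \<in> carrier G \<Longrightarrow> g \<otimes> h \<otimes> inv g \<otimes> inv h \<in> {\<one>, z}"
proof -
  note [simp] = subgroup.mem_carrier[OF A]
  note [simp] = t(1) m z(1)
  have tt: "t \<otimes> (t \<otimes> x) = x" if "x \<in> carrier G" for x
    using that t by (simp flip: m_assoc)
  have zt: "z \<otimes> (t \<otimes> x) = t \<otimes> (z \<otimes> x)" if "x \<in> carrier G" for x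
    using that z(3) by (simp flip: m_assoc)
  \<comment> \<open>Multiplying \<open>m\<close> twice by \<open>z\<close> amounts to conjugating it
    twice by the involution \<open>t\<close>.\<close>
  have "z \<otimes> (z \<otimes> m) = z \<otimes> (t \<otimes> (m \<otimes> t))"
    using z(2) by (simp add: m_assoc)
  also have "\<dots> = t \<otimes> (z \<otimes> m) \<otimes> t"
    by (simp add: zt m_assoc)
  also have "\<dots> = m"
    by (simp add: z(2) m_assoc tt t(2))
  finally have "z \<otimes> z \<otimes> m = m" by (simp add: m_assoc)
  then show zz: "z \<otimes> z = \<one>" by simp
  have zz': "z \<otimes> (z \<otimes> x) = x" if "x \<in> carrier G" for x
    using that zz by (simp flip: m_assoc)
  have split: "g \<in> A \<or> (\<exists>x\<in>A. g = x \<otimes> t)" if "g \<in> carrier G" for g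
  proof -
    have "g = g \<otimes> t \<otimes> t" using that t by (simp add: m_assoc)
    with cover[OF that] show ?thesis by blast
  qed
  have central: "g \<otimes> z = z \<otimes> g" if g: "g \<in> carrier G" for g
    using split[OF g]
  proof
    assume "\<exists>x\<in>A. g = x \<otimes> t"
    then obtain x where x: "x \<in> A" "g = x \<otimes> t" by blast
    then have "g \<otimes> z = x \<otimes> z \<otimes> t" by (simp add: m_assoc z(3))
    also have "\<dots> = z \<otimes> g" using x comm[of x z] by (simp add: m_assoc)
    finally show ?thesis .
  qed (use comm z in auto)
  define R where "R g h \<longleftrightarrow> g \<otimes> h = h \<otimes> g \<or> g \<otimes> h = z \<otimes> (h \<otimes> g)" for g h
  have R_sym: "R h g" if "R g h" "g \<in> carrier G" "h \<in> carrier G" for g h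
    using that unfolding R_def by (auto simp: zz')
  have R_mult: "R g (h \<otimes> k)"
    if "R g h" "R g k" "g \<in> carrier G" "h \<in> carrier G" "k \<in> carrier G" for g h k
  proof -
    have c: "h \<otimes> (z \<otimes> x) = z \<otimes> (h \<otimes> x)" if "x \<in> carrier G" for x
      using central[of h] that \<open>h \<in> carrier G\<close> by (simp flip: m_assoc)
    have "g \<otimes> (h \<otimes> k) = g \<otimes> h \<otimes> k" using that by (simp add: m_assoc)
    moreover have "h \<otimes> g \<otimes> k = h \<otimes> (g \<otimes> k)" using that by (simp add: m_assoc)
    ultimately show ?thesis
      using that unfolding R_def by (elim disjE) (simp_all add: m_assoc c zz')
  qed
  have R_A: "R x y" if "x \<in> A" "y \<in> A" for x y
    using comm[OF that] by (simp add: R_def)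
  have R_t: "R t x" if x: "x \<in> A" for x
    using fix_t[OF x]
  proof
    \<comment> \<open>Splitting off \<open>m\<close> leaves a cofactor commuting with
      \<open>t\<close>, so the failure of \<open>x\<close> to commute with \<open>t\<close> is that
      of \<open>m\<close>, namely \<open>z\<close>.\<close>
    assume c: "t \<otimes> (x \<otimes> inv m) = x \<otimes> inv m \<otimes> t"
    define y where "y = x \<otimes> inv m"
    have yA: "y \<in> A" unfolding y_def using x m A by (simp add: subgroup.m_closed subgroup.m_inv_closed)
    have xy: "x = y \<otimes> m" using x by (simp add: y_def m_assoc)
    have tm: "t \<otimes> m = z \<otimes> (m \<otimes> t)"
    proof -
      have "z \<otimes> (m \<otimes> t) = z \<otimes> m \<otimes> t" by (simp add: m_assoc)
      also have "\<dots> = t \<otimes> m" unfolding z(2) by (simp add: m_assoc t(2))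
      finally show ?thesis by simp
    qed
    have "t \<otimes> x = t \<otimes> y \<otimes> m" using yA by (simp add: xy m_assoc)
    also have "\<dots> = y \<otimes> (t \<otimes> m)" using c yA by (simp add: m_assoc flip: y_def)
    also have "\<dots> = y \<otimes> z \<otimes> (m \<otimes> t)" using yA by (simp add: tm m_assoc)
    also have "y \<otimes> z = z \<otimes> y" using yA z by (intro comm)
    finally have "t \<otimes> x = z \<otimes> (x \<otimes> t)" using yA by (simp add: xy m_assoc)
    then show ?thesis by (simp add: R_def)
  qed (simp add: R_def)
  have R_right: "R g h" if "g \<in> carrier G" "h \<in> carrier G" "R g t" "\<And>x. x \<in> A \<Longrightarrow> R g x" for g h
    using split[OF that(2)] that R_mult[of g _ t] by auto
  have "R t t" by (simp add: R_def)
  have 1: "R x g" if "x \<in> A" "g \<in> carrier G" for x g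
    by (rule R_right) (use that R_A R_sym[OF R_t] in simp_all)
  have 2: "R t g" if "g \<in> carrier G" for g
    by (rule R_right) (use that \<open>R t t\<close> R_t in simp_all)
  fix g h assume gh: "g \<in> carrier G" "h \<in> carrier G"
  have "R g h"
    by (rule R_right) (use gh R_sym[OF 2] R_sym[OF 1] in simp_all)
  then have "g \<otimes> h \<otimes> (inv g \<otimes> inv h) = h \<otimes> g \<otimes> (inv g \<otimes> inv h) \<or>
    g \<otimes> h \<otimes> (inv g \<otimes> inv h) = z \<otimes> (h \<otimes> g) \<otimes> (inv g \<otimes> inv h)"
    unfolding R_def by auto
  moreover have "h \<otimes> g \<otimes> (inv g \<otimes> inv h) = \<one>"
  proof -
    have "g \<otimes> (inv g \<otimes> inv h) = inv h" using gh by (simp flip: m_assoc)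
    then show ?thesis using gh by (simp add: m_assoc)
  qed
  moreover have "z \<otimes> (h \<otimes> g) \<otimes> (inv g \<otimes> inv h) = z \<otimes> (h \<otimes> g \<otimes> (inv g \<otimes> inv h))"
    using gh by (simp add: m_assoc)
  ultimately show "g \<otimes> h \<otimes> inv g \<otimes> inv h \<in> {\<one>, z}"
    using gh by (auto simp: m_assoc)
qed

interpretation Omega: topologized_group Omega Omega_top
  by (intro topologized_group.intro group_Omega topologized_group_axioms.intro topspace_Omega_top)

text \<open>In the abelianization squaring is a homomorphism, so the elements with square in the
  derived subgroup are closed under composition; they also form a closed set. The level factors are
  involutions, and every automorphism is a limit of their products.\<close>

lemma Omega_square: 
  assumes "f \<in> carrier Omega"
  shows "f \<otimes>\<^bsub>Omega\<^esub> f \<in> closed_derived Omega_top Omega"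
proof -
  let ?D = "closed_derived Omega_top Omega"
  define S where "S = {f \<in> carrier Omega. f \<circ> f \<in> ?D}"
  have "closedin Omega_top {f \<in> topspace Omega_top. f \<circ> f \<in> ?D}"
    using continuous_map_Omega_square Omega.closedin_closed_derived
    by (rule closedin_continuous_map_preimage)
  then have closed: "closedin Omega_top S" by (simp add: S_def)
  interpret ab: comm_group "ab Omega_top Omega" by (rule Omega.comm_group_ab)
  have S_comp: "f \<circ> g \<in> S" if "f \<in> S" "g \<in> S" for f g
  proof -
    let ?p = "ab_proj Omega_top Omega"
    have f: "f \<in> carrier Omega" "?p (f \<otimes>\<^bsub>Omega\<^esub> f) = \<one>\<^bsub>ab Omega_top Omega\<^esub>"
      using that by (auto simp: S_def Omega.ab_proj_eq_one_iff Omega_mult)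
    have g: "g \<in> carrier Omega" "?p (g \<otimes>\<^bsub>Omega\<^esub> g) = \<one>\<^bsub>ab Omega_top Omega\<^esub>"
      using that by (auto simp: S_def Omega.ab_proj_eq_one_iff Omega_mult)
    have "?p ((f \<otimes>\<^bsub>Omega\<^esub> g) \<otimes>\<^bsub>Omega\<^esub> (f \<otimes>\<^bsub>Omega\<^esub> g)) =
      ?p (f \<otimes>\<^bsub>Omega\<^esub> f) \<otimes>\<^bsub>ab Omega_top Omega\<^esub> ?p (g \<otimes>\<^bsub>Omega\<^esub> g)"
      using f(1) g(1) by (simp add: ab.m_ac flip: Omega.ab_proj_mult)
    then have "(f \<otimes>\<^bsub>Omega\<^esub> g) \<otimes>\<^bsub>Omega\<^esub> (f \<otimes>\<^bsub>Omega\<^esub> g) \<in> ?D"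
      using f g by (simp add: Omega.ab_proj_eq_one_iff)
    then show ?thesis using f(1) g(1) by (simp add: S_def Omega_mult)
  qed
  have "id \<in> ?D"
    using subgroup.one_closed[OF Omega.subgroup_closed_derived] by (simp add: Omega_one)
  then have level: "sigma_level e i \<in> S" for e i
    by (simp add: S_def sigma_level_sigma_level) (simp add: sigma_level_eq_act)
  have "sigma_prod e N \<in> S" for e N
    by (induction N) (simp_all only: sigma_prod.simps level S_comp)
  then have "f \<in> S"
    using limitin_closedin[OF sigma_prod_limit[OF assms] closed] by simp
  then show ?thesis by (simp add: S_def Omega_mult)
qed

subsection \<open>Restriction of an automorphism to a branch\<close>

definition branch :: "letter \<Rightarrow> (word \<Rightarrow> word) \<Rightarrow> word \<Rightarrow> word" where
  "branch s f u = (if u \<noteq> [] \<and> last u = s then f u else u)"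

text \<open>A vanishing root bit keeps the words ending in \<open>s\<close> among themselves, so
  switching off the portrait outside this branch does not affect what happens inside it.\<close>

lemma branch_in_Omega:
  assumes f: "f \<in> carrier Omega" and p: "portrait f [] = 0"
  shows "branch s f \<in> carrier Omega"
proof -
  have "branch s f u = act (\<lambda>u. if u \<noteq> [] \<and> last u = s then portrait f u else 0) u" for u
  proof (induction u)
    case (Cons r u)
    show ?case
    proof (cases "u = []")
      case True
      then show ?thesis by (simp add: branch_def Omega_Cons[OF f] Omega_Nil[OF f] p)
    next
      case False
      then show ?thesis
        unfolding act.simps Cons[symmetric] by (simp add: branch_def Omega_Cons[OF f])
    qed
  qed (simp add: branch_def)
  then have "branch s f = act (\<lambda>u. if u \<noteq> [] \<and> last u = s then portrait f u else 0)" by blast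
  then show ?thesis by simp
qed

lemma fixed_branches:
  assumes f: "f \<in> carrier Omega" and p: "portrait f [] = 0"
  shows Omega_eq_branches: "f = branch Lx f \<circ> branch Ly f"
    and branch_commute: "branch s f \<circ> f = f \<circ> branch s f"
proof -
  have last: "last (f u) = last u" if "u \<noteq> []" for u
    using last_Omega[OF f that] p by simp
  have Nil: "f u = [] \<longleftrightarrow> u = []" for u
    using length_Omega[OF f, of u] by auto
  show "f = branch Lx f \<circ> branch Ly f"
  proof
    fix u
    show "f u = (branch Lx f \<circ> branch Ly f) u"
    proof (cases "u = []")
      case False
      then show ?thesis
        using last[OF False] by (cases "last u") (auto simp: branch_def)
    qed (simp add: branch_def Omega_Nil[OF f])
  qed
  show "branch s f \<circ> f = f \<circ> branch s f"
  proof
    show "(branch s f \<circ> f) u = (f \<circ> branch s f) u" for u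
      using last[of u] by (cases "u = []") (simp_all add: branch_def Nil)
  qed
qed

text \<open>The supports are disjoint: \<open>sigma w\<close> moves only words ending in
  \<open>w\<close>, and these lie in the branch of \<open>last w\<close>, which is not
  \<open>s\<close>.\<close>

lemma sigma_branch_commute:
  assumes f: "f \<in> carrier Omega" and p: "portrait f [] = 0" and w: "w \<noteq> []" "last w \<noteq> s"
  shows "sigma w \<circ> branch s f = branch s f \<circ> sigma w"
proof
  fix u
  have last: "last (f u) = last u" if "u \<noteq> []" for u
    using last_Omega[OF f that] p by simp
  have Nil: "f u = [] \<longleftrightarrow> u = []" for u
    using length_Omega[OF f, of u] by auto
  have suffix: "\<not> suffix w v" if "v \<noteq> []" "last v = s" for v
    using that w by (auto simp: suffix_def)
  have "portrait (sigma w) [] = 0" using w by (simp add: portrait_sigma)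
  then have last_sigma: "last (sigma w v) = last v" if "v \<noteq> []" for v
    using last_Omega[OF sigma_in_Omega that, of w] by simp
  have Nil_sigma: "sigma w v = [] \<longleftrightarrow> v = []" for v
    using length_Omega[OF sigma_in_Omega, of w v] by auto
  show "(sigma w \<circ> branch s f) u = (branch s f \<circ> sigma w) u"
  proof (cases "u \<noteq> [] \<and> last u = s")
    case True
    then have "sigma w (f u) = f u" "sigma w u = u"
      using suffix[of "f u"] suffix[of u] last Nil by (auto simp: sigma_def)
    with True show ?thesis by (simp add: branch_def)
  next
    case False
    then have "\<not> (sigma w u \<noteq> [] \<and> last (sigma w u) = s)"
      using last_sigma[of u] Nil_sigma[of u] by (cases "u = []") simp_all
    with False show ?thesis unfolding branch_def comp_def by (simp only: if_False)
  qed
qed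

subsection \<open>The group \<open>M_group a\<close>\<close>

definition phi_sum :: "(nat \<Rightarrow> bit) \<Rightarrow> (word \<Rightarrow> word) \<Rightarrow> bit" where
  "phi_sum a f = (\<Sum>i\<in>{i. a i \<noteq> 0}. a i * phi i f)"

lemma phi_mult:
  "f \<in> carrier Omega \<Longrightarrow> g \<in> carrier Omega \<Longrightarrow> phi i (f \<otimes>\<^bsub>Omega\<^esub> g) = phi i f + phi i g"
  by (simp add: Omega_mult phi_comp)

lemma phi_sum_mult:
  "f \<in> carrier Omega \<Longrightarrow> g \<in> carrier Omega \<Longrightarrow>
    phi_sum a (f \<otimes>\<^bsub>Omega\<^esub> g) = phi_sum a f + phi_sum a g"
  by (simp add: phi_sum_def phi_mult distrib_left sum.distrib)

lemma phi_sum_hom: "phi_sum a \<in> hom Omega (add_monoid F2)"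
  by (rule homI) (simp_all add: F2_def phi_sum_mult)

lemma continuous_map_phi_sum: "continuous_map Omega_top (discrete_topology UNIV) (phi_sum a)"
proof -
  have "continuous_map Omega_top (discrete_topology UNIV) (\<lambda>f. \<Sum>i\<in>{i. a i \<noteq> 0}. a i * phi i f)"
    by (rule continuous_map_discrete_sum)
       (rule continuous_map_discrete_comp[of _ "phi _" "(*) (a _)"], rule continuous_map_phi)
  then show ?thesis by (simp add: phi_sum_def[abs_def])
qed

lemma M_set_eq: "M_set a = {f \<in> carrier Omega. phi_sum a f = 0}"
  by (simp add: M_set_def kernel_def F2_def phi_sum_def)

lemma M_set_in_Omega: "f \<in> M_set a \<Longrightarrow> f \<in> carrier Omega"
  by (simp add: M_set_eq)

lemma subgroup_M_set: "subgroup (M_set a) Omega"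
proof -
  interpret F2: comm_group "add_monoid F2" by (rule comm_group_F2)
  interpret h: group_hom Omega "add_monoid F2" "phi_sum a"
    by unfold_locales (rule phi_sum_hom)
  show ?thesis using h.subgroup_kernel by (simp add: M_set_def phi_sum_def[abs_def])
qed

lemma carrier_M_group [simp]: "carrier (M_group a) = M_set a"
  by (simp add: M_group_def)

lemma mult_M_group [simp]: "f \<otimes>\<^bsub>M_group a\<^esub> g = f \<otimes>\<^bsub>Omega\<^esub> g"
  by (simp add: M_group_def)

lemma one_M_group [simp]: "\<one>\<^bsub>M_group a\<^esub> = \<one>\<^bsub>Omega\<^esub>"
  by (simp add: M_group_def)

lemma inv_M_group [simp]: "f \<in> M_set a \<Longrightarrow> inv\<^bsub>M_group a\<^esub> f = inv\<^bsub>Omega\<^esub> f"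
  unfolding M_group_def using Omega.m_inv_consistent[OF subgroup_M_set] by blast

lemma topspace_M_top [simp]: "topspace (M_top a) = M_set a"
  by (auto simp: M_top_def M_set_eq)

interpretation M: topologized_group "M_group a" "M_top a" for a
proof (intro topologized_group.intro topologized_group_axioms.intro)
  show "group (M_group a)"
    unfolding M_group_def using subgroup_M_set by (rule Omega.subgroup_imp_group)
qed simp

lemma closedin_M_set: "closedin Omega_top (M_set a)"
proof -
  have "closedin Omega_top {f \<in> topspace Omega_top. phi_sum a f \<in> {0}}"
    by (rule closedin_continuous_map_preimage[OF continuous_map_phi_sum]) simp
  then show ?thesis by (simp add: M_set_eq)
qed

text \<open>Openness allows continuity on \<open>Omega\<close> to be checked on the two cosets
  separately, as \<open>character_extends\<close> does.\<close>

lemma openin_M_set: "openin Omega_top (M_set a)"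
proof -
  have "openin Omega_top {f \<in> topspace Omega_top. phi_sum a f \<in> {0}}"
    by (rule openin_continuous_map_preimage[OF continuous_map_phi_sum]) simp
  then show ?thesis by (simp add: M_set_eq)
qed

lemma phi_sum_inv:
  assumes "f \<in> carrier Omega" shows "phi_sum a (inv\<^bsub>Omega\<^esub> f) = phi_sum a f"
proof -
  have one: "phi_sum a \<one>\<^bsub>Omega\<^esub> = 0"
    using subgroup.one_closed[OF subgroup_M_set, of a] by (simp add: M_set_eq)
  have "phi_sum a f + phi_sum a (inv\<^bsub>Omega\<^esub> f) = 0"
    using assms one by (simp flip: phi_sum_mult)
  then show ?thesis by (cases "phi_sum a f"; cases "phi_sum a (inv\<^bsub>Omega\<^esub> f)") auto
qed

lemma phi_inv:
  assumes "f \<in> carrier Omega" shows "phi i (inv\<^bsub>Omega\<^esub> f) = phi i f"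
proof -
  have one: "phi i \<one>\<^bsub>Omega\<^esub> = 0"
    using phi_mult[of "\<one>\<^bsub>Omega\<^esub>" "\<one>\<^bsub>Omega\<^esub>" i] by simp
  have "phi i f + phi i (inv\<^bsub>Omega\<^esub> f) = 0"
    using assms one by (simp flip: phi_mult)
  then show ?thesis by (cases "phi i f"; cases "phi i (inv\<^bsub>Omega\<^esub> f)") auto
qed

subsection \<open>The derived subgroup of \<open>M_group a\<close>\<close>

abbreviation M_derived :: "(nat \<Rightarrow> bit) \<Rightarrow> (word \<Rightarrow> word) set" where
  "M_derived a \<equiv> closed_derived (M_top a) (M_group a)"

abbreviation Omega_derived :: "(word \<Rightarrow> word) set" where
  "Omega_derived \<equiv> closed_derived Omega_top Omega"

lemma M_derived_subset: "M_derived a \<subseteq> M_set a"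
  using M.closed_derived_in_carrier by auto

lemma subgroup_M_derived: "subgroup (M_derived a) Omega"
  by (rule Omega.incl_subgroup[OF subgroup_M_set, folded M_group_def, OF M.subgroup_closed_derived])

lemma closedin_M_derived: "closedin Omega_top (M_derived a)"
  by (rule closedin_trans_full[OF _ closedin_M_set, folded M_top_def, OF M.closedin_closed_derived])

lemma closedin_M_topI: "closedin Omega_top S \<Longrightarrow> closedin (M_top a) (S \<inter> M_set a)"
  by (auto simp: M_top_def closedin_subtopology)

lemma M_conj:
  assumes "t \<in> carrier Omega" "m \<in> M_set a"
  shows "t \<otimes>\<^bsub>Omega\<^esub> m \<otimes>\<^bsub>Omega\<^esub> inv\<^bsub>Omega\<^esub> t \<in> M_set a"
  using assms by (simp add: M_set_eq phi_sum_mult phi_sum_inv)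

lemma continuous_map_Omega_conj:
  assumes t: "t \<in> carrier Omega"
  shows "continuous_map Omega_top Omega_top (\<lambda>f. t \<otimes>\<^bsub>Omega\<^esub> f \<otimes>\<^bsub>Omega\<^esub> inv\<^bsub>Omega\<^esub> t)"
  using continuous_map_compose[OF continuous_map_Omega_mult_left[OF t]
      continuous_map_Omega_mult_right[OF Omega.inv_closed[OF t]]]
  by (simp add: Omega_mult comp_def)

text \<open>Conjugation by an element of \<open>Omega\<close> is a continuous automorphism
  preserving \<open>M\<close>. The preimage of \<open>M_derived a\<close> under it is therefore a
  closed subgroup that contains the commutators of \<open>M\<close>.\<close>

lemma normal_M_derived: "M_derived a \<lhd> Omega"
proof -
  have "t \<otimes>\<^bsub>Omega\<^esub> d \<otimes>\<^bsub>Omega\<^esub> inv\<^bsub>Omega\<^esub> t \<in> M_derived a"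
    if t: "t \<in> carrier Omega" and d: "d \<in> M_derived a" for t d
  proof -
    let ?c = "\<lambda>f. t \<otimes>\<^bsub>Omega\<^esub> f \<otimes>\<^bsub>Omega\<^esub> inv\<^bsub>Omega\<^esub> t"
    define K where "K = {f \<in> carrier Omega. ?c f \<in> M_derived a}"
    have c_mult: "?c (f \<otimes>\<^bsub>Omega\<^esub> g) = ?c f \<otimes>\<^bsub>Omega\<^esub> ?c g"
      if "f \<in> carrier Omega" "g \<in> carrier Omega" for f g
    proof -
      have "inv\<^bsub>Omega\<^esub> t \<otimes>\<^bsub>Omega\<^esub> (t \<otimes>\<^bsub>Omega\<^esub> (g \<otimes>\<^bsub>Omega\<^esub> inv\<^bsub>Omega\<^esub> t)) = g \<otimes>\<^bsub>Omega\<^esub> inv\<^bsub>Omega\<^esub> t"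
        using that t by (simp flip: Omega.m_assoc)
      then show ?thesis using that t by (simp add: Omega.m_assoc)
    qed
    have c_inv: "?c (inv\<^bsub>Omega\<^esub> f) = inv\<^bsub>Omega\<^esub> (?c f)" if "f \<in> carrier Omega" for f
      using that t by (simp add: Omega.inv_mult_group Omega.m_assoc)
    have sub: "subgroup K Omega"
    proof (rule Omega.subgroupI)
      show "K \<noteq> {}"
        using subgroup.one_closed[OF subgroup_M_derived] t by (auto simp: K_def intro!: exI[of _ "\<one>\<^bsub>Omega\<^esub>"])
    next
      fix f assume "f \<in> K"
      then show "inv\<^bsub>Omega\<^esub> f \<in> K"
        using subgroup.m_inv_closed[OF subgroup_M_derived] by (simp add: K_def c_inv)
    next
      fix f g assume "f \<in> K" "g \<in> K"
      then show "f \<otimes>\<^bsub>Omega\<^esub> g \<in> K"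
        using subgroup.m_closed[OF subgroup_M_derived] by (simp add: K_def c_mult)
    qed (auto simp: K_def)
    have "closedin Omega_top {f \<in> topspace Omega_top. ?c f \<in> M_derived a}"
      using continuous_map_Omega_conj[OF t] closedin_M_derived
      by (rule closedin_continuous_map_preimage)
    then have closed: "closedin (M_top a) (K \<inter> M_set a)"
      by (intro closedin_M_topI) (simp add: K_def)
    have "M_derived a \<subseteq> K \<inter> M_set a"
    proof (rule M.closed_derived_subset)
      show "subgroup (K \<inter> M_set a) (M_group a)"
        unfolding M_group_def using sub subgroup_M_set
        by (intro Omega.subgroup_incl Omega.subgroups_Inter_pair) auto
      fix g h assume gh: "g \<in> carrier (M_group a)" "h \<in> carrier (M_group a)"
      then have M: "g \<in> M_set a" "h \<in> M_set a" "?c g \<in> M_set a" "?c h \<in> M_set a"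
        using M_conj[OF t] by auto
      then have g: "g \<in> carrier Omega" "h \<in> carrier Omega" by (auto dest: M_set_in_Omega)
      have "?c (g \<otimes>\<^bsub>Omega\<^esub> h \<otimes>\<^bsub>Omega\<^esub> inv\<^bsub>Omega\<^esub> g \<otimes>\<^bsub>Omega\<^esub> inv\<^bsub>Omega\<^esub> h) =
        ?c g \<otimes>\<^bsub>Omega\<^esub> ?c h \<otimes>\<^bsub>Omega\<^esub> inv\<^bsub>Omega\<^esub> (?c g) \<otimes>\<^bsub>Omega\<^esub> inv\<^bsub>Omega\<^esub> (?c h)"
        using g by (simp only: c_mult c_inv Omega.m_closed Omega.inv_closed)
      moreover have "\<dots> \<in> M_derived a"
        using M.commutator_in_closed_derived[of "?c g" a "?c h"] M by simp
      moreover have "g \<otimes>\<^bsub>Omega\<^esub> h \<otimes>\<^bsub>Omega\<^esub> inv\<^bsub>Omega\<^esub> g \<otimes>\<^bsub>Omega\<^esub> inv\<^bsub>Omega\<^esub> h \<in> M_set a"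
        using M.commutator_in_closed_derived[of g a h] M M_derived_subset by auto
      ultimately show "g \<otimes>\<^bsub>M_group a\<^esub> h \<otimes>\<^bsub>M_group a\<^esub> inv\<^bsub>M_group a\<^esub> g \<otimes>\<^bsub>M_group a\<^esub> inv\<^bsub>M_group a\<^esub> h
        \<in> K \<inter> M_set a"
        using M g by (simp add: K_def)
    qed (rule closed)
    with d show ?thesis by (auto simp: K_def)
  qed
  then show ?thesis by (simp add: Omega.normal_inv_iff subgroup_M_derived)
qed

lemma M_derived_subset_Omega_derived: "M_derived a \<subseteq> Omega_derived"
proof -
  have "M_derived a \<subseteq> Omega_derived \<inter> M_set a"
  proof (rule M.closed_derived_subset)
    show "subgroup (Omega_derived \<inter> M_set a) (M_group a)"
      unfolding M_group_def using Omega.subgroup_closed_derived subgroup_M_set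
      by (intro Omega.subgroup_incl Omega.subgroups_Inter_pair) auto
    show "closedin (M_top a) (Omega_derived \<inter> M_set a)"
      using Omega.closedin_closed_derived by (rule closedin_M_topI)
    fix g h assume gh: "g \<in> carrier (M_group a)" "h \<in> carrier (M_group a)"
    then show "g \<otimes>\<^bsub>M_group a\<^esub> h \<otimes>\<^bsub>M_group a\<^esub> inv\<^bsub>M_group a\<^esub> g \<otimes>\<^bsub>M_group a\<^esub> inv\<^bsub>M_group a\<^esub> h
      \<in> Omega_derived \<inter> M_set a"
      using M.commutator_in_closed_derived[of g a h] M_derived_subset[of a]
        Omega.commutator_in_closed_derived[of g h] by (auto dest: M_set_in_Omega)
  qed
  then show ?thesis by blast
qed


subsection \<open>Commutators of \<open>Omega\<close> modulo \<open>M_derived a\<close>\<close>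

text \<open>Leaving out the index 0 lets one function serve both cases: it is the first coordinate
  of \<open>star_map a\<close>, and equals \<open>character_x a\<close> if
  \<open>a 0 = 0\<close>.\<close>

definition lam :: "(nat \<Rightarrow> bit) \<Rightarrow> (word \<Rightarrow> word) \<Rightarrow> bit" where
  "lam a f = (\<Sum>i\<in>{i. 1 \<le> i \<and> a i \<noteq> 0}. a i * phi_tilde i Lx f)"

definition phi_sum1 :: "(nat \<Rightarrow> bit) \<Rightarrow> (word \<Rightarrow> word) \<Rightarrow> bit" where
  "phi_sum1 a f = (\<Sum>i\<in>{i. 1 \<le> i \<and> a i \<noteq> 0}. a i * phi i f)"

lemma lam_mult:
  assumes "f \<in> carrier Omega" "g \<in> carrier Omega"
  shows "lam a (f \<otimes>\<^bsub>Omega\<^esub> g) = lam a f + lam a g + phi 0 f * phi_sum1 a g"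
proof -
  have "lam a (f \<otimes>\<^bsub>Omega\<^esub> g) = (\<Sum>i\<in>{i. 1 \<le> i \<and> a i \<noteq> 0}.
      a i * phi_tilde i Lx f + a i * phi_tilde i Lx g + phi 0 f * (a i * phi i g))"
    unfolding lam_def
    by (intro sum.cong refl) (simp add: Omega_mult phi_tilde_cocycle[OF assms] algebra_simps)
  then show ?thesis
    by (simp add: sum.distrib lam_def phi_sum1_def sum_distrib_left)
qed

lemma continuous_map_phi_tilde: "continuous_map Omega_top (discrete_topology UNIV) (phi_tilde i s)"
  by (rule continuous_map_Omega_discrete[of "Suc i"]) (rule phi_tilde_cong)

lemma continuous_map_lam: "continuous_map Omega_top (discrete_topology UNIV) (lam a)"
proof -
  have "continuous_map Omega_top (discrete_topology UNIV)
    (\<lambda>f. \<Sum>i\<in>{i. 1 \<le> i \<and> a i \<noteq> 0}. a i * phi_tilde i Lx f)"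
    by (rule continuous_map_discrete_sum)
       (rule continuous_map_discrete_comp[of _ "phi_tilde _ _" "(*) (a _)"], rule continuous_map_phi_tilde)
  then show ?thesis by (simp add: lam_def[abs_def])
qed

lemma character_x_eq_lam: "a 0 = 0 \<Longrightarrow> character_x a = lam a"
proof -
  assume "a 0 = 0"
  then have "{i. 1 \<le> i \<and> a i \<noteq> 0} = {i. a i \<noteq> 0}"
    by (auto simp: Suc_le_eq intro!: gr0I)
  then show ?thesis by (simp add: character_x_def[abs_def] lam_def[abs_def])
qed

lemma star_map_eq_lam: "star_map a f = (lam a f, phi 0 f)"
  by (simp add: star_map_def lam_def)

lemma continuous_map_M_top:
  "continuous_map Omega_top T f \<Longrightarrow> continuous_map (M_top a) T f"
  by (simp add: M_top_def continuous_map_from_subtopology)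

section \<open>Explicit elements inside and outside \<open>M_set a\<close>\<close>

locale nontrivial_sequence =
  fixes a :: "nat \<Rightarrow> bit"
  assumes finite_support: "finite {i. a i \<noteq> 0}"
    and nonzero: "a \<noteq> (\<lambda>_. 0)"
    and not_delta: "a \<noteq> (\<lambda>i. if i = 0 then 1 else 0)"
begin

lemma phi_sum_split: "phi_sum a f = a 0 * phi 0 f + phi_sum1 a f"
proof (cases "a 0 = 0")
  case True
  then have "{i. 1 \<le> i \<and> a i \<noteq> 0} = {i. a i \<noteq> 0}"
    by (auto simp: Suc_le_eq intro!: gr0I)
  then show ?thesis using True by (simp add: phi_sum_def phi_sum1_def)
next
  case False
  then have "{i. a i \<noteq> 0} = insert 0 {i. 1 \<le> i \<and> a i \<noteq> 0}"
    by (auto intro: Suc_leI)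
  moreover have "finite {i. 1 \<le> i \<and> a i \<noteq> 0}"
    by (rule finite_subset[OF _ finite_support]) auto
  ultimately show ?thesis by (simp add: phi_sum_def phi_sum1_def)
qed

text \<open>In characteristic 2 a vanishing sum means equal summands. The coboundary of
  \<open>lam a\<close> on \<open>M\<close> is thereby expressed through \<open>phi 0\<close>
  alone.\<close>

lemma phi_sum1_M: "f \<in> M_set a \<Longrightarrow> phi_sum1 a f = a 0 * phi 0 f"
  using phi_sum_split[of f] by (cases "a 0 * phi 0 f"; cases "phi_sum1 a f") (auto simp: M_set_eq)

text \<open>The two excluded sequences are precisely those with no entry 1 at a positive index. Such
  an index yields involutions outside \<open>M\<close> that preserve both branches and can be
  supported in either of them.\<close>

lemma ex_index: "\<exists>i\<ge>1. a i = 1"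
proof (rule ccontr)
  assume "\<not> ?thesis"
  then have *: "a i = 0" if "i \<noteq> 0" for i
    using that by (metis Suc_leI bit_not_one_iff gr0I One_nat_def)
  show False
  proof (cases "a 0 = 0")
    case True
    with * have "a = (\<lambda>_. 0)" by (metis ext)
    with nonzero show False by contradiction
  next
    case False
    with * have "a = (\<lambda>i. if i = 0 then 1 else 0)" by auto
    with not_delta show False by contradiction
  qed
qed

definition idx :: nat where "idx = (SOME i. 1 \<le> i \<and> a i = 1)"

lemma idx: "1 \<le> idx" "a idx = 1"
  using someI_ex[of "\<lambda>i. 1 \<le> i \<and> a i = 1"] ex_index by (auto simp: idx_def)

lemma phi_sum_sigma: "length w = idx \<Longrightarrow> phi_sum a (sigma w) = 1"
proof -
  assume w: "length w = idx"
  have "phi_sum a (sigma w) = (\<Sum>i\<in>{i. a i \<noteq> 0}. if i = idx then 1 else 0)"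
    unfolding phi_sum_def by (intro sum.cong refl) (simp add: phi_sigma w)
  also have "\<dots> = 1" using idx finite_support by (simp add: sum.delta)
  finally show ?thesis .
qed

definition tau :: "word \<Rightarrow> word" where "tau = sigma (replicate idx Lx)"

lemma tau_in_Omega [simp]: "tau \<in> carrier Omega"
  by (simp add: tau_def)

lemma phi_sum_tau [simp]: "phi_sum a tau = 1"
  by (simp add: tau_def phi_sum_sigma)

lemma phi_0_tau [simp]: "phi 0 tau = 0"
  using idx by (simp add: tau_def phi_sigma)

lemma tau_tau [simp]: "tau \<otimes>\<^bsub>Omega\<^esub> tau = \<one>\<^bsub>Omega\<^esub>"
  by (simp add: tau_def Omega_mult Omega_one)

lemma inv_tau [simp]: "inv\<^bsub>Omega\<^esub> tau = tau"
  by (rule Omega.inv_equality) simp_all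

text \<open>The purpose is a branch swap inside \<open>M\<close>. The root involution
  \<open>sigma []\<close> lies outside \<open>M\<close> when \<open>a 0 = 1\<close>; the factor
  \<open>tau\<close> then brings it back without changing the root bit.\<close>

definition mu :: "word \<Rightarrow> word" where
  "mu = (if a 0 = 0 then sigma [] else sigma [] \<otimes>\<^bsub>Omega\<^esub> tau)"

lemma mu_in_Omega [simp]: "mu \<in> carrier Omega"
  by (simp add: mu_def)

lemma phi_0_mu [simp]: "phi 0 mu = 1"
  by (simp add: mu_def phi_mult phi_sigma)

lemma phi_sum_sigma_Nil: "phi_sum a (sigma []) = a 0"
proof -
  have "phi_sum1 a (sigma []) = 0"
    unfolding phi_sum1_def by (rule sum.neutral) (simp add: phi_sigma)
  then show ?thesis by (simp add: phi_sum_split phi_sigma)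
qed

lemma mu_in_M [simp]: "mu \<in> M_set a"
  by (simp add: M_set_eq) (simp add: mu_def phi_sum_mult phi_sum_sigma_Nil)

definition zeta :: "word \<Rightarrow> word" where
  "zeta = tau \<otimes>\<^bsub>Omega\<^esub> mu \<otimes>\<^bsub>Omega\<^esub> inv\<^bsub>Omega\<^esub> tau \<otimes>\<^bsub>Omega\<^esub> inv\<^bsub>Omega\<^esub> mu"

lemma zeta_in_Omega [simp]: "zeta \<in> carrier Omega"
  by (simp add: zeta_def)

lemma zeta_in_M [simp]: "zeta \<in> M_set a"
  by (simp add: M_set_eq) (simp add: zeta_def phi_sum_mult phi_sum_inv)

lemma phi_0_zeta [simp]: "phi 0 zeta = 0"
  by (simp add: zeta_def phi_mult phi_inv)

lemma zeta_in_Omega_derived: "zeta \<in> Omega_derived"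
  unfolding zeta_def by (rule Omega.commutator_in_closed_derived) simp_all

lemma zeta_mu: "zeta \<otimes>\<^bsub>Omega\<^esub> mu = tau \<otimes>\<^bsub>Omega\<^esub> mu \<otimes>\<^bsub>Omega\<^esub> tau"
  by (simp add: zeta_def Omega.m_assoc)

text \<open>\<open>zeta\<close> is the difference between \<open>tau mu\<close> and
  \<open>mu tau\<close>, on which the linear parts of \<open>lam a\<close> agree. The coboundary
  contributes \<open>phi 0 mu * phi_sum1 a tau = 1\<close> to the second product, but nothing to the
  first because \<open>phi 0 tau = 0\<close>.\<close>

lemma lam_zeta: "lam a zeta = 1"
proof -
  have "zeta \<otimes>\<^bsub>Omega\<^esub> (mu \<otimes>\<^bsub>Omega\<^esub> tau) = tau \<otimes>\<^bsub>Omega\<^esub> mu"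
  proof -
    have "zeta \<otimes>\<^bsub>Omega\<^esub> (mu \<otimes>\<^bsub>Omega\<^esub> tau) = tau \<otimes>\<^bsub>Omega\<^esub> mu \<otimes>\<^bsub>Omega\<^esub> tau \<otimes>\<^bsub>Omega\<^esub> tau"
      by (simp flip: zeta_mu Omega.m_assoc)
    then show ?thesis by (simp add: Omega.m_assoc)
  qed
  then have "lam a (zeta \<otimes>\<^bsub>Omega\<^esub> (mu \<otimes>\<^bsub>Omega\<^esub> tau)) = lam a (tau \<otimes>\<^bsub>Omega\<^esub> mu)" by simp
  moreover have "phi_sum1 a tau = 1" using phi_sum_split[of tau] by simp
  ultimately have "lam a zeta + (lam a mu + lam a tau + 1) = lam a tau + lam a mu"
    by (simp add: lam_mult)
  then show ?thesis
    by (cases "lam a zeta"; cases "lam a mu"; cases "lam a tau") simp_all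
qed

text \<open>As \<open>M\<close> has index 2, \<open>tau\<close> is \<open>n h\<close> with
  \<open>n\<close> in \<open>M\<close>. Conjugation by \<open>h\<close> fixes \<open>m\<close>, so
  the commutator of \<open>tau\<close> and \<open>m\<close> equals that of \<open>n\<close> and
  \<open>m\<close>, two elements of \<open>M\<close>.\<close>

lemma commute_mod_derived:
  assumes m: "m \<in> M_set a" and h: "h \<in> carrier Omega" "h \<notin> M_set a"
    and comm: "h \<otimes>\<^bsub>Omega\<^esub> m = m \<otimes>\<^bsub>Omega\<^esub> h"
  shows "tau \<otimes>\<^bsub>Omega\<^esub> m \<otimes>\<^bsub>Omega\<^esub> inv\<^bsub>Omega\<^esub> tau \<otimes>\<^bsub>Omega\<^esub> inv\<^bsub>Omega\<^esub> m \<in> M_derived a"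
proof -
  define n where "n = tau \<otimes>\<^bsub>Omega\<^esub> inv\<^bsub>Omega\<^esub> h"
  have m': "m \<in> carrier Omega" using m by (rule M_set_in_Omega)
  have n: "n \<in> carrier Omega" using h by (simp add: n_def)
  have "phi_sum a h = 1" using h by (simp add: M_set_eq)
  then have nM: "n \<in> M_set a"
    using h by (simp add: n_def M_set_eq phi_sum_mult phi_sum_inv)
  have tau: "tau = n \<otimes>\<^bsub>Omega\<^esub> h" using h by (simp add: n_def Omega.m_assoc)
  have "h \<otimes>\<^bsub>Omega\<^esub> m \<otimes>\<^bsub>Omega\<^esub> inv\<^bsub>Omega\<^esub> h = m"
    unfolding comm using h m' by (simp add: Omega.m_assoc)
  then have "n \<otimes>\<^bsub>Omega\<^esub> (h \<otimes>\<^bsub>Omega\<^esub> m \<otimes>\<^bsub>Omega\<^esub> inv\<^bsub>Omega\<^esub> h) \<otimes>\<^bsub>Omega\<^esub> inv\<^bsub>Omega\<^esub> n =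
    n \<otimes>\<^bsub>Omega\<^esub> m \<otimes>\<^bsub>Omega\<^esub> inv\<^bsub>Omega\<^esub> n" by simp
  then have "tau \<otimes>\<^bsub>Omega\<^esub> m \<otimes>\<^bsub>Omega\<^esub> inv\<^bsub>Omega\<^esub> tau =
    n \<otimes>\<^bsub>Omega\<^esub> m \<otimes>\<^bsub>Omega\<^esub> inv\<^bsub>Omega\<^esub> n"
    unfolding tau using n h m' by (simp add: Omega.m_assoc Omega.inv_mult_group)
  moreover have "n \<otimes>\<^bsub>Omega\<^esub> m \<otimes>\<^bsub>Omega\<^esub> inv\<^bsub>Omega\<^esub> n \<otimes>\<^bsub>Omega\<^esub> inv\<^bsub>Omega\<^esub> m \<in> M_derived a"
    using M.commutator_in_closed_derived[of n a m] nM m by simp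
  ultimately show ?thesis by simp
qed

section \<open>The quotient of \<open>Omega\<close> by \<open>M_derived a\<close>\<close>

abbreviation Q :: "(word \<Rightarrow> word) set monoid" where "Q \<equiv> Omega Mod M_derived a"
abbreviation q :: "(word \<Rightarrow> word) \<Rightarrow> (word \<Rightarrow> word) set" where "q f \<equiv> M_derived a #>\<^bsub>Omega\<^esub> f"

lemma group_Q: "group Q"
  using normal_M_derived by (rule normal.factorgroup_is_group)

lemma q_hom: "q \<in> hom Omega Q"
  using normal_M_derived by (rule normal.r_coset_hom_Mod)

lemma group_hom_q: "group_hom Omega Q q"
  using group_Omega group_Q q_hom by (simp add: group_hom_def group_hom_axioms_def)

lemma q_eq_one_iff: "f \<in> carrier Omega \<Longrightarrow> q f = \<one>\<^bsub>Q\<^esub> \<longleftrightarrow> f \<in> M_derived a"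
  using subgroup_M_derived Omega.coset_join1 Omega.coset_join2 by (metis one_FactGroup)

lemma q_eq_iff:
  assumes "f \<in> carrier Omega" "g \<in> carrier Omega"
  shows "q f = q g \<longleftrightarrow> f \<otimes>\<^bsub>Omega\<^esub> inv\<^bsub>Omega\<^esub> g \<in> M_derived a"
proof -
  interpret Q: group Q by (rule group_Q)
  interpret q: group_hom Omega Q q by (rule group_hom_q)
  have "q (f \<otimes>\<^bsub>Omega\<^esub> inv\<^bsub>Omega\<^esub> g) = q f \<otimes>\<^bsub>Q\<^esub> inv\<^bsub>Q\<^esub> q g"
    using assms by (simp only: q.hom_mult q.hom_inv Omega.inv_closed)
  moreover have "q f \<otimes>\<^bsub>Q\<^esub> inv\<^bsub>Q\<^esub> q g = \<one>\<^bsub>Q\<^esub> \<longleftrightarrow> q f = q g"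
    using assms q.hom_closed Q.inv_solve_right'[of "\<one>\<^bsub>Q\<^esub>" "q f" "q g"] Q.l_one Q.one_closed by metis
  ultimately show ?thesis
    using assms q_eq_one_iff[of "f \<otimes>\<^bsub>Omega\<^esub> inv\<^bsub>Omega\<^esub> g"] by simp
qed

lemma q_commute:
  assumes "f \<in> carrier Omega" "g \<in> carrier Omega"
    and "f \<otimes>\<^bsub>Omega\<^esub> g \<otimes>\<^bsub>Omega\<^esub> inv\<^bsub>Omega\<^esub> f \<otimes>\<^bsub>Omega\<^esub> inv\<^bsub>Omega\<^esub> g \<in> M_derived a"
  shows "q f \<otimes>\<^bsub>Q\<^esub> q g = q g \<otimes>\<^bsub>Q\<^esub> q f"
proof -
  have "q (f \<otimes>\<^bsub>Omega\<^esub> g) = q (g \<otimes>\<^bsub>Omega\<^esub> f)"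
    using assms by (subst q_eq_iff) (simp_all add: Omega.inv_mult_group Omega.m_assoc)
  then show ?thesis using assms(1,2) hom_mult[OF q_hom] by metis
qed

text \<open>Modulo \<open>M_derived a\<close>, all elements outside \<open>M_set a\<close> act on \<open>M_set a\<close> by the same
  conjugation, so it suffices to find one of them commuting with \<open>m\<close>: a branch of \<open>m\<close> itself,
  or an involution supported on the other branch.\<close>

lemma tau_commutes:
  assumes m: "m \<in> M_set a" and "phi 0 m = 0"
  shows "q tau \<otimes>\<^bsub>Q\<^esub> q m = q m \<otimes>\<^bsub>Q\<^esub> q tau"
proof -
  interpret Q: group Q by (rule group_Q)
  interpret q: group_hom Omega Q q by (rule group_hom_q)
  have m': "m \<in> carrier Omega" using m by (rule M_set_in_Omega)
  then have p: "portrait m [] = 0" using assms by (simp add: phi_0)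
  have b: "branch s m \<in> carrier Omega" for s
    using m' p by (rule branch_in_Omega)
  show ?thesis
  proof (cases "branch Lx m \<in> M_set a")
    case False
    have "branch Lx m \<otimes>\<^bsub>Omega\<^esub> m = m \<otimes>\<^bsub>Omega\<^esub> branch Lx m"
      using branch_commute[OF m' p] by (simp add: Omega_mult)
    from commute_mod_derived[OF m b False this] show ?thesis
      using m' by (intro q_commute) simp_all
  next
    case True
    have eq: "m = branch Lx m \<otimes>\<^bsub>Omega\<^esub> branch Ly m"
      using Omega_eq_branches[OF m' p] by (simp add: Omega_mult)
    have "phi_sum a m = phi_sum a (branch Lx m) + phi_sum a (branch Ly m)"
      using b phi_sum_mult[of "branch Lx m" "branch Ly m" a] eq by simp
    with True m b have bM: "branch s m \<in> M_set a" for s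
      by (cases s) (simp_all add: M_set_eq)
    have comm: "q tau \<otimes>\<^bsub>Q\<^esub> q (branch s m) = q (branch s m) \<otimes>\<^bsub>Q\<^esub> q tau" for s
    proof -
      let ?w = "replicate idx (other s)"
      have w: "?w \<noteq> []" "last ?w \<noteq> s" using idx(1) by auto
      have "sigma ?w \<otimes>\<^bsub>Omega\<^esub> branch s m = branch s m \<otimes>\<^bsub>Omega\<^esub> sigma ?w"
        using sigma_branch_commute[OF m' p w] by (simp add: Omega_mult)
      moreover have "sigma ?w \<notin> M_set a" by (simp add: M_set_eq phi_sum_sigma)
      ultimately show ?thesis
        using commute_mod_derived[OF bM sigma_in_Omega] b by (intro q_commute) simp_all
    qed
    have qm: "q m = q (branch Lx m) \<otimes>\<^bsub>Q\<^esub> q (branch Ly m)"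
      using eq b q.hom_mult[of "branch Lx m" "branch Ly m"] by metis
    have c: "q tau \<in> carrier Q" "q (branch s m) \<in> carrier Q" for s
      using b q.hom_closed tau_in_Omega by blast+
    have "q tau \<otimes>\<^bsub>Q\<^esub> q m = q (branch Lx m) \<otimes>\<^bsub>Q\<^esub> q tau \<otimes>\<^bsub>Q\<^esub> q (branch Ly m)"
      unfolding qm using c comm[of Lx] by (metis Q.m_assoc)
    also have "\<dots> = q m \<otimes>\<^bsub>Q\<^esub> q tau"
      unfolding qm using c comm[of Ly] by (metis Q.m_assoc)
    finally show ?thesis .
  qed
qed

lemma Q_structure:
  shows "q zeta \<otimes>\<^bsub>Q\<^esub> q zeta = \<one>\<^bsub>Q\<^esub>"
    and "\<And>f g. f \<in> carrier Omega \<Longrightarrow> g \<in> carrier Omega \<Longrightarrow>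
      q (f \<otimes>\<^bsub>Omega\<^esub> g \<otimes>\<^bsub>Omega\<^esub> inv\<^bsub>Omega\<^esub> f \<otimes>\<^bsub>Omega\<^esub> inv\<^bsub>Omega\<^esub> g) \<in> {\<one>\<^bsub>Q\<^esub>, q zeta}"
proof -
  interpret Q: group Q by (rule group_Q)
  interpret q: group_hom Omega Q q by (rule group_hom_q)
  have A: "subgroup (q ` M_set a) Q"
    using subgroup_M_set by (rule q.subgroup_img_is_subgroup)
  have comm: "x \<otimes>\<^bsub>Q\<^esub> y = y \<otimes>\<^bsub>Q\<^esub> x" if xy: "x \<in> q ` M_set a" "y \<in> q ` M_set a" for x y
  proof -
    obtain f g where fg: "x = q f" "y = q g" "f \<in> M_set a" "g \<in> M_set a"
      using xy by blast
    then have "f \<otimes>\<^bsub>Omega\<^esub> g \<otimes>\<^bsub>Omega\<^esub> inv\<^bsub>Omega\<^esub> f \<otimes>\<^bsub>Omega\<^esub> inv\<^bsub>Omega\<^esub> g \<in> M_derived a"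
      using M.commutator_in_closed_derived[of f a g] by simp
    then show ?thesis
      unfolding fg(1,2) by (rule q_commute[rotated 2]) (use fg M_set_in_Omega in blast)+
  qed
  have t: "q tau \<in> carrier Q" "q tau \<otimes>\<^bsub>Q\<^esub> q tau = \<one>\<^bsub>Q\<^esub>"
    using q.hom_closed q.hom_mult[of tau tau] q.hom_one tau_tau tau_in_Omega by metis+
  have cover: "x \<in> q ` M_set a \<or> x \<otimes>\<^bsub>Q\<^esub> q tau \<in> q ` M_set a" if x: "x \<in> carrier Q" for x
  proof -
    obtain f where f: "f \<in> carrier Omega" "x = q f"
      using x by (auto simp: carrier_FactGroup)
    show ?thesis
    proof (cases "f \<in> M_set a")
      case False
      then have "f \<otimes>\<^bsub>Omega\<^esub> tau \<in> M_set a"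
        using f by (simp add: M_set_eq phi_sum_mult)
      then show ?thesis using f q.hom_mult[of f tau] by (metis imageI tau_in_Omega)
    qed (use f in blast)
  qed
  have z: "q zeta \<otimes>\<^bsub>Q\<^esub> q mu = q tau \<otimes>\<^bsub>Q\<^esub> q mu \<otimes>\<^bsub>Q\<^esub> q tau"
    using zeta_mu q.hom_mult tau_in_Omega mu_in_Omega zeta_in_Omega Omega.m_closed by metis
  have fix_t: "q tau \<otimes>\<^bsub>Q\<^esub> x = x \<otimes>\<^bsub>Q\<^esub> q tau \<or>
    q tau \<otimes>\<^bsub>Q\<^esub> (x \<otimes>\<^bsub>Q\<^esub> inv\<^bsub>Q\<^esub> q mu) = x \<otimes>\<^bsub>Q\<^esub> inv\<^bsub>Q\<^esub> q mu \<otimes>\<^bsub>Q\<^esub> q tau"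
    if x: "x \<in> q ` M_set a" for x
  proof -
    obtain m where m: "x = q m" "m \<in> M_set a" using x by blast
    then have m': "m \<in> carrier Omega" by (auto dest: M_set_in_Omega)
    show ?thesis
    proof (cases "phi 0 m = 0")
      case True
      show ?thesis unfolding m(1) using tau_commutes[OF m(2) True] by (rule disjI1)
    next
      \<comment> \<open>Both \<open>m\<close> and \<open>mu\<close> swap the branches; their
        quotient preserves them, so \<open>tau_commutes\<close> applies to it.\<close>
      case False
      have "x \<otimes>\<^bsub>Q\<^esub> inv\<^bsub>Q\<^esub> q mu = q (m \<otimes>\<^bsub>Omega\<^esub> inv\<^bsub>Omega\<^esub> mu)"
        unfolding m(1) using m' q.hom_mult q.hom_inv mu_in_Omega Omega.inv_closed by metis
      moreover have "m \<otimes>\<^bsub>Omega\<^esub> inv\<^bsub>Omega\<^esub> mu \<in> M_set a"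
        using m mu_in_M subgroup_M_set by (simp add: subgroup.m_closed subgroup.m_inv_closed)
      moreover have "phi 0 (m \<otimes>\<^bsub>Omega\<^esub> inv\<^bsub>Omega\<^esub> mu) = 0"
        using m' False by (simp add: phi_mult phi_inv)
      ultimately show ?thesis using tau_commutes by metis
    qed
  qed
  note * = Q.commutators_of_index_two_abelian[of "q ` M_set a" "q tau" "q mu" "q zeta",
      OF A comm t cover imageI[OF mu_in_M] imageI[OF zeta_in_M] z
        tau_commutes[OF zeta_in_M phi_0_zeta] fix_t]
  show "q zeta \<otimes>\<^bsub>Q\<^esub> q zeta = \<one>\<^bsub>Q\<^esub>" by (rule *(1))
  show "q (f \<otimes>\<^bsub>Omega\<^esub> g \<otimes>\<^bsub>Omega\<^esub> inv\<^bsub>Omega\<^esub> f \<otimes>\<^bsub>Omega\<^esub> inv\<^bsub>Omega\<^esub> g) \<in> {\<one>\<^bsub>Q\<^esub>, q zeta}"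
    if fg: "f \<in> carrier Omega" "g \<in> carrier Omega" for f g
  proof -
    have "q f \<otimes>\<^bsub>Q\<^esub> q g \<otimes>\<^bsub>Q\<^esub> inv\<^bsub>Q\<^esub> q f \<otimes>\<^bsub>Q\<^esub> inv\<^bsub>Q\<^esub> q g \<in> {\<one>\<^bsub>Q\<^esub>, q zeta}"
      using fg by (intro *(2) q.hom_closed)
    then show ?thesis
      using fg by (simp only: q.hom_mult q.hom_inv Omega.inv_closed Omega.m_closed)
  qed
qed

lemma zeta_square: "zeta \<otimes>\<^bsub>Omega\<^esub> zeta \<in> M_derived a"
proof -
  have "q (zeta \<otimes>\<^bsub>Omega\<^esub> zeta) = \<one>\<^bsub>Q\<^esub>"
    using Q_structure(1) hom_mult[OF q_hom zeta_in_Omega zeta_in_Omega] by metis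
  then show ?thesis using q_eq_one_iff[of "zeta \<otimes>\<^bsub>Omega\<^esub> zeta"] by simp
qed

text \<open>The union of \<open>M_derived a\<close> and its coset of \<open>zeta\<close> is a
  subgroup because \<open>zeta\<close> squares into \<open>M_derived a\<close>, is closed because
  translations are continuous, and contains all commutators by \<open>Q_structure\<close>.\<close>

lemma Omega_derived_cases:
  assumes "f \<in> Omega_derived"
  shows "f \<in> M_derived a \<or> f \<otimes>\<^bsub>Omega\<^esub> inv\<^bsub>Omega\<^esub> zeta \<in> M_derived a"
proof -
  interpret Q: group Q by (rule group_Q)
  interpret q: group_hom Omega Q q by (rule group_hom_q)
  define H where "H = {f \<in> carrier Omega. q f \<in> {\<one>\<^bsub>Q\<^esub>, q zeta}}"
  have qz: "q zeta \<in> carrier Q" using q.hom_closed zeta_in_Omega by blast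
  have H_iff: "f \<in> H \<longleftrightarrow> f \<in> carrier Omega \<and>
    (f \<in> M_derived a \<or> f \<otimes>\<^bsub>Omega\<^esub> inv\<^bsub>Omega\<^esub> zeta \<in> M_derived a)" for f
    unfolding H_def using q_eq_one_iff[of f] q_eq_iff[of f zeta] by auto
  have "subgroup H Omega"
  proof (rule Omega.subgroupI)
    show "H \<subseteq> carrier Omega" by (auto simp: H_def)
    have "\<one>\<^bsub>Omega\<^esub> \<in> H"
      using subgroup.one_closed[OF subgroup_M_derived] by (simp add: H_iff)
    then show "H \<noteq> {}" by blast
    fix f assume f: "f \<in> H"
    have "inv\<^bsub>Q\<^esub> q zeta = q zeta"
      using Q_structure(1) qz by (rule Q.inv_equality) (rule qz)
    moreover have "q (inv\<^bsub>Omega\<^esub> f) = inv\<^bsub>Q\<^esub> q f"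
      using f by (intro q.hom_inv) (simp add: H_def)
    ultimately show "inv\<^bsub>Omega\<^esub> f \<in> H"
      using f Q.inv_one unfolding H_def by auto
    fix g assume g: "g \<in> H"
    have "q (f \<otimes>\<^bsub>Omega\<^esub> g) = q f \<otimes>\<^bsub>Q\<^esub> q g"
      using f g by (intro q.hom_mult) (simp_all add: H_def)
    moreover have "q f \<otimes>\<^bsub>Q\<^esub> q g \<in> {\<one>\<^bsub>Q\<^esub>, q zeta}"
    proof -
      have "q f \<in> {\<one>\<^bsub>Q\<^esub>, q zeta}" "q g \<in> {\<one>\<^bsub>Q\<^esub>, q zeta}"
        using f g by (auto simp: H_def)
      then show ?thesis
        using Q_structure(1) Q.l_one[OF qz] Q.r_one[OF qz] Q.l_one[OF Q.one_closed]
        by (elim insertE emptyE) (metis insertI1 insertI2)+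
    qed
    ultimately show "f \<otimes>\<^bsub>Omega\<^esub> g \<in> H"
      using f g unfolding H_def by simp
  qed
  moreover have "closedin Omega_top H"
  proof -
    have "closedin Omega_top {f \<in> topspace Omega_top. f \<circ> inv\<^bsub>Omega\<^esub> zeta \<in> M_derived a}"
      by (rule closedin_continuous_map_preimage[OF continuous_map_Omega_mult_right closedin_M_derived]) simp
    then have "closedin Omega_top ({f \<in> topspace Omega_top. f \<circ> inv\<^bsub>Omega\<^esub> zeta \<in> M_derived a} \<union> M_derived a)"
      using closedin_M_derived by (rule closedin_Un)
    also have "{f \<in> topspace Omega_top. f \<circ> inv\<^bsub>Omega\<^esub> zeta \<in> M_derived a} \<union> M_derived a = H"
      using subgroup.mem_carrier[OF subgroup_M_derived] by (auto simp: H_iff Omega_mult)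
    finally show ?thesis .
  qed
  ultimately have "Omega_derived \<subseteq> H"
    using Q_structure(2) by (intro Omega.closed_derived_subset) (auto simp: H_def)
  with assms show ?thesis using H_iff by blast
qed

end

section \<open>Characters of \<open>M_group a\<close>\<close>

lemma F2_embed_comp_hom:
  "f \<in> hom G (add_monoid F2) \<Longrightarrow> F2_embed \<circ> f \<in> hom G Q2Z2"
  using F2_embed_hom by (rule hom_compose[rotated])

lemma star_embed_comp_hom:
  "f \<in> hom G star_group \<Longrightarrow> star_embed \<circ> f \<in> hom G Q2Z2"
  using star_embed_hom by (rule hom_compose[rotated])

lemma continuous_map_discrete_o:
  "continuous_map T (discrete_topology UNIV) f \<Longrightarrow> continuous_map T (discrete_topology UNIV) (h \<circ> f)"
  using continuous_map_discrete_comp[of T f h] by (simp add: comp_def)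

lemma M_dual_eq: "M_dual a = dual (ab_top (M_top a) (M_group a)) (ab (M_top a) (M_group a))"
  by (simp add: M_dual_def M_ab_top_def M_ab_def)

lemma Omega_dual_eq: "Omega_dual = dual (ab_top Omega_top Omega) (ab Omega_top Omega)"
  by (simp add: Omega_dual_def Omega_ab_def)

lemma phi_0_hom_M: "phi 0 \<in> hom (M_group a) (add_monoid F2)"
  by (rule homI) (simp_all add: F2_def phi_mult M_set_in_Omega)

lemma F2_character_proj:
  assumes "f \<in> hom (M_group a) (add_monoid F2)"
    and "continuous_map (M_top a) (discrete_topology UNIV) f"
  shows F2_character_in_dual: "F2_character a f \<in> carrier (M_dual a)"
    and F2_character_apply: "m \<in> M_set a \<Longrightarrow>
      F2_character a f (ab_proj (M_top a) (M_group a) m) = F2_embed (f m)"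
  unfolding F2_character_def M_dual_eq
  using M.ab_factor_in_dual[OF F2_embed_comp_hom[OF assms(1)] continuous_map_discrete_o[OF assms(2)]]
    M.ab_factor_character[OF F2_embed_comp_hom[OF assms(1)] comm_group_Q2Z2
      continuous_map_discrete_o[OF assms(2)], of m]
  by simp_all

lemma star_character_proj:
  assumes "f \<in> hom (M_group a) star_group"
    and "continuous_map (M_top a) (discrete_topology UNIV) f"
  shows star_character_in_dual: "star_character a f \<in> carrier (M_dual a)"
    and star_character_apply: "m \<in> M_set a \<Longrightarrow>
      star_character a f (ab_proj (M_top a) (M_group a) m) = star_embed (f m)"
  unfolding star_character_def M_dual_eq
  using M.ab_factor_in_dual[OF star_embed_comp_hom[OF assms(1)] continuous_map_discrete_o[OF assms(2)]]
    M.ab_factor_character[OF star_embed_comp_hom[OF assms(1)] comm_group_Q2Z2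
      continuous_map_discrete_o[OF assms(2)], of m]
  by simp_all

lemma (in group_hom) kernel_coset_eqI:
  assumes "x \<in> carrier G" "y \<in> carrier G" "h x = h y"
  shows "kernel G H h #> x = kernel G H h #> y"
proof -
  have "x \<otimes> inv y \<in> kernel G H h" using assms by (simp add: kernel_def)
  then have "x \<in> kernel G H h #> y"
    using subgroup.rcos_module_rev[OF subgroup_kernel G.is_group assms(2,1)] by blast
  then show ?thesis using G.repr_independence[OF _ assms(2) subgroup_kernel] by simp
qed

context nontrivial_sequence
begin

abbreviation pM :: "(word \<Rightarrow> word) \<Rightarrow> (word \<Rightarrow> word) set" where
  "pM \<equiv> ab_proj (M_top a) (M_group a)"

abbreviation pO :: "(word \<Rightarrow> word) \<Rightarrow> (word \<Rightarrow> word) set" where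
  "pO \<equiv> ab_proj Omega_top Omega"

lemma Omega_derived_subset_M: "Omega_derived \<subseteq> M_set a"
proof
  fix d assume d: "d \<in> Omega_derived"
  then have "phi_sum a d = 0"
    using Omega.closed_derived_trivial[OF phi_sum_hom comm_group_F2 continuous_map_phi_sum d]
    by (simp add: F2_def)
  then show "d \<in> M_set a"
    using Omega.closed_derived_in_carrier[OF d] by (simp add: M_set_eq)
qed

lemma lam_mult_M:
  assumes "f \<in> M_set a" "g \<in> M_set a"
  shows "lam a (f \<otimes>\<^bsub>Omega\<^esub> g) = lam a f + lam a g + phi 0 f * (a 0 * phi 0 g)"
  using assms by (simp add: lam_mult M_set_in_Omega phi_sum1_M)

lemma character_x_hom: "a 0 = 0 \<Longrightarrow> character_x a \<in> hom (M_group a) (add_monoid F2)"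
  by (rule homI) (simp_all add: F2_def character_x_eq_lam lam_mult_M)

lemma continuous_character_x:
  "a 0 = 0 \<Longrightarrow> continuous_map (M_top a) (discrete_topology UNIV) (character_x a)"
  by (simp add: character_x_eq_lam continuous_map_M_top continuous_map_lam)

lemma star_map_hom: "a 0 = 1 \<Longrightarrow> star_map a \<in> hom (M_group a) star_group"
  by (rule homI) (simp_all add: star_map_eq_lam star_mult lam_mult_M phi_mult M_set_in_Omega,
      simp add: star_group_def)

lemma continuous_phi_0: "continuous_map (M_top a) (discrete_topology UNIV) (phi 0)"
  by (simp add: continuous_map_M_top continuous_map_phi)

lemma continuous_star_map: "continuous_map (M_top a) (discrete_topology UNIV) (star_map a)"
  using continuous_map_discrete_combine[OF continuous_map_M_top[OF continuous_map_lam]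
      continuous_phi_0, where h = Pair]
  by (simp add: star_map_eq_lam[abs_def])

text \<open>One name for the distinguished character in both cases, so that whatever depends only on
  its value 1/2 at \<open>zeta\<close> is argued once.\<close>

definition Lam :: "(word \<Rightarrow> word) set \<Rightarrow> rat set" where
  "Lam = (if a 0 = 0 then F2_character a (character_x a) else star_character a (star_map a))"

lemma Lam_in_dual: "Lam \<in> carrier (M_dual a)"
  using F2_character_in_dual[OF character_x_hom continuous_character_x]
    star_character_in_dual[OF star_map_hom continuous_star_map]
  by (simp add: Lam_def)

lemma Lam_zeta: "Lam (pM zeta) = Q2Z2_of (1 / 2)"
proof (cases "a 0 = 0")
  case True
  then show ?thesis
    using F2_character_apply[OF character_x_hom continuous_character_x, of zeta]
    by (simp add: Lam_def character_x_eq_lam lam_zeta F2_embed_1)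
next
  case False
  then show ?thesis
    using star_character_apply[OF star_map_hom continuous_star_map, of zeta]
    by (simp add: Lam_def star_map_eq_lam lam_zeta star_embed_def)
qed

text \<open>The lower bound on the kernel: a continuous character of \<open>M\<close> is trivial on
  \<open>M_derived a\<close>, but \<open>Lam\<close> is not trivial at \<open>zeta\<close>.\<close>

lemma zeta_notin_derived: "zeta \<notin> M_derived a"
  using M.ab_dual_trivial[of Lam a zeta] Lam_in_dual Lam_zeta half_not_one by (auto simp: M_dual_eq)

lemma M_square: "m \<in> M_set a \<Longrightarrow> m \<otimes>\<^bsub>Omega\<^esub> m \<in> Omega_derived"
  by (intro Omega_square M_set_in_Omega)

lemma pM_derived:
  assumes "m \<in> Omega_derived" "m \<notin> M_derived a"
  shows "pM m = pM zeta"
proof -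
  have "m \<in> M_set a" using assms Omega_derived_subset_M by blast
  then show ?thesis
    using Omega_derived_cases[OF assms(1)] assms(2) M.ab_proj_eq_iff[of m a zeta] by simp
qed

lemma M_ab_map_proj: "m \<in> M_set a \<Longrightarrow> M_ab_map a (pM m) = pO m"
  unfolding M_ab_map_def
proof (rule M.ab_factor_proj)
  fix g h assume gh: "g \<in> carrier (M_group a)" "h \<in> carrier (M_group a)" and "pM g = pM h"
  then have "g \<otimes>\<^bsub>Omega\<^esub> inv\<^bsub>Omega\<^esub> h \<in> Omega_derived"
    using M_derived_subset_Omega_derived[of a] by (auto simp: M.ab_proj_eq_iff)
  then show "pO g = pO h"
    using gh by (simp add: Omega.ab_proj_eq_iff M_set_in_Omega)
qed simp

lemma card_kernel: "card (kernel (M_ab a) Omega_ab (M_ab_map a)) = 2"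
proof -
  have "kernel (M_ab a) Omega_ab (M_ab_map a) = {\<one>\<^bsub>ab (M_top a) (M_group a)\<^esub>, pM zeta}"
  proof (intro equalityI subsetI)
    fix C assume "C \<in> kernel (M_ab a) Omega_ab (M_ab_map a)"
    then obtain m where m: "m \<in> M_set a" "C = pM m" "M_ab_map a (pM m) = \<one>\<^bsub>ab Omega_top Omega\<^esub>"
      by (auto simp: kernel_def M_ab_def Omega_ab_def M.carrier_ab)
    then have "m \<in> Omega_derived"
      by (simp add: M_ab_map_proj Omega.ab_proj_eq_one_iff M_set_in_Omega)
    then show "C \<in> {\<one>\<^bsub>ab (M_top a) (M_group a)\<^esub>, pM zeta}"
      using m pM_derived[of m] by (cases "m \<in> M_derived a") (auto simp: M.ab_proj_eq_one_iff)
  next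
    have "pM m \<in> kernel (M_ab a) Omega_ab (M_ab_map a)" if "m \<in> M_set a" "m \<in> Omega_derived" for m
      using that M.ab_proj_in_ab[of m a]
      by (simp add: kernel_def M_ab_def Omega_ab_def M_ab_map_proj Omega.ab_proj_eq_one_iff M_set_in_Omega)
    from this[of zeta] this[of "\<one>\<^bsub>Omega\<^esub>"]
    have *: "pM zeta \<in> kernel (M_ab a) Omega_ab (M_ab_map a)"
      "pM \<one>\<^bsub>Omega\<^esub> \<in> kernel (M_ab a) Omega_ab (M_ab_map a)"
      using zeta_in_Omega_derived subgroup.one_closed[OF Omega.subgroup_closed_derived]
        subgroup.one_closed[OF subgroup_M_set, of a] by simp_all
    have "pM \<one>\<^bsub>Omega\<^esub> = \<one>\<^bsub>ab (M_top a) (M_group a)\<^esub>"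
      using M.ab_proj_eq_one_iff[of "\<one>\<^bsub>Omega\<^esub>" a] subgroup.one_closed[OF subgroup_M_derived, of a]
        subgroup.one_closed[OF subgroup_M_set, of a] by simp
    with * show "C \<in> kernel (M_ab a) Omega_ab (M_ab_map a)"
      if "C \<in> {\<one>\<^bsub>ab (M_top a) (M_group a)\<^esub>, pM zeta}" for C
      using that by auto
  qed
  moreover have "pM zeta \<noteq> \<one>\<^bsub>ab (M_top a) (M_group a)\<^esub>"
    using zeta_notin_derived by (simp add: M.ab_proj_eq_one_iff)
  ultimately show ?thesis by simp
qed

subsection \<open>Restricted characters\<close>

lemma dual_hom:
  assumes "\<psi> \<in> carrier (M_dual a)" "f \<in> M_set a" "g \<in> M_set a"
  shows "\<psi> (pM (f \<otimes>\<^bsub>Omega\<^esub> g)) = \<psi> (pM f) \<otimes>\<^bsub>Q2Z2\<^esub> \<psi> (pM g)"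
proof -
  have "(\<lambda>g. \<psi> (pM g)) \<in> hom (M_group a) Q2Z2"
    using assms(1) by (simp add: M_dual_eq M.ab_dual_iff)
  from hom_mult[OF this, of f g] show ?thesis using assms by simp
qed

lemma dual_closed:
  assumes "\<psi> \<in> carrier (M_dual a)" "f \<in> M_set a"
  shows "\<psi> (pM f) \<in> carrier Q2Z2"
proof -
  have "(\<lambda>g. \<psi> (pM g)) \<in> hom (M_group a) Q2Z2"
    using assms(1) by (simp add: M_dual_eq M.ab_dual_iff)
  from hom_in_carrier[OF this, of f] show ?thesis using assms by simp
qed

lemma dual_derived:
  assumes "\<psi> \<in> carrier (M_dual a)" "d \<in> M_derived a"
  shows "\<psi> (pM d) = \<one>\<^bsub>Q2Z2\<^esub>"
  using M.ab_dual_trivial assms by (simp add: M_dual_eq)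

lemma dual_at_Omega_derived:
  assumes "\<psi> \<in> carrier (M_dual a)" "m \<in> Omega_derived"
  shows "\<psi> (pM m) = (if m \<in> M_derived a then \<one>\<^bsub>Q2Z2\<^esub> else \<psi> (pM zeta))"
  using dual_derived[OF assms(1)] pM_derived[OF assms(2)] by simp

lemma dual_zeta:
  assumes "\<psi> \<in> carrier (M_dual a)"
  shows "\<psi> (pM zeta) = \<one>\<^bsub>Q2Z2\<^esub> \<or> \<psi> (pM zeta) = Q2Z2_of (1 / 2)"
proof -
  have "\<psi> (pM zeta) \<otimes>\<^bsub>Q2Z2\<^esub> \<psi> (pM zeta) = \<one>\<^bsub>Q2Z2\<^esub>"
    using dual_hom[OF assms zeta_in_M zeta_in_M] dual_derived[OF assms zeta_square] by simp
  then show ?thesis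
    using Q2Z2_involution[OF dual_closed[OF assms zeta_in_M]] by blast
qed

text \<open>The condition on \<open>m m\<close> does not mention \<open>\<psi>\<close>, so the
  double of a character depends only on its value at \<open>zeta\<close>. Conversely, a single
  character that is nontrivial at \<open>zeta\<close> detects which squares lie in
  \<open>M_derived a\<close>.\<close>

lemma dual_square:
  assumes "\<psi> \<in> carrier (M_dual a)" "m \<in> M_set a"
  shows "\<psi> (pM m) \<otimes>\<^bsub>Q2Z2\<^esub> \<psi> (pM m) =
    (if m \<otimes>\<^bsub>Omega\<^esub> m \<in> M_derived a then \<one>\<^bsub>Q2Z2\<^esub> else \<psi> (pM zeta))"
  using dual_hom[OF assms assms(2)] dual_at_Omega_derived[OF assms(1) M_square[OF assms(2)]] by simp

lemma not_in_M: "f \<in> carrier Omega \<Longrightarrow> f \<notin> M_set a \<longleftrightarrow> f \<otimes>\<^bsub>Omega\<^esub> tau \<in> M_set a"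
  by (simp add: M_set_eq phi_sum_mult) (metis bit_add_self(1) bit_not_zero_iff add_0)

text \<open>The extension is determined by giving \<open>tau\<close> the trivial value. It is
  multiplicative because \<open>c\<close> is invariant under conjugation by \<open>tau\<close>: the
  commutators that arise lie in \<open>Omega_derived\<close>, where \<open>c\<close> is
  trivial.\<close>

lemma character_extends:
  assumes c: "c \<in> hom (M_group a) Q2Z2" and cont: "continuous_map (M_top a) (discrete_topology UNIV) c"
    and triv: "\<And>m. m \<in> Omega_derived \<Longrightarrow> c m = \<one>\<^bsub>Q2Z2\<^esub>"
  shows "\<exists>e\<in>hom Omega Q2Z2. continuous_map Omega_top (discrete_topology UNIV) e \<and>
    (\<forall>m\<in>M_set a. e m = c m)"
proof -
  define e where "e f = (if f \<in> M_set a then c f else c (f \<otimes>\<^bsub>Omega\<^esub> tau))" for f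
  have c_mult: "c (f \<otimes>\<^bsub>Omega\<^esub> g) = c f \<otimes>\<^bsub>Q2Z2\<^esub> c g" if "f \<in> M_set a" "g \<in> M_set a" for f g
    using hom_mult[OF c, of f g] that by simp
  have c_closed: "c f \<in> carrier Q2Z2" if "f \<in> M_set a" for f
    using hom_in_carrier[OF c, of f] that by simp
  have tt: "tau \<otimes>\<^bsub>Omega\<^esub> (tau \<otimes>\<^bsub>Omega\<^esub> f) = f" if "f \<in> carrier Omega" for f
    using that by (simp flip: Omega.m_assoc)
  have conj_M: "tau \<otimes>\<^bsub>Omega\<^esub> m \<otimes>\<^bsub>Omega\<^esub> tau \<in> M_set a" if "m \<in> M_set a" for m
    using M_conj[OF tau_in_Omega that] by simp
  have c_conj: "c (tau \<otimes>\<^bsub>Omega\<^esub> m \<otimes>\<^bsub>Omega\<^esub> tau) = c m" if m: "m \<in> M_set a" for m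
  proof -
    have m': "m \<in> carrier Omega" using m by (rule M_set_in_Omega)
    define d where "d = tau \<otimes>\<^bsub>Omega\<^esub> m \<otimes>\<^bsub>Omega\<^esub> inv\<^bsub>Omega\<^esub> tau \<otimes>\<^bsub>Omega\<^esub> inv\<^bsub>Omega\<^esub> m"
    have d: "d \<in> Omega_derived"
      unfolding d_def using m' by (intro Omega.commutator_in_closed_derived) simp_all
    have "tau \<otimes>\<^bsub>Omega\<^esub> m \<otimes>\<^bsub>Omega\<^esub> tau = d \<otimes>\<^bsub>Omega\<^esub> m"
      using m' by (simp add: d_def Omega.m_assoc)
    moreover have "c (d \<otimes>\<^bsub>Omega\<^esub> m) = c d \<otimes>\<^bsub>Q2Z2\<^esub> c m"
      using d m Omega_derived_subset_M by (intro c_mult) auto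
    ultimately show ?thesis using triv[OF d] c_closed[OF m] by simp
  qed
  have "e \<in> hom Omega Q2Z2"
  proof (rule homI)
    show "e f \<in> carrier Q2Z2" if "f \<in> carrier Omega" for f
      using that not_in_M[OF that] by (auto simp: e_def intro: c_closed)
    fix f g assume f: "f \<in> carrier Omega" and g: "g \<in> carrier Omega"
    have fg: "f \<otimes>\<^bsub>Omega\<^esub> g \<in> M_set a \<longleftrightarrow> (f \<in> M_set a \<longleftrightarrow> g \<in> M_set a)"
      using f g by (cases "phi_sum a f"; cases "phi_sum a g") (simp_all add: M_set_eq phi_sum_mult)
    show "e (f \<otimes>\<^bsub>Omega\<^esub> g) = e f \<otimes>\<^bsub>Q2Z2\<^esub> e g"
    proof (cases "f \<in> M_set a"; cases "g \<in> M_set a")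
      assume *: "f \<in> M_set a" "g \<in> M_set a"
      then show ?thesis using fg by (simp add: e_def c_mult)
    next
      assume *: "f \<in> M_set a" "g \<notin> M_set a"
      then have "e (f \<otimes>\<^bsub>Omega\<^esub> g) = c (f \<otimes>\<^bsub>Omega\<^esub> (g \<otimes>\<^bsub>Omega\<^esub> tau))"
        using fg f g by (simp add: e_def Omega.m_assoc)
      also have "\<dots> = c f \<otimes>\<^bsub>Q2Z2\<^esub> c (g \<otimes>\<^bsub>Omega\<^esub> tau)"
        using * not_in_M[OF g] by (intro c_mult) auto
      finally show ?thesis using * by (simp add: e_def)
    next
      assume *: "f \<notin> M_set a" "g \<in> M_set a"
      \<comment> \<open>The product lies outside \<open>M\<close>, so its value is that of
        \<open>f g tau\<close>; inserting \<open>tau tau\<close> after \<open>f\<close> leaves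
        \<open>g\<close> conjugated by \<open>tau\<close>.\<close>
      then have "e (f \<otimes>\<^bsub>Omega\<^esub> g) = c ((f \<otimes>\<^bsub>Omega\<^esub> tau) \<otimes>\<^bsub>Omega\<^esub> (tau \<otimes>\<^bsub>Omega\<^esub> g \<otimes>\<^bsub>Omega\<^esub> tau))"
        using fg f g by (simp add: e_def Omega.m_assoc tt)
      also have "\<dots> = c (f \<otimes>\<^bsub>Omega\<^esub> tau) \<otimes>\<^bsub>Q2Z2\<^esub> c (tau \<otimes>\<^bsub>Omega\<^esub> g \<otimes>\<^bsub>Omega\<^esub> tau)"
        using * not_in_M[OF f] conj_M by (intro c_mult) auto
      finally show ?thesis using * by (simp add: e_def c_conj)
    next
      assume *: "f \<notin> M_set a" "g \<notin> M_set a"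
      then have gt: "g \<otimes>\<^bsub>Omega\<^esub> tau \<in> M_set a" using not_in_M[OF g] by simp
      have "e (f \<otimes>\<^bsub>Omega\<^esub> g) =
        c ((f \<otimes>\<^bsub>Omega\<^esub> tau) \<otimes>\<^bsub>Omega\<^esub> (tau \<otimes>\<^bsub>Omega\<^esub> (g \<otimes>\<^bsub>Omega\<^esub> tau) \<otimes>\<^bsub>Omega\<^esub> tau))"
        using * fg f g by (simp add: e_def Omega.m_assoc tt)
      also have "\<dots> = c (f \<otimes>\<^bsub>Omega\<^esub> tau) \<otimes>\<^bsub>Q2Z2\<^esub> c (tau \<otimes>\<^bsub>Omega\<^esub> (g \<otimes>\<^bsub>Omega\<^esub> tau) \<otimes>\<^bsub>Omega\<^esub> tau)"
        using * not_in_M[OF f] conj_M[OF gt] by (intro c_mult) auto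
      finally show ?thesis using * gt by (simp add: e_def c_conj)
    qed
  qed
  moreover have "openin Omega_top {f \<in> carrier Omega. e f \<in> U}" for U
  proof -
    have "openin (M_top a) {f \<in> M_set a. c f \<in> U}"
      using cont by (simp add: continuous_map_def)
    then have o: "openin Omega_top {f \<in> M_set a. c f \<in> U}"
      unfolding M_top_def using openin_M_set by (rule openin_trans_full)
    have "openin Omega_top {f \<in> topspace Omega_top. f \<circ> tau \<in> {f \<in> M_set a. c f \<in> U}}"
      using continuous_map_Omega_mult_right[OF tau_in_Omega] o by (rule openin_continuous_map_preimage)
    with o have "openin Omega_top ({f \<in> M_set a. c f \<in> U} \<union>
      {f \<in> topspace Omega_top. f \<circ> tau \<in> {f \<in> M_set a. c f \<in> U}})"
      by (rule openin_Un)
    also have "\<dots> = {f \<in> carrier Omega. e f \<in> U}"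
      using not_in_M by (auto simp: e_def M_set_in_Omega simp flip: Omega_mult)
    finally show ?thesis .
  qed
  then have "continuous_map Omega_top (discrete_topology UNIV) e"
    by (simp add: continuous_map_def)
  moreover have "\<forall>m\<in>M_set a. e m = c m" by (simp add: e_def)
  ultimately show ?thesis by blast
qed

text \<open>\<open>zeta\<close> and \<open>M_derived a\<close> together account for all of
  \<open>Omega_derived\<close>, so triviality at this one element is the only obstruction to
  extending a character to \<open>Omega\<close>.\<close>

lemma restricted_iff:
  "\<psi> \<in> restricted_characters a \<longleftrightarrow> \<psi> \<in> carrier (M_dual a) \<and> \<psi> (pM zeta) = \<one>\<^bsub>Q2Z2\<^esub>"
proof
  assume "\<psi> \<in> restricted_characters a"
  then obtain \<eta> where \<eta>: "\<eta> \<in> carrier Omega_dual"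
    and \<psi>: "\<psi> = (\<lambda>C\<in>carrier (M_ab a). \<eta> (M_ab_map a C))"
    by (auto simp: restricted_characters_def)
  have eq: "\<psi> (pM m) = \<eta> (pO m)" if "m \<in> M_set a" for m
    using that M.ab_proj_in_ab[of m a] by (simp add: \<psi> M_ab_def M_ab_map_proj)
  have hom: "(\<lambda>g. \<eta> (pO g)) \<in> hom Omega Q2Z2"
    and cont: "continuous_map Omega_top (discrete_topology UNIV) (\<lambda>g. \<eta> (pO g))"
    using \<eta> by (simp_all add: Omega_dual_eq Omega.ab_dual_iff)
  have "(\<lambda>m. \<psi> (pM m)) \<in> hom (M_group a) Q2Z2"
  proof (rule homI)
    show "\<psi> (pM m) \<in> carrier Q2Z2" if "m \<in> carrier (M_group a)" for m
      using that hom_in_carrier[OF hom, of m] by (simp add: eq M_set_in_Omega)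
    show "\<psi> (pM (f \<otimes>\<^bsub>M_group a\<^esub> g)) = \<psi> (pM f) \<otimes>\<^bsub>Q2Z2\<^esub> \<psi> (pM g)"
      if "f \<in> carrier (M_group a)" "g \<in> carrier (M_group a)" for f g
      using that hom_mult[OF hom, of f g] subgroup.m_closed[OF subgroup_M_set]
      by (simp add: eq M_set_in_Omega)
  qed
  moreover have "continuous_map (M_top a) (discrete_topology UNIV) (\<lambda>m. \<psi> (pM m))"
    using continuous_map_M_top[OF cont, of a] by (rule continuous_map_eq) (simp add: eq)
  ultimately have "\<psi> \<in> carrier (M_dual a)"
    by (simp add: M_dual_eq M.ab_dual_iff \<psi> M_ab_def)
  moreover have "\<eta> (pO zeta) = \<one>\<^bsub>Q2Z2\<^esub>"
    using Omega.ab_dual_trivial[OF _ zeta_in_Omega_derived] \<eta> by (simp add: Omega_dual_eq)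
  ultimately show "\<psi> \<in> carrier (M_dual a) \<and> \<psi> (pM zeta) = \<one>\<^bsub>Q2Z2\<^esub>"
    by (simp add: eq)
next
  assume "\<psi> \<in> carrier (M_dual a) \<and> \<psi> (pM zeta) = \<one>\<^bsub>Q2Z2\<^esub>"
  then have \<psi>: "\<psi> \<in> carrier (M_dual a)" and z: "\<psi> (pM zeta) = \<one>\<^bsub>Q2Z2\<^esub>" by auto
  have "(\<lambda>m. \<psi> (pM m)) \<in> hom (M_group a) Q2Z2"
    "continuous_map (M_top a) (discrete_topology UNIV) (\<lambda>m. \<psi> (pM m))"
    using \<psi> by (simp_all add: M_dual_eq M.ab_dual_iff)
  moreover have "\<psi> (pM m) = \<one>\<^bsub>Q2Z2\<^esub>" if "m \<in> Omega_derived" for m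
    using dual_at_Omega_derived[OF \<psi> that] z by simp
  ultimately have "\<exists>e\<in>hom Omega Q2Z2. continuous_map Omega_top (discrete_topology UNIV) e \<and>
    (\<forall>m\<in>M_set a. e m = \<psi> (pM m))"
    by (rule character_extends)
  then obtain e where e: "e \<in> hom Omega Q2Z2"
    "continuous_map Omega_top (discrete_topology UNIV) e"
    "\<forall>m\<in>M_set a. e m = \<psi> (pM m)"
    by blast
  define \<eta> where "\<eta> = ab_factor Omega_top Omega e"
  have \<eta>: "\<eta> \<in> carrier Omega_dual"
    unfolding \<eta>_def Omega_dual_eq using e(1,2) by (rule Omega.ab_factor_in_dual)
  have "\<psi> = (\<lambda>C\<in>carrier (M_ab a). \<eta> (M_ab_map a C))"
  proof (rule extensionalityI)
    show "\<psi> \<in> extensional (carrier (M_ab a))"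
      using \<psi> by (simp add: M_dual_eq M.ab_dual_iff M_ab_def)
    show "\<psi> C = (\<lambda>C\<in>carrier (M_ab a). \<eta> (M_ab_map a C)) C" if C: "C \<in> carrier (M_ab a)" for C
    proof -
      obtain m where m: "m \<in> M_set a" "C = pM m"
        using C by (auto simp: M_ab_def M.carrier_ab)
      have "\<eta> (pO m) = e m"
        unfolding \<eta>_def using e(1) comm_group_Q2Z2 e(2) M_set_in_Omega[OF m(1)]
        by (rule Omega.ab_factor_character)
      then show ?thesis using C m by (simp add: M_ab_map_proj e(3))
    qed
  qed simp
  with \<eta> show "\<psi> \<in> restricted_characters a"
    unfolding restricted_characters_def by blast
qed

lemma comm_group_M_dual: "comm_group (M_dual a)"
  unfolding M_dual_eq by (rule M.comm_group_ab_dual)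

lemma dual_mult_apply:
  "m \<in> M_set a \<Longrightarrow> (\<psi> \<otimes>\<^bsub>M_dual a\<^esub> \<eta>) (pM m) = \<psi> (pM m) \<otimes>\<^bsub>Q2Z2\<^esub> \<eta> (pM m)"
  unfolding M_dual_eq using M.ab_dual_mult[of m a] by simp

lemma dual_one_apply: "m \<in> M_set a \<Longrightarrow> \<one>\<^bsub>M_dual a\<^esub> (pM m) = \<one>\<^bsub>Q2Z2\<^esub>"
  unfolding M_dual_eq using M.ab_dual_one[of m a] by simp

lemma dual_eqI:
  assumes "\<psi> \<in> carrier (M_dual a)" "\<eta> \<in> carrier (M_dual a)"
    and "\<And>m. m \<in> M_set a \<Longrightarrow> \<psi> (pM m) = \<eta> (pM m)"
  shows "\<psi> = \<eta>"
  using assms M.ab_dual_eqI[of \<psi> a \<eta>] by (simp add: M_dual_eq)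

lemma evaluation_hom: "group_hom (M_dual a) Q2Z2 (\<lambda>\<psi>. \<psi> (pM zeta))"
proof -
  interpret D: comm_group "M_dual a" by (rule comm_group_M_dual)
  show ?thesis
    by unfold_locales (auto intro!: homI simp: dual_closed dual_mult_apply)
qed

text \<open>The dual modulo restricted characters thus embeds into \<open>Q2Z2\<close> by evaluation
  at \<open>zeta\<close>, and cosets can be compared by a single value.\<close>

lemma restricted_eq_kernel:
  "restricted_characters a = kernel (M_dual a) Q2Z2 (\<lambda>\<psi>. \<psi> (pM zeta))"
  unfolding kernel_def using restricted_iff by blast

lemma restricted_coset_eqI:
  assumes "\<psi> \<in> carrier (M_dual a)" "\<eta> \<in> carrier (M_dual a)" "\<psi> (pM zeta) = \<eta> (pM zeta)"
  shows "restricted_characters a #>\<^bsub>M_dual a\<^esub> \<psi> = restricted_characters a #>\<^bsub>M_dual a\<^esub> \<eta>"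
  unfolding restricted_eq_kernel
  using group_hom.kernel_coset_eqI[OF evaluation_hom assms(1,2)] assms(3) by simp

lemma Lam_not_restricted: "Lam \<notin> restricted_characters a"
  using Lam_zeta half_not_one by (simp add: restricted_iff)

lemma not_restricted_coset:
  assumes "\<psi> \<in> carrier (M_dual a)" "\<psi> \<notin> restricted_characters a"
  shows "restricted_characters a #>\<^bsub>M_dual a\<^esub> \<psi> = restricted_characters a #>\<^bsub>M_dual a\<^esub> Lam"
  using assms dual_zeta[OF assms(1)] Lam_zeta
  by (intro restricted_coset_eqI Lam_in_dual) (auto simp: restricted_iff)

end

subsection \<open>Direct summands\<close>

lemma cring_F2: "cring F2"
proof (rule cringI)
  show "abelian_group F2"
  proof (rule abelian_groupI)
    fix x :: bit
    show "\<exists>y\<in>carrier F2. y \<oplus>\<^bsub>F2\<^esub> x = \<zero>\<^bsub>F2\<^esub>"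
      by (rule bexI[of _ x]) (simp_all add: F2_def)
  qed (simp_all add: F2_def add_ac)
  show "comm_monoid F2"
    by (rule comm_monoidI) (simp_all add: F2_def mult_ac)
qed (simp add: F2_def distrib_right)

lemma F2_vector_space_if_exponent_two:
  fixes G :: "'g monoid" (structure)
  assumes "comm_group G" and sq: "\<And>x. x \<in> carrier G \<Longrightarrow> x \<otimes> x = \<one>"
  shows "F2_vector_space G"
proof -
  interpret comm_group G by fact
  define s :: "bit \<Rightarrow> 'g \<Rightarrow> 'g" where "s u x = (if u = 1 then x else \<one>)" for u x
  let ?M = "\<lparr>carrier = carrier G, monoid.mult = mult G, monoid.one = \<one>,
    ring.zero = \<one>, ring.add = mult G, module.smult = s\<rparr>"
  have "Module.module F2 ?M"
  proof (rule moduleI)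
    show "abelian_group ?M"
    proof (rule abelian_groupI)
      fix x assume "x \<in> carrier ?M"
      then show "\<exists>y\<in>carrier ?M. y \<oplus>\<^bsub>?M\<^esub> x = \<zero>\<^bsub>?M\<^esub>"
        using sq by (intro bexI[of _ x]) simp_all
    qed (simp_all add: m_ac)
    show "(u \<oplus>\<^bsub>F2\<^esub> v) \<odot>\<^bsub>?M\<^esub> x = (u \<odot>\<^bsub>?M\<^esub> x) \<oplus>\<^bsub>?M\<^esub> (v \<odot>\<^bsub>?M\<^esub> x)"
      if "x \<in> carrier ?M" for u v x
      using that sq by (cases u; cases v) (simp_all add: F2_def s_def)
    show "(u \<otimes>\<^bsub>F2\<^esub> v) \<odot>\<^bsub>?M\<^esub> x = u \<odot>\<^bsub>?M\<^esub> (v \<odot>\<^bsub>?M\<^esub> x)" for u v x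
      by (cases u; cases v) (simp_all add: F2_def s_def)
  qed (simp_all add: cring_F2 s_def, simp add: F2_def)
  then show ?thesis unfolding F2_vector_space_def by blast
qed

text \<open>Matching orders make \<open>h\<close> injective on the powers of \<open>g\<close>, and
  \<open>surj\<close> allows any element to be corrected by a power of \<open>g\<close> into the
  kernel.\<close>

lemma (in group_hom) cyclic_complement:
  assumes g: "g \<in> carrier G" and ord: "G.ord g \<noteq> 0" "H.ord (h g) = G.ord g"
    and surj: "\<And>x. x \<in> carrier G \<Longrightarrow> \<exists>k::nat. h x = h g [^]\<^bsub>H\<^esub> k"
  shows "generate G {g} \<inter> kernel G H h = {\<one>}"
    and "generate G {g} <#> kernel G H h = carrier G"
proof -
  have gen: "generate G {g} = {g [^] k | k. k \<in> (UNIV :: nat set)}"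
    using g ord(1) by (rule G.generate_pow_nat)
  have "x = \<one>" if x: "x \<in> generate G {g}" "x \<in> kernel G H h" for x
  proof -
    obtain k :: nat where k: "x = g [^] k" using x gen by blast
    then have "h g [^]\<^bsub>H\<^esub> k = \<one>\<^bsub>H\<^esub>" using x g by (simp add: kernel_def hom_nat_pow)
    then have "G.ord g dvd k" using g ord(2) H.pow_eq_id[of "h g" k] by simp
    then show ?thesis using g k G.pow_eq_id[of g k] by simp
  qed
  moreover have "\<one> \<in> generate G {g}" by (rule generate.one)
  moreover have "\<one> \<in> kernel G H h" by (simp add: kernel_def)
  ultimately show "generate G {g} \<inter> kernel G H h = {\<one>}"
    by blast
  show "generate G {g} <#> kernel G H h = carrier G"
  proof (intro equalityI subsetI)
    fix x assume "x \<in> generate G {g} <#> kernel G H h"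
    then show "x \<in> carrier G"
      using G.generate_in_carrier[of "{g}"] g by (auto simp: set_mult_def kernel_def)
  next
    fix x assume x: "x \<in> carrier G"
    then obtain k :: nat where k: "h x = h g [^]\<^bsub>H\<^esub> k" using surj by blast
    have "inv (g [^] k) \<otimes> x \<in> kernel G H h"
      using g x by (simp add: kernel_def k hom_nat_pow)
    moreover have "g [^] k \<in> generate G {g}" using gen by blast
    moreover have "x = g [^] k \<otimes> (inv (g [^] k) \<otimes> x)"
      using g x by (simp flip: G.m_assoc)
    ultimately show "x \<in> generate G {g} <#> kernel G H h"
      unfolding set_mult_def by blast
  qed
qed

context topologized_group
begin

lemma closedin_ab_top:
  assumes "S \<subseteq> carrier (ab T G)" "closedin T {g \<in> carrier G. ab_proj T G g \<in> S}"
  shows "closedin (ab_top T G) S"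
proof -
  have "topspace T - {g \<in> carrier G. ab_proj T G g \<in> S} =
    {g \<in> topspace T. ab_proj T G g \<in> carrier (ab T G) - S}"
    by (auto simp: topspace_eq)
  moreover have "openin T (topspace T - {g \<in> carrier G. ab_proj T G g \<in> S})"
    using assms(2) by (simp add: closedin_def)
  ultimately show ?thesis
    using assms(1) by (simp add: closedin_def topspace_ab_top openin_ab_top)
qed

text \<open>The preimage of a point is a coset of the closed subgroup
  \<open>closed_derived T G\<close>, hence closed by continuity of translations.\<close>

lemma finite_closedin_ab_top:
  assumes S: "finite S" "S \<subseteq> carrier (ab T G)"
    and cont: "\<And>x. x \<in> carrier G \<Longrightarrow> continuous_map T T (\<lambda>g. g \<otimes> x)"
  shows "closedin (ab_top T G) S"
proof -
  have "closedin (ab_top T G) {C}" if C: "C \<in> carrier (ab T G)" for C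
  proof (rule closedin_ab_top)
    obtain x where x: "x \<in> carrier G" "C = ab_proj T G x"
      using C by (auto simp: carrier_ab)
    have "closedin T {g \<in> topspace T. g \<otimes> inv x \<in> closed_derived T G}"
      using cont[OF inv_closed[OF x(1)]] closedin_closed_derived
      by (rule closedin_continuous_map_preimage)
    also have "{g \<in> topspace T. g \<otimes> inv x \<in> closed_derived T G} = {g \<in> carrier G. ab_proj T G g \<in> {C}}"
      using x by (intro Collect_cong conj_cong) (simp_all add: topspace_eq ab_proj_eq_iff)
    finally show "closedin T {g \<in> carrier G. ab_proj T G g \<in> {C}}" .
  qed (use C in blast)
  then have "closedin (ab_top T G) (\<Union>C\<in>S. {C})"
    using S by (intro closedin_Union) auto
  then show ?thesis by simp
qed

end

lemma continuous_map_M_mult_right: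
  assumes "x \<in> M_set a"
  shows "continuous_map (M_top a) (M_top a) (\<lambda>g. g \<otimes>\<^bsub>M_group a\<^esub> x)"
proof -
  have "continuous_map (M_top a) Omega_top (\<lambda>g. g \<otimes>\<^bsub>M_group a\<^esub> x)"
    using continuous_map_M_top[OF continuous_map_Omega_mult_right[OF M_set_in_Omega[OF assms]], of a]
    by (simp add: Omega_mult)
  moreover have "g \<otimes>\<^bsub>Omega\<^esub> x \<in> M_set a" if "g \<in> M_set a" for g
    using that assms subgroup.m_closed[OF subgroup_M_set] by blast
  ultimately show ?thesis
    unfolding M_top_def[of a] by (subst continuous_map_in_subtopology) (auto simp: M_set_eq)
qed

text \<open>Every pair with second coordinate 1 generates the cyclic group of order 4. The first
  coordinate stays arbitrary because the value \<open>lam a mu\<close> is left undetermined.\<close>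

lemma star_powers:
  fixes u :: bit and p :: "bit \<times> bit"
  shows "p \<in> {(0, 0), (u, 1), (u, 1) \<otimes>\<^bsub>star_group\<^esub> (u, 1),
    (u, 1) \<otimes>\<^bsub>star_group\<^esub> (u, 1) \<otimes>\<^bsub>star_group\<^esub> (u, 1)}"
proof -
  obtain v w where "p = (v, w)" by (meson surj_pair)
  then show ?thesis by (cases u; cases v; cases w) (simp_all add: star_mult)
qed

context nontrivial_sequence
begin

text \<open>For \<open>a 0 = 0\<close> the doubles of all values of \<open>Lam\<close> are trivial,
  while \<open>Lam\<close> is not trivial at \<open>zeta\<close>; by \<open>dual_square\<close>
  every square then lies in \<open>M_derived a\<close>.\<close>

lemma F2_vector_space_M_ab:
  assumes "a 0 = 0"
  shows "F2_vector_space (M_ab a)"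
proof -
  show ?thesis
  proof (rule F2_vector_space_if_exponent_two)
    show "comm_group (M_ab a)" unfolding M_ab_def by (rule M.comm_group_ab)
    fix x assume "x \<in> carrier (M_ab a)"
    then obtain m where m: "m \<in> M_set a" "x = pM m"
      by (auto simp: M_ab_def M.carrier_ab)
    have "Lam (pM m) = F2_embed (character_x a m)"
      using F2_character_apply[OF character_x_hom continuous_character_x m(1)] assms
      by (simp add: Lam_def)
    moreover have "F2_embed u \<otimes>\<^bsub>Q2Z2\<^esub> F2_embed u = \<one>\<^bsub>Q2Z2\<^esub>" for u
      by (cases u) (simp_all add: F2_embed_0 F2_embed_1 half_half)
    ultimately have "m \<otimes>\<^bsub>Omega\<^esub> m \<in> M_derived a"
      using dual_square[OF Lam_in_dual m(1)] Lam_zeta half_not_one by (auto split: if_splits)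
    then show "x \<otimes>\<^bsub>M_ab a\<^esub> x = \<one>\<^bsub>M_ab a\<^esub>"
      using m M.ab_proj_mult[of m a m] M.ab_proj_eq_one_iff[of "m \<otimes>\<^bsub>Omega\<^esub> m" a]
        subgroup.m_closed[OF subgroup_M_set, of m a m]
      by (simp add: M_ab_def)
  qed
qed

lemma generate_dual_quotient:
  "generate (M_dual a Mod restricted_characters a) {restricted_characters a #>\<^bsub>M_dual a\<^esub> Lam} =
    carrier (M_dual a Mod restricted_characters a)"
proof -
  interpret D: comm_group "M_dual a" by (rule comm_group_M_dual)
  interpret ev: group_hom "M_dual a" Q2Z2 "\<lambda>\<psi>. \<psi> (pM zeta)" by (rule evaluation_hom)
  have sub: "subgroup (restricted_characters a) (M_dual a)"
    unfolding restricted_eq_kernel by (rule ev.subgroup_kernel)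
  interpret Q: comm_group "M_dual a Mod restricted_characters a"
    using sub by (rule D.abelian_FactGroup)
  let ?g = "restricted_characters a #>\<^bsub>M_dual a\<^esub> Lam"
  have g: "?g \<in> carrier (M_dual a Mod restricted_characters a)"
    using Lam_in_dual by (auto simp: carrier_FactGroup)
  show ?thesis
  proof (intro equalityI subsetI)
    show "x \<in> carrier (M_dual a Mod restricted_characters a)"
      if "x \<in> generate (M_dual a Mod restricted_characters a) {?g}" for x
      using Q.generate_in_carrier[OF _ that] g by blast
  next
    fix x assume "x \<in> carrier (M_dual a Mod restricted_characters a)"
    then obtain \<psi> where \<psi>: "\<psi> \<in> carrier (M_dual a)" "x = restricted_characters a #>\<^bsub>M_dual a\<^esub> \<psi>"
      by (auto simp: carrier_FactGroup)
    show "x \<in> generate (M_dual a Mod restricted_characters a) {?g}"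
    proof (cases "\<psi> \<in> restricted_characters a")
      case True
      then have "x = \<one>\<^bsub>M_dual a Mod restricted_characters a\<^esub>"
        using D.coset_join2[OF \<psi>(1) sub True] \<psi>(2) by simp
      then show ?thesis using generate.one by metis
    next
      case False
      then have "x = ?g" using not_restricted_coset[OF \<psi>(1)] \<psi>(2) by simp
      then show ?thesis by (simp add: generate.incl)
    qed
  qed
qed

lemma star_map_mu: "star_map a mu = (lam a mu, 1)"
  by (simp add: star_map_eq_lam)

lemma star_map_surj:
  assumes "a 0 = 1"
  shows "star_map a ` carrier (M_group a) = carrier star_group"
proof -
  have mult: "star_map a (f \<otimes>\<^bsub>Omega\<^esub> g) = star_map a f \<otimes>\<^bsub>star_group\<^esub> star_map a g"
    if "f \<in> M_set a" "g \<in> M_set a" for f g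
    using hom_mult[OF star_map_hom[OF assms], of f g] that by simp
  have M2: "mu \<otimes>\<^bsub>Omega\<^esub> mu \<in> M_set a"
    using subgroup.m_closed[OF subgroup_M_set mu_in_M mu_in_M] .
  then have M3: "mu \<otimes>\<^bsub>Omega\<^esub> mu \<otimes>\<^bsub>Omega\<^esub> mu \<in> M_set a"
    using subgroup.m_closed[OF subgroup_M_set _ mu_in_M] by blast
  have M4: "mu \<otimes>\<^bsub>Omega\<^esub> mu \<otimes>\<^bsub>Omega\<^esub> mu \<otimes>\<^bsub>Omega\<^esub> mu \<in> M_set a"
    using subgroup.m_closed[OF subgroup_M_set M3 mu_in_M] .
  have "p \<in> star_map a ` M_set a" for p
  proof -
    have "star_map a (mu \<otimes>\<^bsub>Omega\<^esub> mu \<otimes>\<^bsub>Omega\<^esub> mu \<otimes>\<^bsub>Omega\<^esub> mu) = (0, 0)"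
      using M2 M3 by (cases "lam a mu") (simp_all add: mult star_map_mu star_mult)
    then show ?thesis
      using star_powers[of p "lam a mu"] M2 M3 M4 mu_in_M mult[OF M2 mu_in_M] mult[OF mu_in_M mu_in_M]
        star_map_mu by (metis (no_types, lifting) empty_iff image_eqI insert_iff)
  qed
  then show ?thesis by (auto simp: star_group_def)
qed

text \<open>At a preimage of \<open>(0, 1)\<close> the double of the character is 1/2, and by
  \<open>dual_square\<close> a nontrivial value of a double can only be the value at
  \<open>zeta\<close>. Surjectivity thus makes all such characters agree modulo
  restrictions.\<close>

lemma star_character_zeta:
  assumes f: "f \<in> hom (M_group a) star_group" "continuous_map (M_top a) (discrete_topology UNIV) f"
    and surj: "f ` carrier (M_group a) = carrier star_group"
  shows "star_character a f (pM zeta) = Q2Z2_of (1 / 2)"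
proof -
  let ?\<psi> = "star_character a f"
  have \<psi>: "?\<psi> \<in> carrier (M_dual a)" using f by (rule star_character_in_dual)
  have "(0, 1) \<in> f ` carrier (M_group a)" unfolding surj by (simp add: star_group_def)
  then obtain m where m: "m \<in> M_set a" "f m = (0, 1)" by force
  have "?\<psi> (pM m) \<otimes>\<^bsub>Q2Z2\<^esub> ?\<psi> (pM m) = Q2Z2_of (1 / 2)"
    using star_character_apply[OF f m(1)] m(2) by (simp add: star_embed_square F2_embed_1)
  then show ?thesis
    using dual_square[OF \<psi> m(1)] half_not_one by (auto split: if_splits)
qed

text \<open>The summand is generated by the class of \<open>mu\<close>, with the kernel of
  \<open>Lam\<close> as complement: \<open>Lam\<close> sends this class to an element of order 4,
  which generates the image of \<open>Lam\<close>.\<close>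

lemma has_cyclic_summand_M_ab:
  assumes a0: "a 0 = 1"
  shows "has_cyclic_summand (M_ab_top a) (M_ab a) 4"
proof -
  interpret A: comm_group "M_ab a" unfolding M_ab_def by (rule M.comm_group_ab)
  have Lam: "Lam = star_character a (star_map a)" using a0 by (simp add: Lam_def)
  have Lam_apply: "Lam (pM m) = star_embed (star_map a m)" if "m \<in> M_set a" for m
    unfolding Lam using star_map_hom[OF a0] continuous_star_map that by (rule star_character_apply)
  have "Lam \<in> hom (M_ab a) Q2Z2"
    using Lam_in_dual by (simp add: M_dual_def dual_carrier_iff)
  then interpret L: group_hom "M_ab a" Q2Z2 Lam by unfold_locales
  define g where "g = pM mu"
  have g: "g \<in> carrier (M_ab a)" using M.ab_proj_in_ab[of mu a] by (simp add: g_def M_ab_def)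
  have mult: "pM f \<otimes>\<^bsub>M_ab a\<^esub> pM h = pM (f \<otimes>\<^bsub>Omega\<^esub> h)" if "f \<in> M_set a" "h \<in> M_set a" for f h
    using M.ab_proj_mult[of f a h] that by (simp add: M_ab_def)
  have M2: "mu \<otimes>\<^bsub>Omega\<^esub> mu \<in> M_set a"
    using subgroup.m_closed[OF subgroup_M_set mu_in_M mu_in_M] .
  have one: "pM d = \<one>\<^bsub>M_ab a\<^esub>" if "d \<in> M_derived a" for d
    using that M_derived_subset[of a] M.ab_proj_eq_one_iff[of d a] by (auto simp: M_ab_def)
  \<comment> \<open>The square of \<open>mu\<close> is trivial or equal to \<open>zeta\<close>
    modulo \<open>M_derived a\<close>, and \<open>zeta\<close> has trivial square there; so the
    class of \<open>mu\<close> has order dividing 4.\<close>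
  have "pM (mu \<otimes>\<^bsub>Omega\<^esub> mu) \<otimes>\<^bsub>M_ab a\<^esub> pM (mu \<otimes>\<^bsub>Omega\<^esub> mu) = \<one>\<^bsub>M_ab a\<^esub>"
  proof (cases "mu \<otimes>\<^bsub>Omega\<^esub> mu \<in> M_derived a")
    case True
    then show ?thesis by (simp add: one)
  next
    case False
    then have "pM (mu \<otimes>\<^bsub>Omega\<^esub> mu) = pM zeta"
      using pM_derived[OF M_square[OF mu_in_M]] by simp
    then show ?thesis using mult[OF zeta_in_M zeta_in_M] one[OF zeta_square] by simp
  qed
  moreover have "g [^]\<^bsub>M_ab a\<^esub> (4::nat) = (g \<otimes>\<^bsub>M_ab a\<^esub> g) \<otimes>\<^bsub>M_ab a\<^esub> (g \<otimes>\<^bsub>M_ab a\<^esub> g)"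
    using g by (simp add: eval_nat_numeral A.m_assoc)
  ultimately have g4: "g [^]\<^bsub>M_ab a\<^esub> (4::nat) = \<one>\<^bsub>M_ab a\<^esub>"
    using mult[OF mu_in_M mu_in_M] by (simp add: g_def)
  have Lg: "Lam g = star_embed (lam a mu, 1)"
    by (simp add: g_def Lam_apply star_map_mu)
  have Lc: "star_embed p \<in> carrier Q2Z2" for p by (rule star_embed_in)
  have "Lam g [^]\<^bsub>Q2Z2\<^esub> (2::nat) \<noteq> \<one>\<^bsub>Q2Z2\<^esub>"
    using Lc[of "(lam a mu, 1)"] half_not_one
    by (simp add: Lg eval_nat_numeral star_embed_square F2_embed_1)
  then have not2: "\<not> Q2Z2.ord (Lam g) dvd 2"
    using Q2Z2.pow_eq_id[of "Lam g" 2] g by simp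
  have "Lam g [^]\<^bsub>Q2Z2\<^esub> (4::nat) = \<one>\<^bsub>Q2Z2\<^esub>"
    using g g4 L.hom_nat_pow[of g 4] by simp
  then have "Q2Z2.ord (Lam g) dvd 4"
    using Q2Z2.pow_eq_id[of "Lam g" 4] g by simp
  moreover have "d = 4" if "d dvd 4" "\<not> d dvd 2" for d :: nat
  proof -
    have "d \<le> 4" using that(1) by (rule dvd_imp_le) simp
    then have "d \<in> {0, 1, 2, 3, 4}" by auto
    with that show ?thesis by auto
  qed
  ultimately have ordL: "Q2Z2.ord (Lam g) = 4" using not2 by blast
  have "Lam g [^]\<^bsub>Q2Z2\<^esub> A.ord g = \<one>\<^bsub>Q2Z2\<^esub>"
    using g L.hom_nat_pow[of g "A.ord g"] by (simp add: A.pow_ord_eq_1)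
  then have "4 dvd A.ord g"
    using Q2Z2.pow_eq_id[of "Lam g" "A.ord g"] g ordL by simp
  moreover have "A.ord g dvd 4" using g g4 A.pow_eq_id[of g 4] by simp
  ultimately have ord: "A.ord g = 4" by (simp add: dvd_antisym)
  have surj: "\<exists>k::nat. Lam x = Lam g [^]\<^bsub>Q2Z2\<^esub> k" if x: "x \<in> carrier (M_ab a)" for x
  proof -
    obtain m where m: "m \<in> M_set a" "x = pM m"
      using x by (auto simp: M_ab_def M.carrier_ab)
    let ?u = "(lam a mu, 1)"
    have h: "star_embed (p \<otimes>\<^bsub>star_group\<^esub> p') = star_embed p \<otimes>\<^bsub>Q2Z2\<^esub> star_embed p'" for p p'
      by (rule hom_mult[OF star_embed_hom]) (simp_all add: star_group_def)
    have z: "star_embed (0, 0) = \<one>\<^bsub>Q2Z2\<^esub>"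
      by (simp add: star_embed_def Q2Z2_of_eq_one_iff)
    have 1: "Lam g [^]\<^bsub>Q2Z2\<^esub> (0::nat) = star_embed (0, 0)" using z by simp
    have 2: "Lam g [^]\<^bsub>Q2Z2\<^esub> (1::nat) = star_embed ?u"
      using Lc[of ?u] by (simp add: Lg)
    have 3: "Lam g [^]\<^bsub>Q2Z2\<^esub> (2::nat) = star_embed (?u \<otimes>\<^bsub>star_group\<^esub> ?u)"
      using Lc[of ?u] by (simp add: Lg h eval_nat_numeral)
    have 4: "Lam g [^]\<^bsub>Q2Z2\<^esub> (3::nat) = star_embed (?u \<otimes>\<^bsub>star_group\<^esub> ?u \<otimes>\<^bsub>star_group\<^esub> ?u)"
      using Lc[of ?u] by (simp add: Lg h eval_nat_numeral)
    have "Lam x = star_embed (star_map a m)" using m by (simp add: Lam_apply)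
    then show ?thesis
      using star_powers[of "star_map a m" "lam a mu"] 1 2 3 4
      by (metis empty_iff insert_iff)
  qed
  let ?A = "generate (M_ab a) {g}" and ?B = "kernel (M_ab a) Q2Z2 Lam"
  have compl: "?A \<inter> ?B = {\<one>\<^bsub>M_ab a\<^esub>}" "?A <#>\<^bsub>M_ab a\<^esub> ?B = carrier (M_ab a)"
    using L.cyclic_complement[of g, OF g _ _ surj] ord ordL by simp_all
  have card: "card ?A = 4" using A.generate_pow_card[OF g] ord by simp
  have subA: "subgroup ?A (M_ab a)" using g by (intro A.generate_is_subgroup) simp
  have "closedin (M_ab_top a) ?A"
    unfolding M_ab_top_def
  proof (rule M.finite_closedin_ab_top)
    show "finite ?A" using card by (metis card.infinite zero_neq_numeral)
    show "?A \<subseteq> carrier (ab (M_top a) (M_group a))"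
      using subgroup.subset[OF subA] by (simp add: M_ab_def)
  qed (simp add: continuous_map_M_mult_right del: mult_M_group)
  moreover have "closedin (M_ab_top a) ?B"
    unfolding M_ab_top_def
  proof (rule M.closedin_ab_top)
    show "?B \<subseteq> carrier (ab (M_top a) (M_group a))" by (auto simp: kernel_def M_ab_def)
    have "continuous_map (M_top a) (discrete_topology UNIV) (\<lambda>m. Lam (pM m))"
      using Lam_in_dual by (simp add: M_dual_eq M.ab_dual_iff)
    then have "closedin (M_top a) {m \<in> topspace (M_top a). Lam (pM m) \<in> {\<one>\<^bsub>Q2Z2\<^esub>}}"
      by (rule closedin_continuous_map_preimage) simp
    also have "{m \<in> topspace (M_top a). Lam (pM m) \<in> {\<one>\<^bsub>Q2Z2\<^esub>}} = {m \<in> carrier (M_group a). pM m \<in> ?B}"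
      using M.ab_proj_in_ab[of _ a] by (auto simp: kernel_def M_ab_def)
    finally show "closedin (M_top a) {m \<in> carrier (M_group a). pM m \<in> ?B}" .
  qed
  ultimately show ?thesis
    unfolding has_cyclic_summand_def using subA L.subgroup_kernel compl card g by blast
qed

lemma Lam_square:
  assumes "a 0 = 1"
  shows "Lam \<otimes>\<^bsub>M_dual a\<^esub> Lam = F2_character a (phi 0)"
proof -
  interpret D: comm_group "M_dual a" by (rule comm_group_M_dual)
  show ?thesis
  proof (rule dual_eqI)
    show "Lam \<otimes>\<^bsub>M_dual a\<^esub> Lam \<in> carrier (M_dual a)"
      using Lam_in_dual by (intro D.m_closed)
    show "F2_character a (phi 0) \<in> carrier (M_dual a)"
      using phi_0_hom_M continuous_phi_0 by (rule F2_character_in_dual)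
    fix m assume m: "m \<in> M_set a"
    have "Lam (pM m) = star_embed (star_map a m)"
      using star_character_apply[OF star_map_hom[OF assms] continuous_star_map m] assms
      by (simp add: Lam_def)
    then show "(Lam \<otimes>\<^bsub>M_dual a\<^esub> Lam) (pM m) = F2_character a (phi 0) (pM m)"
      using m F2_character_apply[OF phi_0_hom_M continuous_phi_0 m]
      by (simp add: dual_mult_apply star_embed_square star_map_eq_lam)
  qed
qed

text \<open>By \<open>dual_square\<close>, characters with the same value at \<open>zeta\<close>
  have the same double. A nontrivial double forces this value to be 1/2, the value of
  \<open>Lam\<close>.\<close>

lemma dual_squares:
  assumes "a 0 = 1"
  shows "{\<psi> \<otimes>\<^bsub>M_dual a\<^esub> \<psi> | \<psi>. \<psi> \<in> carrier (M_dual a)} - {\<one>\<^bsub>M_dual a\<^esub>} =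
    {F2_character a (phi 0)}"
proof -
  interpret D: comm_group "M_dual a" by (rule comm_group_M_dual)
  have sq: "(\<psi> \<otimes>\<^bsub>M_dual a\<^esub> \<psi>) (pM m) =
    (if m \<otimes>\<^bsub>Omega\<^esub> m \<in> M_derived a then \<one>\<^bsub>Q2Z2\<^esub> else \<psi> (pM zeta))"
    if "\<psi> \<in> carrier (M_dual a)" "m \<in> M_set a" for \<psi> m
    using that dual_square[OF that] by (simp add: dual_mult_apply)
  have eq: "\<psi> \<otimes>\<^bsub>M_dual a\<^esub> \<psi> = F2_character a (phi 0)"
    if \<psi>: "\<psi> \<in> carrier (M_dual a)" and ne: "\<psi> \<otimes>\<^bsub>M_dual a\<^esub> \<psi> \<noteq> \<one>\<^bsub>M_dual a\<^esub>" for \<psi>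
  proof -
    have "\<psi> (pM zeta) \<noteq> \<one>\<^bsub>Q2Z2\<^esub>"
    proof
      assume "\<psi> (pM zeta) = \<one>\<^bsub>Q2Z2\<^esub>"
      then have "\<psi> \<otimes>\<^bsub>M_dual a\<^esub> \<psi> = \<one>\<^bsub>M_dual a\<^esub>"
        using \<psi> by (intro dual_eqI D.m_closed D.one_closed) (simp_all add: sq dual_one_apply)
      with ne show False by contradiction
    qed
    then have z: "\<psi> (pM zeta) = Lam (pM zeta)"
      using dual_zeta[OF \<psi>] Lam_zeta by simp
    have "\<psi> \<otimes>\<^bsub>M_dual a\<^esub> \<psi> = Lam \<otimes>\<^bsub>M_dual a\<^esub> Lam"
      using \<psi> Lam_in_dual z by (intro dual_eqI D.m_closed) (simp_all add: sq)
    then show ?thesis using Lam_square[OF assms] by simp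
  qed
  have ne: "F2_character a (phi 0) \<noteq> \<one>\<^bsub>M_dual a\<^esub>"
  proof
    assume "F2_character a (phi 0) = \<one>\<^bsub>M_dual a\<^esub>"
    \<comment> \<open>\<open>mu\<close> lies in \<open>M\<close> and swaps the branches, so it
      witnesses that \<open>phi 0\<close> does not vanish on \<open>M\<close>.\<close>
    then have "F2_embed (phi 0 mu) = \<one>\<^bsub>Q2Z2\<^esub>"
      using F2_character_apply[OF phi_0_hom_M continuous_phi_0 mu_in_M] dual_one_apply[OF mu_in_M]
      by simp
    then show False by (simp add: F2_embed_eq_one_iff)
  qed
  show ?thesis
  proof (intro equalityI subsetI)
    fix \<theta> assume "\<theta> \<in> {\<psi> \<otimes>\<^bsub>M_dual a\<^esub> \<psi> | \<psi>. \<psi> \<in> carrier (M_dual a)} - {\<one>\<^bsub>M_dual a\<^esub>}"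
    then obtain \<psi> where \<psi>: "\<theta> = \<psi> \<otimes>\<^bsub>M_dual a\<^esub> \<psi>" "\<psi> \<in> carrier (M_dual a)" "\<theta> \<noteq> \<one>\<^bsub>M_dual a\<^esub>"
      by (elim DiffE CollectE exE conjE) (simp only: singleton_iff not_False_eq_True)
    show "\<theta> \<in> {F2_character a (phi 0)}"
      unfolding \<psi>(1) using eq[OF \<psi>(2) \<psi>(3)[unfolded \<psi>(1)]] by (simp only: singleton_iff)
  next
    fix \<theta> assume "\<theta> \<in> {F2_character a (phi 0)}"
    then have \<theta>: "\<theta> = Lam \<otimes>\<^bsub>M_dual a\<^esub> Lam" "\<theta> \<noteq> \<one>\<^bsub>M_dual a\<^esub>"
      using Lam_square[OF assms] ne by (simp_all only: singleton_iff not_False_eq_True)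
    then show "\<theta> \<in> {\<psi> \<otimes>\<^bsub>M_dual a\<^esub> \<psi> | \<psi>. \<psi> \<in> carrier (M_dual a)} - {\<one>\<^bsub>M_dual a\<^esub>}"
      using Lam_in_dual by (intro DiffI CollectI exI[of _ Lam] conjI) (simp_all only: singleton_iff not_False_eq_True)
  qed
qed

end

theorem theorem3p2:
  fixes a :: "nat \<Rightarrow> bit"
  assumes "finite {i. a i \<noteq> 0}"
    and "a \<noteq> (\<lambda>_. 0)"
    and "a \<noteq> (\<lambda>i. if i = 0 then 1 else 0)"
  shows "card (kernel (M_ab a) Omega_ab (M_ab_map a)) = 2 \<and>
    (a 0 = 0 \<longrightarrow>
      F2_vector_space (M_ab a) \<and>
      character_x a \<in> hom (M_group a) (add_monoid F2) \<and>
      continuous_map (M_top a) (discrete_topology UNIV) (character_x a) \<and>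
      F2_character a (character_x a) \<in> carrier (M_dual a) \<and>
      F2_character a (character_x a) \<notin> restricted_characters a \<and>
      (\<forall>\<psi>\<in>carrier (M_dual a). \<psi> \<notin> restricted_characters a \<longrightarrow>
         restricted_characters a #>\<^bsub>M_dual a\<^esub> \<psi> =
         restricted_characters a #>\<^bsub>M_dual a\<^esub> F2_character a (character_x a)) \<and>
      generate (M_dual a Mod restricted_characters a)
         {restricted_characters a #>\<^bsub>M_dual a\<^esub> F2_character a (character_x a)} =
      carrier (M_dual a Mod restricted_characters a)) \<and>
    (a 0 = 1 \<longrightarrow>
      has_cyclic_summand (M_ab_top a) (M_ab a) 4 \<and>
      star_group \<cong> integer_mod_group 4 \<and>
      star_map a \<in> hom (M_group a) star_group \<and>
      continuous_map (M_top a) (discrete_topology UNIV) (star_map a) \<and>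
      star_map a ` carrier (M_group a) = carrier star_group \<and>
      (\<forall>f. f \<in> hom (M_group a) star_group \<and>
           continuous_map (M_top a) (discrete_topology UNIV) f \<and>
           f ` carrier (M_group a) = carrier star_group \<longrightarrow>
         restricted_characters a #>\<^bsub>M_dual a\<^esub> star_character a f =
         restricted_characters a #>\<^bsub>M_dual a\<^esub> star_character a (star_map a)) \<and>
      star_character a (star_map a) \<in> carrier (M_dual a) \<and>
      star_character a (star_map a) \<otimes>\<^bsub>M_dual a\<^esub> star_character a (star_map a) =
        F2_character a (phi 0) \<and>
      (\<forall>\<sigma>\<in>carrier (M_group a). (\<Sum>i\<in>{i. 1 \<le> i \<and> a i \<noteq> 0}. a i * phi i \<sigma>) = phi 0 \<sigma>) \<and>
      {\<psi> \<otimes>\<^bsub>M_dual a\<^esub> \<psi> | \<psi>. \<psi> \<in> carrier (M_dual a)} - {\<one>\<^bsub>M_dual a\<^esub>} =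
        {F2_character a (phi 0)})"
proof -
  interpret nontrivial_sequence a
    using assms by unfold_locales
  have case0: "Lam = F2_character a (character_x a)" if "a 0 = 0"
    using that by (simp add: Lam_def)
  have case1: "Lam = star_character a (star_map a)" if "a 0 = 1"
    using that by (simp add: Lam_def)
  show ?thesis
  proof (intro conjI impI ballI allI; (elim conjE)?)
    show "card (kernel (M_ab a) Omega_ab (M_ab_map a)) = 2" by (rule card_kernel)
  next
    assume a0: "a 0 = 0"
    note L = case0[OF a0]
    show "F2_vector_space (M_ab a)" using a0 by (rule F2_vector_space_M_ab)
    show "character_x a \<in> hom (M_group a) (add_monoid F2)" using a0 by (rule character_x_hom)
    show "continuous_map (M_top a) (discrete_topology UNIV) (character_x a)"
      using a0 by (rule continuous_character_x)
    show "F2_character a (character_x a) \<in> carrier (M_dual a)" using Lam_in_dual by (simp add: L)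
    show "F2_character a (character_x a) \<notin> restricted_characters a"
      using Lam_not_restricted by (simp add: L)
    show "restricted_characters a #>\<^bsub>M_dual a\<^esub> \<psi> =
      restricted_characters a #>\<^bsub>M_dual a\<^esub> F2_character a (character_x a)"
      if "\<psi> \<in> carrier (M_dual a)" "\<psi> \<notin> restricted_characters a" for \<psi>
      using not_restricted_coset[OF that] by (simp add: L)
    show "generate (M_dual a Mod restricted_characters a)
      {restricted_characters a #>\<^bsub>M_dual a\<^esub> F2_character a (character_x a)} =
      carrier (M_dual a Mod restricted_characters a)"
      using generate_dual_quotient by (simp add: L)
  next
    assume a0: "a 0 = 1"
    note L = case1[OF a0]
    show "has_cyclic_summand (M_ab_top a) (M_ab a) 4" using a0 by (rule has_cyclic_summand_M_ab)
    show "star_group \<cong> integer_mod_group 4" by (rule star_group_iso)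
    show "star_map a \<in> hom (M_group a) star_group" using a0 by (rule star_map_hom)
    show "continuous_map (M_top a) (discrete_topology UNIV) (star_map a)" by (rule continuous_star_map)
    show "star_map a ` carrier (M_group a) = carrier star_group" using a0 by (rule star_map_surj)
    show "restricted_characters a #>\<^bsub>M_dual a\<^esub> star_character a f =
      restricted_characters a #>\<^bsub>M_dual a\<^esub> star_character a (star_map a)"
      if "f \<in> hom (M_group a) star_group" "continuous_map (M_top a) (discrete_topology UNIV) f"
        "f ` carrier (M_group a) = carrier star_group" for f
      using restricted_coset_eqI[OF star_character_in_dual[OF that(1,2)] Lam_in_dual]
        star_character_zeta[OF that] Lam_zeta by (simp add: L)
    show "star_character a (star_map a) \<in> carrier (M_dual a)" using Lam_in_dual by (simp add: L)
    show "star_character a (star_map a) \<otimes>\<^bsub>M_dual a\<^esub> star_character a (star_map a) =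
      F2_character a (phi 0)"
      using Lam_square[OF a0] by (simp add: L)
    show "(\<Sum>i\<in>{i. 1 \<le> i \<and> a i \<noteq> 0}. a i * phi i \<sigma>) = phi 0 \<sigma>"
      if "\<sigma> \<in> carrier (M_group a)" for \<sigma>
      using phi_sum1_M[of \<sigma>] that a0 by (simp add: phi_sum1_def)
    show "{\<psi> \<otimes>\<^bsub>M_dual a\<^esub> \<psi> | \<psi>. \<psi> \<in> carrier (M_dual a)} - {\<one>\<^bsub>M_dual a\<^esub>} =
      {F2_character a (phi 0)}"
      using a0 by (rule dual_squares)
  qed
qed

end
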